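(* Let $F$ be a finite field of characteristic two and let $G$ and $H$ be non-abelian $2$-groups of order at most $2^4$. If $V_*(FG)\cong V_*(FH)$ (as groups), then $G\cong H$.
   Context: For a finite $2$-group $G$ and a finite field $F$ of characteristic two, $FG$ is the group algebra, and $*$ is the classical involution of $FG$, i.e. the $F$-linear extension of $g\mapsto g^{-1}$ ($g\in G$). $V(FG)$ is the group of normalized units of $FG$ (units whose coefficients sum to $1$). $V_*(FG)=\{u\in V(FG) : u^*=u^{-1}\}$ is the $*$-unitary subgroup. *)

theory Defs
  imports "HOL-Algebra.Coset" "HOL-Algebra.Ring"
begin

text \<open>
  The coefficient field is a type, the group a carrier-based structure. An element of the group
  algebra of a finite group \<open>G\<close> is its coefficient function, taken to be \<open>0\<close> outside
  \<open>carrier G\<close> so that equality of elements is equality of functions; for infinite \<open>G\<close> the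
  definition is not meaningful.
\<close>

definition group_algebra ::
    "'f::comm_ring_1 itself \<Rightarrow> ('g, 'm) monoid_scheme \<Rightarrow> ('g \<Rightarrow> 'f) ring" where
  "group_algebra F G =
     \<lparr> carrier = {a. \<forall>g. g \<notin> carrier G \<longrightarrow> a g = 0},
       monoid.mult = (\<lambda>a b g. if g \<in> carrier G
                then \<Sum>h\<in>carrier G. a h * b (inv\<^bsub>G\<^esub> h \<otimes>\<^bsub>G\<^esub> g) else 0),
       one = (\<lambda>g. if g = \<one>\<^bsub>G\<^esub> then 1 else 0),
       zero = (\<lambda>g. 0),
       add = (\<lambda>a b g. a g + b g) \<rparr>"

text \<open>The linear extension of \<open>g \<mapsto> g\<^sup>-\<^sup>1\<close> puts at \<open>g\<close> the coefficient that \<open>a\<close> has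
  at \<open>g\<^sup>-\<^sup>1\<close>.\<close>

definition star :: "('g, 'm) monoid_scheme \<Rightarrow> ('g \<Rightarrow> 'f::zero) \<Rightarrow> 'g \<Rightarrow> 'f" where
  "star G a = (\<lambda>g. if g \<in> carrier G then a (inv\<^bsub>G\<^esub> g) else 0)"

definition augmentation :: "('g, 'm) monoid_scheme \<Rightarrow> ('g \<Rightarrow> 'f::comm_monoid_add) \<Rightarrow> 'f" where
  "augmentation G a = (\<Sum>g\<in>carrier G. a g)"

definition normalized_units ::
    "'f::comm_ring_1 itself \<Rightarrow> ('g, 'm) monoid_scheme \<Rightarrow> ('g \<Rightarrow> 'f) monoid" where
  "normalized_units F G =
     (units_of (group_algebra F G))
       \<lparr>carrier := {u \<in> Units (group_algebra F G). augmentation G u = 1}\<rparr>"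

definition unitary_subgroup ::
    "'f::comm_ring_1 itself \<Rightarrow> ('g, 'm) monoid_scheme \<Rightarrow> ('g \<Rightarrow> 'f) monoid" where
  "unitary_subgroup F G =
     (normalized_units F G)
       \<lparr>carrier := {u \<in> carrier (normalized_units F G).
                      star G u = inv\<^bsub>normalized_units F G\<^esub> u}\<rparr>"

definition two_group :: "('g, 'm) monoid_scheme \<Rightarrow> bool" where
  "two_group G \<longleftrightarrow> group G \<and> (\<exists>n. order G = 2 ^ n)"

end

theory Submission
  imports Defs "HOL-Library.Function_Algebras" "HOL-Algebra.Group_Action"
    "HOL-Algebra.Multiplicative_Group" "HOL-Computational_Algebra.Primes"
begin

text \<open>
  There are eleven non-abelian groups of order \<open>8\<close> or \<open>16\<close>. Eight of them satisfy
  \<open>|G / Z(G)| = 4\<close> and are determined by \<open>Z(G)\<close>, the commutator \<open>c\<close> of two generators and the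
  squares of these generators; the other three have a cyclic subgroup of index two that an outer
  element acts on by \<open>a \<mapsto> a\<^sup>-\<^sup>1\<close> or \<open>a \<mapsto> a\<^sup>3\<close>. Their unitary subgroups \<open>V\<^sub>*(FG)\<close> are told
  apart by properties that do not depend on \<open>|F|\<close>: whether the exponent divides four, whether
  squares are central, whether the involutions commute, are central, generate the group, or have
  products of order dividing four, and whether the centre is elementary. Only for \<open>D\<^sub>8\<close> against
  \<open>D\<^sub>8 \<times> C\<^sub>2\<close> and \<open>Q\<^sub>8\<close> against \<open>Q\<^sub>8 \<times> C\<^sub>2\<close> the orders of the unitary subgroups are compared.

  Involutions of \<open>V\<^sub>*(FG)\<close> are elements fixed by \<open>*\<close>. In characteristic two a sum over a set with a
  value-preserving involution reduces to its fixed points; this evaluates squares and commutators of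
  such elements, exactly or modulo the ideal \<open>(1 + c) FG\<close> of square zero, for a central involution
  \<open>c\<close> of \<open>G\<close>.
\<close>

section \<open>Group algebras as functions under convolution\<close>

text \<open>An isomorphism of unitary subgroups need not respect \<open>star\<close> or the
  augmentation, and \<open>F\<close> ranges over infinitely many fields, so every separating
  property has to be purely group-theoretic and be proved without enumeration. Most failures of a
  property are cheap: \<open>G\<close> sits inside \<open>V\<close> as the elements
  \<open>single g\<close>, so a counterexample in \<open>G\<close> is one in \<open>V\<close>. In
  \<open>C22_C4\<close> and \<open>C4_C4\<close> the involutions of \<open>G\<close> commute, and
  the extra involution \<open>1 + b + b^-1\<close> is needed. Positive statements must cover all of
  \<open>V\<close>; they rest on class functions, which are exactly the central elements of
  \<open>FG\<close>. When commutators lie in \<open>{1, c}\<close>, all squares in \<open>FG\<close>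
  are class functions, and the square of a class function sees only coefficients on the centre. For
  the dihedral, semidihedral and quaternion groups of order 16 this breaks down, and an abelian
  subgroup of index two replaces it. Exact orders of \<open>V\<close> are avoided: with
  \<open>q\<close> elements in \<open>F\<close>, the bounds \<open>|V| < q^8\<close> for order 8 and
  \<open>q^16 <= |V|^2\<close> for the two groups of order 16 already exclude an
  isomorphism.\<close>

lemma CHAR_2_add_self:
  assumes "CHAR('a::ring_1) = 2" shows "(x::'a) + x = 0"
  using assms by (metis add.right_inverse uminus_CHAR_2)

text \<open>An orbit \<open>{s, \<theta> s}\<close> of length two contributes
  \<open>f s + f s = 0\<close>; induction on the cardinality removes one such orbit at a
  time.\<close>

lemma sum_CHAR_2_involution:
  fixes f :: "'b \<Rightarrow> 'a::ring_1"
  assumes char: "CHAR('a) = 2" and "finite S"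
    and \<theta>: "\<And>s. s \<in> S \<Longrightarrow> \<theta> s \<in> S" "\<And>s. s \<in> S \<Longrightarrow> \<theta> (\<theta> s) = s" "\<And>s. s \<in> S \<Longrightarrow> f (\<theta> s) = f s"
  shows "sum f S = sum f {s \<in> S. \<theta> s = s}"
  using \<open>finite S\<close> \<theta>
proof (induction "card S" arbitrary: S rule: less_induct)
  case less
  show ?case
  proof (cases "\<exists>s\<in>S. \<theta> s \<noteq> s")
    case False
    then have "{s \<in> S. \<theta> s = s} = S" by auto
    then show ?thesis by simp
  next
    case True
    then obtain s where s: "s \<in> S" "\<theta> s \<noteq> s" by auto
    define T where "T = S - {s, \<theta> s}"
    have S: "S = insert s (insert (\<theta> s) T)" "s \<notin> insert (\<theta> s) T" "\<theta> s \<notin> T" "finite T"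
      using s less.prems(1) less.prems(2)[OF s(1)] by (auto simp: T_def)
    have cT: "card T < card S" using S by simp
    have TS: "x \<in> S" if "x \<in> T" for x using that by (simp add: T_def)
    have "sum f T = sum f {x \<in> T. \<theta> x = x}"
    proof (rule less.hyps[OF cT])
      fix x assume x: "x \<in> T"
      have "\<theta> x \<noteq> s" "\<theta> x \<noteq> \<theta> s"
        using x less.prems(3)[OF TS[OF x]] less.prems(3)[OF s(1)] by (auto simp: T_def)
      then show "\<theta> x \<in> T" using x less.prems(2)[of x] by (simp add: T_def)
    qed (use less.prems(3,4)[OF TS] S(4) in blast)+
    moreover have "{x \<in> T. \<theta> x = x} = {x \<in> S. \<theta> x = x}"
      using s less.prems(3)[OF s(1)] by (auto simp: T_def)
    moreover have "sum f S = f s + (f (\<theta> s) + sum f T)"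
      using S by (metis finite_insert sum.insert)
    moreover have "f s + (f (\<theta> s) + sum f T) = sum f T"
      using less.prems(4)[OF s(1)] by (metis CHAR_2_add_self[OF char] add.assoc add_0)
    ultimately show ?thesis by simp
  qed
qed

section \<open>The centre and products lying in it\<close>

definition center :: "('g, 'm) monoid_scheme \<Rightarrow> 'g set" where
  "center M = {x \<in> carrier M. \<forall>y\<in>carrier M. x \<otimes>\<^bsub>M\<^esub> y = y \<otimes>\<^bsub>M\<^esub> x}"

lemma center_closed: "z \<in> center M \<Longrightarrow> z \<in> carrier M"
  unfolding center_def by blast

lemma center_commute: "z \<in> center M \<Longrightarrow> y \<in> carrier M \<Longrightarrow> z \<otimes>\<^bsub>M\<^esub> y = y \<otimes>\<^bsub>M\<^esub> z"
  unfolding center_def by blast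

lemma centerI:
  "z \<in> carrier M \<Longrightarrow> (\<And>y. y \<in> carrier M \<Longrightarrow> z \<otimes>\<^bsub>M\<^esub> y = y \<otimes>\<^bsub>M\<^esub> z) \<Longrightarrow> z \<in> center M"
  unfolding center_def by blast

context group
begin

text \<open>\<open>h g\<close> is a conjugate of \<open>g h\<close>, and a central element is its
  own conjugate. Contrapositively, noncommuting elements have a noncentral product.\<close>

lemma central_product_commute:
  assumes "g \<in> carrier G" "h \<in> carrier G" "g \<otimes> h \<in> center G" shows "h \<otimes> g = g \<otimes> h"
proof -
  have "h \<otimes> g = inv g \<otimes> (g \<otimes> h \<otimes> g)" using assms(1,2) by (simp add: m_assoc inv_solve_left)
  also have "g \<otimes> h \<otimes> g = g \<otimes> (g \<otimes> h)" using center_commute[OF assms(3,1)] by simp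
  finally show ?thesis using assms(1,2) by (simp add: m_assoc[symmetric])
qed

lemma central_product_iff:
  "g \<in> carrier G \<Longrightarrow> h \<in> carrier G \<Longrightarrow> z \<in> center G \<Longrightarrow> g \<otimes> h = z \<longleftrightarrow> h \<otimes> g = z"
  using central_product_commute by metis

lemma center_mult: "z \<in> center G \<Longrightarrow> w \<in> center G \<Longrightarrow> z \<otimes> w \<in> center G"
proof (rule centerI)
  fix y assume z: "z \<in> center G" and w: "w \<in> center G" and y: "y \<in> carrier G"
  have "z \<otimes> w \<otimes> y = z \<otimes> (y \<otimes> w)"
    using center_closed[OF z] center_closed[OF w] center_commute[OF w y] y by (simp add: m_assoc)
  also have "\<dots> = y \<otimes> z \<otimes> w"
    using center_closed[OF z] center_closed[OF w] center_commute[OF z y] y by (simp add: m_assoc[symmetric])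
  finally show "z \<otimes> w \<otimes> y = y \<otimes> (z \<otimes> w)"
    using center_closed[OF z] center_closed[OF w] y by (simp add: m_assoc)
qed (simp add: center_closed)

lemma center_inv: assumes z: "z \<in> center G" shows "inv z \<in> center G"
proof (rule centerI)
  fix y assume "y \<in> carrier G"
  then show "inv z \<otimes> y = y \<otimes> inv z"
    using center_closed[OF z] center_commute[OF z, of "inv y"] by (metis inv_closed inv_inv inv_mult_group)
qed (simp add: center_closed z)

lemma center_mult_iff: "z \<in> center G \<Longrightarrow> g \<in> carrier G \<Longrightarrow> z \<otimes> g \<in> center G \<longleftrightarrow> g \<in> center G"
proof
  assume z: "z \<in> center G" and g: "g \<in> carrier G" and zg: "z \<otimes> g \<in> center G"
  have "inv z \<otimes> (z \<otimes> g) \<in> center G" by (rule center_mult[OF center_inv[OF z] zg])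
  then show "g \<in> center G" using center_closed[OF z] g by (simp add: m_assoc[symmetric])
qed (rule center_mult)

lemma one_center: "\<one> \<in> center G"
  by (rule centerI) simp_all

end

text \<open>The product is separated from the record so that elements are plain functions, added by
  the pointwise \<open>+\<close>.\<close>

definition conv :: "('g, 'm) monoid_scheme \<Rightarrow> ('g \<Rightarrow> 'f::comm_ring_1) \<Rightarrow> ('g \<Rightarrow> 'f) \<Rightarrow> 'g \<Rightarrow> 'f" where
  "conv G = monoid.mult (group_algebra TYPE('f) G)"

definition single :: "'g \<Rightarrow> 'g \<Rightarrow> 'f::zero_neq_one" where
  "single g = (\<lambda>h. if h = g then 1 else 0)"

definition supported :: "('g, 'm) monoid_scheme \<Rightarrow> ('g \<Rightarrow> 'f::zero) set" where
  "supported G = {x. \<forall>g. g \<notin> carrier G \<longrightarrow> x g = 0}"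

text \<open>Replaces the inverse taken in \<open>normalized_units\<close> by two equations in
  \<open>FG\<close>; \<open>carrier_unitary\<close> identifies this set with the carrier of the
  unitary subgroup.\<close>

definition unitaries :: "('g, 'm) monoid_scheme \<Rightarrow> ('g \<Rightarrow> 'f::comm_ring_1) set" where
  "unitaries G = {x \<in> supported G. augmentation G x = 1 \<and>
     conv G x (star G x) = single \<one>\<^bsub>G\<^esub> \<and> conv G (star G x) x = single \<one>\<^bsub>G\<^esub>}"

section \<open>Convolution, the involution and the unitary subgroup of a finite group\<close>

locale finite_group = group +
  assumes finite_carrier [simp, intro]: "finite (carrier G)"
begin

abbreviation cv :: "('a \<Rightarrow> 'f::comm_ring_1) \<Rightarrow> ('a \<Rightarrow> 'f) \<Rightarrow> 'a \<Rightarrow> 'f" (infixl \<open>\<star>\<close> 70)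
  where "x \<star> y \<equiv> conv G x y"

lemma conv_apply: "k \<in> carrier G \<Longrightarrow> (x \<star> y) k = (\<Sum>h\<in>carrier G. x h * y (inv h \<otimes> k))"
  and conv_outside: "k \<notin> carrier G \<Longrightarrow> (x \<star> y) k = 0"
  by (simp_all add: conv_def group_algebra_def)

lemma conv_supported [simp]: "x \<star> y \<in> supported G"
  by (simp add: supported_def conv_outside)

text \<open>The factorisations of \<open>k\<close> are the index set on which the later
  cancellations act, by swapping the two factors or multiplying them by central elements.\<close>

lemma conv_pairs:
  assumes k: "k \<in> carrier G"
  shows "(x \<star> y) k = (\<Sum>(g, h) \<in> {(g, h) \<in> carrier G \<times> carrier G. g \<otimes> h = k}. x g * y h)"
proof -
  have "(\<Sum>h\<in>carrier G. x h * y (inv h \<otimes> k)) =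
      (\<Sum>p \<in> {(g, h) \<in> carrier G \<times> carrier G. g \<otimes> h = k}. x (fst p) * y (snd p))"
    using k by (intro sum.reindex_bij_witness[where i = fst and j = "\<lambda>h. (h, inv h \<otimes> k)"])
      (auto simp: m_assoc[symmetric])
  then show ?thesis by (simp add: conv_apply[OF k] case_prod_unfold)
qed

lemma conv_pairs':
  assumes k: "k \<in> carrier G"
  shows "(x \<star> y) k = (\<Sum>h\<in>carrier G. x (k \<otimes> inv h) * y h)"
proof -
  have "(\<Sum>h\<in>carrier G. x (k \<otimes> inv h) * y h) =
      (\<Sum>p \<in> {(g, h) \<in> carrier G \<times> carrier G. g \<otimes> h = k}. x (fst p) * y (snd p))"
    using k by (intro sum.reindex_bij_witness[where i = snd and j = "\<lambda>h. (k \<otimes> inv h, h)"])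
      (auto simp: m_assoc)
  then show ?thesis by (simp add: conv_pairs[OF k] case_prod_unfold)
qed

lemma conv_add_left: "(x + y) \<star> z = x \<star> z + y \<star> z"
  and conv_add_right: "x \<star> (y + z) = x \<star> y + x \<star> z"
  by (auto simp: fun_eq_iff conv_def group_algebra_def algebra_simps sum.distrib)

lemma conv_zero_left [simp]: "0 \<star> z = 0" and conv_zero_right [simp]: "z \<star> 0 = 0"
  by (auto simp: fun_eq_iff conv_def group_algebra_def)

lemma conv_smult_left: "(\<lambda>g. a * x g) \<star> y = (\<lambda>g. a * (x \<star> y) g)"
  and conv_smult_right: "x \<star> (\<lambda>g. a * y g) = (\<lambda>g. a * (x \<star> y) g)"
  by (auto simp: fun_eq_iff conv_def group_algebra_def sum_distrib_left algebra_simps)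

lemma conv_assoc: "x \<star> y \<star> z = x \<star> (y \<star> z)"
proof
  fix k
  show "(x \<star> y \<star> z) k = (x \<star> (y \<star> z)) k"
  proof (cases "k \<in> carrier G")
    case k: True
    have "(x \<star> y \<star> z) k = (\<Sum>l\<in>carrier G. \<Sum>h\<in>carrier G. x h * y (inv h \<otimes> (k \<otimes> inv l)) * z l)"
      unfolding conv_pairs'[OF k] using k by (simp add: conv_apply sum_distrib_right)
    also have "\<dots> = (\<Sum>h\<in>carrier G. \<Sum>l\<in>carrier G. x h * (y (inv h \<otimes> k \<otimes> inv l) * z l))"
      using k by (subst sum.swap) (auto intro!: sum.cong simp: m_assoc mult.assoc)
    also have "\<dots> = (x \<star> (y \<star> z)) k"
      unfolding conv_apply[OF k] using k by (simp add: conv_pairs' sum_distrib_left)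
    finally show ?thesis .
  qed (simp add: conv_outside)
qed

lemma single_conv: "g \<in> carrier G \<Longrightarrow> (single g \<star> x) = (\<lambda>k. if k \<in> carrier G then x (inv g \<otimes> k) else 0)"
  by (auto simp: fun_eq_iff conv_apply conv_outside single_def if_distrib[of "\<lambda>u. u * _"] cong: if_cong)

lemma conv_single: "g \<in> carrier G \<Longrightarrow> (x \<star> single g) = (\<lambda>k. if k \<in> carrier G then x (k \<otimes> inv g) else 0)"
  by (auto simp: fun_eq_iff conv_pairs' conv_outside single_def if_distrib[of "\<lambda>u. _ * u"] cong: if_cong)

lemma supportedD: "x \<in> supported G \<Longrightarrow> g \<notin> carrier G \<Longrightarrow> x g = 0"
  by (simp add: supported_def)

lemma supported_add [simp]:
  "x \<in> supported G \<Longrightarrow> y \<in> supported G \<Longrightarrow> x + (y :: 'a \<Rightarrow> 'f::comm_ring_1) \<in> supported G"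
  by (simp add: supported_def)

lemma zero_supported [simp]: "0 \<in> supported G"
  by (simp add: supported_def)

lemma single_supported [simp]: "g \<in> carrier G \<Longrightarrow> single g \<in> supported G"
  by (auto simp: supported_def single_def)

lemma supported_eqI: "x \<in> supported G \<Longrightarrow> y \<in> supported G \<Longrightarrow> (\<And>k. k \<in> carrier G \<Longrightarrow> x k = y k) \<Longrightarrow> x = y"
  by (metis ext supportedD)

lemma conv_one_left [simp]: "x \<in> supported G \<Longrightarrow> single \<one> \<star> x = x"
  and conv_one_right [simp]: "x \<in> supported G \<Longrightarrow> x \<star> single \<one> = x"
  by (auto simp: single_conv conv_single supportedD)

lemma single_conv_single: "g \<in> carrier G \<Longrightarrow> h \<in> carrier G \<Longrightarrow> single g \<star> single h = single (g \<otimes> h)"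
  by (subst single_conv) (auto simp: single_def fun_eq_iff m_assoc[symmetric])

lemma star_supported [simp]: "star G x \<in> supported G"
  by (simp add: supported_def star_def)

lemma star_apply: "g \<in> carrier G \<Longrightarrow> star G x g = x (inv g)"
  by (simp add: star_def)

lemma star_star: "x \<in> supported G \<Longrightarrow> star G (star G x) = x"
  by (auto simp: fun_eq_iff star_def supportedD)

lemma star_add: "star G (x + y) = star G x + star G (y :: 'a \<Rightarrow> 'f::comm_ring_1)"
  by (auto simp: fun_eq_iff star_def)

lemma star_single: "g \<in> carrier G \<Longrightarrow> star G (single g) = single (inv g)"
  by (auto simp: fun_eq_iff star_def single_def)

lemma star_conv: "star G (x \<star> y) = star G y \<star> star G x"
proof (rule supported_eqI)
  fix k assume k: "k \<in> carrier G"
  have "star G (x \<star> y) k = (\<Sum>h\<in>carrier G. x h * y (inv h \<otimes> inv k))"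
    using k by (simp add: star_apply conv_apply)
  also have "\<dots> = (\<Sum>h\<in>carrier G. y (inv h \<otimes> inv k) * x h)" by (simp add: mult.commute)
  also have "\<dots> = (\<Sum>h\<in>carrier G. y (inv (k \<otimes> h)) * x h)"
    using k by (intro sum.cong) (auto simp: inv_mult_group)
  also have "\<dots> = (\<Sum>h\<in>carrier G. star G y (k \<otimes> inv h) * star G x h)"
    using k by (intro sum.reindex_bij_witness[where i = "\<lambda>h. inv h" and j = "\<lambda>h. inv h"])
      (auto simp: star_apply)
  also have "\<dots> = (star G y \<star> star G x) k" using k by (simp add: conv_pairs')
  finally show "star G (x \<star> y) k = (star G y \<star> star G x) k" .
qed simp_all

lemma augmentation_conv: "augmentation G (x \<star> y) = augmentation G x * augmentation G (y :: 'a \<Rightarrow> 'f::comm_ring_1)"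
proof -
  have "augmentation G (x \<star> y) = (\<Sum>h\<in>carrier G. \<Sum>k\<in>carrier G. x h * y (inv h \<otimes> k))"
    unfolding augmentation_def by (simp add: conv_apply) (rule sum.swap)
  also have "\<dots> = (\<Sum>h\<in>carrier G. \<Sum>k\<in>carrier G. x h * y k)"
    by (rule sum.cong, simp, intro sum.reindex_bij_witness[where i = "\<lambda>k. h \<otimes> k" and j = "\<lambda>k. inv h \<otimes> k" for h])
      (auto simp: m_assoc[symmetric])
  also have "\<dots> = augmentation G x * augmentation G y"
    by (simp add: augmentation_def sum_product)
  finally show ?thesis .
qed

lemma augmentation_single: "g \<in> carrier G \<Longrightarrow> augmentation G (single g) = 1"
  by (simp add: augmentation_def single_def)

lemma augmentation_add: "augmentation G (x + y) = augmentation G x + augmentation G y"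
  by (simp add: augmentation_def sum.distrib)

lemma augmentation_star: "augmentation G (star G x) = augmentation G x"
  unfolding augmentation_def
  by (intro sum.reindex_bij_witness[where i = "\<lambda>h. inv h" and j = "\<lambda>h. inv h"]) (auto simp: star_apply)

lemma group_algebra_simps:
  "carrier (group_algebra F G) = supported G"
  "x \<otimes>\<^bsub>group_algebra TYPE('f::comm_ring_1) G\<^esub> y = x \<star> y"
  "\<one>\<^bsub>group_algebra TYPE('f) G\<^esub> = single \<one>"
  by (simp_all add: group_algebra_def supported_def conv_def single_def)

lemma monoid_group_algebra: "monoid (group_algebra TYPE('f::comm_ring_1) G)"
  by unfold_locales (simp_all add: group_algebra_simps conv_assoc)

lemma group_normalized_units: "group (normalized_units TYPE('f::comm_ring_1) G)"
proof -
  let ?A = "group_algebra TYPE('f) G"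
  interpret A: monoid ?A by (rule monoid_group_algebra)
  interpret U: group "units_of ?A" by (rule A.units_group)
  let ?S = "{u \<in> Units ?A. augmentation G u = 1}"
  have "subgroup ?S (units_of ?A)"
  proof (rule U.subgroupI)
    show "?S \<subseteq> carrier (units_of ?A)" by (auto simp: units_of_carrier)
    have "\<one>\<^bsub>?A\<^esub> \<in> ?S" using A.Units_one_closed by (simp add: group_algebra_simps(3) augmentation_single)
    then show "?S \<noteq> {}" by blast
  next
    fix u assume u: "u \<in> ?S"
    then have "inv\<^bsub>?A\<^esub> u \<in> Units ?A" "u \<star> inv\<^bsub>?A\<^esub> u = single \<one>"
      by (auto simp: group_algebra_simps[symmetric])
    then have "augmentation G u * augmentation G (inv\<^bsub>?A\<^esub> u) = 1"
      by (metis augmentation_conv augmentation_single one_closed)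
    then show "inv\<^bsub>units_of ?A\<^esub> u \<in> ?S"
      using u \<open>inv\<^bsub>?A\<^esub> u \<in> Units ?A\<close> by (simp add: A.units_of_inv)
  next
    fix u v assume "u \<in> ?S" "v \<in> ?S"
    then show "u \<otimes>\<^bsub>units_of ?A\<^esub> v \<in> ?S"
      using A.Units_m_closed[of u v] by (simp add: units_of_mult group_algebra_simps(2) augmentation_conv)
  qed
  then show ?thesis using U.subgroup_imp_group by (simp add: normalized_units_def)
qed

lemma mult_unitary: "x \<otimes>\<^bsub>unitary_subgroup TYPE('f::comm_ring_1) G\<^esub> y = x \<star> y"
  and one_unitary: "\<one>\<^bsub>unitary_subgroup TYPE('f) G\<^esub> = single \<one>"
  by (simp_all add: unitary_subgroup_def normalized_units_def units_of_def group_algebra_simps)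

text \<open>If \<open>star G x\<close> is a two-sided inverse of \<open>x\<close>, both are units,
  and both have augmentation one by \<open>augmentation_star\<close>; uniqueness of inverses
  identifies the two descriptions.\<close>

lemma carrier_unitary: "carrier (unitary_subgroup TYPE('f::comm_ring_1) G) = unitaries G"
proof -
  let ?A = "group_algebra TYPE('f) G"
  let ?N = "normalized_units TYPE('f) G"
  interpret A: monoid ?A by (rule monoid_group_algebra)
  interpret N: group ?N by (rule group_normalized_units)
  have N: "carrier ?N = {u \<in> Units ?A. augmentation G u = 1}" "\<And>x y. x \<otimes>\<^bsub>?N\<^esub> y = x \<star> y"
      "\<one>\<^bsub>?N\<^esub> = single \<one>"
    by (simp_all add: normalized_units_def units_of_def group_algebra_simps)
  show ?thesis
  proof (intro equalityI subsetI)
    fix x assume "x \<in> carrier (unitary_subgroup TYPE('f) G)"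
    then have x: "x \<in> carrier ?N" "star G x = inv\<^bsub>?N\<^esub> x" by (simp_all add: unitary_subgroup_def)
    then have "x \<in> supported G" "augmentation G x = 1"
      using A.Units_closed by (auto simp: N(1) group_algebra_simps(1))
    then show "x \<in> unitaries G"
      using x N.r_inv[of x] N.l_inv[of x] by (simp add: unitaries_def N)
  next
    fix x :: "'a \<Rightarrow> 'f" assume x: "x \<in> unitaries G"
    then have "x \<in> Units ?A" "star G x \<in> Units ?A"
      unfolding Units_def group_algebra_simps unitaries_def by (auto intro: star_supported)
    then have "x \<in> carrier ?N" "star G x \<in> carrier ?N"
      using x by (auto simp: N unitaries_def augmentation_star)
    moreover from this have "star G x = inv\<^bsub>?N\<^esub> x"
      using x by (intro N.inv_equality[symmetric]) (simp_all add: N unitaries_def)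
    ultimately show "x \<in> carrier (unitary_subgroup TYPE('f) G)"
      by (simp add: unitary_subgroup_def)
  qed
qed

lemma unitary_conv: "x \<in> unitaries G \<Longrightarrow> y \<in> unitaries G \<Longrightarrow> x \<star> y \<in> unitaries G"
proof -
  assume x: "x \<in> unitaries G" and y: "y \<in> unitaries G"
  have "x \<star> y \<star> (star G y \<star> star G x) = x \<star> (y \<star> star G y) \<star> star G x" by (simp add: conv_assoc)
  moreover have "star G y \<star> star G x \<star> (x \<star> y) = star G y \<star> (star G x \<star> x) \<star> y" by (simp add: conv_assoc)
  ultimately show ?thesis
    using x y by (simp add: unitaries_def star_conv augmentation_conv)
qed

lemma unitary_star: "x \<in> unitaries G \<Longrightarrow> star G x \<in> unitaries G"
  by (simp add: unitaries_def star_star augmentation_star)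

lemma single_unitary: "g \<in> carrier G \<Longrightarrow> single g \<in> unitaries G"
  by (simp add: unitaries_def star_single augmentation_single single_conv_single)

lemma unitary_supported: "x \<in> unitaries G \<Longrightarrow> x \<in> supported G"
  by (simp add: unitaries_def)

lemma group_unitary: "group (unitary_subgroup TYPE('f::comm_ring_1) G)"
proof (rule groupI)
  fix x :: "'a \<Rightarrow> 'f" assume "x \<in> carrier (unitary_subgroup TYPE('f) G)"
  then have "star G x \<in> unitaries G" "star G x \<star> x = single \<one>"
    by (simp_all add: carrier_unitary unitary_star) (simp add: unitaries_def)
  then show "\<exists>y\<in>carrier (unitary_subgroup TYPE('f) G).
      y \<otimes>\<^bsub>unitary_subgroup TYPE('f) G\<^esub> x = \<one>\<^bsub>unitary_subgroup TYPE('f) G\<^esub>"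
    by (auto simp: carrier_unitary mult_unitary one_unitary)
qed (simp_all add: carrier_unitary mult_unitary one_unitary unitary_conv single_unitary conv_assoc unitary_supported)

text \<open>Both \<open>x\<close> and \<open>star G x\<close> are inverse to \<open>x\<close>. On
  coefficients this is the symmetry \<open>x (inv g) = x g\<close> used throughout.\<close>

lemma involution_star:
  assumes "x \<in> unitaries G" "x \<star> x = single \<one>" shows "star G x = x"
proof -
  have "star G x = star G x \<star> (x \<star> x)" using assms(2) by simp
  also have "\<dots> = (star G x \<star> x) \<star> x" by (simp only: conv_assoc)
  also have "\<dots> = x" using assms(1) by (simp add: unitaries_def)
  finally show ?thesis .
qed

lemma symmetric_unitary:
  assumes "x \<in> supported G" "star G x = x" "x \<star> x = single \<one>" "augmentation G x = 1"
  shows "x \<in> unitaries G"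
  using assms by (simp add: unitaries_def)

end

section \<open>Centralizers\<close>

definition centralizer :: "('g, 'm) monoid_scheme \<Rightarrow> 'g \<Rightarrow> 'g set" where
  "centralizer M a = {g \<in> carrier M. g \<otimes>\<^bsub>M\<^esub> a = a \<otimes>\<^bsub>M\<^esub> g}"

text \<open>The cosets of \<open>1\<close>, \<open>a\<close>, \<open>b\<close>, \<open>ab\<close>
  are only required to cover the group; their disjointness is recovered from \<open>a\<close> and
  \<open>b\<close> not commuting.\<close>

definition central_presentation :: "('g, 'm) monoid_scheme \<Rightarrow> 'g \<Rightarrow> 'g \<Rightarrow> 'g \<Rightarrow> bool" where
  "central_presentation M a b c \<longleftrightarrow> a \<in> carrier M \<and> b \<in> carrier M \<and> c \<in> center M \<and> c \<noteq> \<one>\<^bsub>M\<^esub> \<and>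
     c \<otimes>\<^bsub>M\<^esub> c = \<one>\<^bsub>M\<^esub> \<and> b \<otimes>\<^bsub>M\<^esub> a = c \<otimes>\<^bsub>M\<^esub> (a \<otimes>\<^bsub>M\<^esub> b) \<and>
     a \<otimes>\<^bsub>M\<^esub> a \<in> center M \<and> b \<otimes>\<^bsub>M\<^esub> b \<in> center M \<and>
     (\<forall>g\<in>carrier M. \<exists>z\<in>center M. g = z \<or> g = z \<otimes>\<^bsub>M\<^esub> a \<or> g = z \<otimes>\<^bsub>M\<^esub> b \<or> g = z \<otimes>\<^bsub>M\<^esub> (a \<otimes>\<^bsub>M\<^esub> b))"

section \<open>Class equation and cosets of the centre\<close>

context finite_group
begin

lemma finite_center: "finite (center G)"
  by (rule finite_subset[OF _ finite_carrier]) (auto dest: center_closed)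

lemma subgroup_centralizer: assumes a: "a \<in> carrier G" shows "subgroup (centralizer G a) G"
proof (rule subgroupI)
  show "centralizer G a \<noteq> {}" using a by (auto simp: centralizer_def)
next
  fix g assume g: "g \<in> centralizer G a"
  then have gG: "g \<in> carrier G" and ga: "g \<otimes> a = a \<otimes> g" by (auto simp: centralizer_def)
  have "a \<otimes> inv g = inv g \<otimes> (g \<otimes> a) \<otimes> inv g" using a gG by (simp add: m_assoc[symmetric])
  also have "\<dots> = inv g \<otimes> a" unfolding ga using a gG by (simp add: m_assoc)
  finally show "inv g \<in> centralizer G a" using gG by (simp add: centralizer_def)
next
  fix g h assume "g \<in> centralizer G a" and "h \<in> centralizer G a"
  then have g: "g \<in> carrier G" "g \<otimes> a = a \<otimes> g" and h: "h \<in> carrier G" "h \<otimes> a = a \<otimes> h"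
    by (auto simp: centralizer_def)
  have "g \<otimes> h \<otimes> a = g \<otimes> (h \<otimes> a)" using a g(1) h(1) by (simp add: m_assoc)
  also have "\<dots> = g \<otimes> a \<otimes> h" unfolding h(2) using a g(1) h(1) by (simp add: m_assoc)
  also have "\<dots> = a \<otimes> (g \<otimes> h)" unfolding g(2) using a g(1) h(1) by (simp add: m_assoc)
  finally show "g \<otimes> h \<in> centralizer G a" using g(1) h(1) by (simp add: centralizer_def)
qed (auto simp: centralizer_def)

lemma card_centralizer_less:
  assumes a: "a \<in> carrier G" "a \<notin> center G" shows "card (centralizer G a) < order G"
proof -
  obtain g where g: "g \<in> carrier G" "a \<otimes> g \<noteq> g \<otimes> a" using a centerI[of a G] by blast
  then have "g \<notin> centralizer G a" by (auto simp: centralizer_def)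
  moreover have "centralizer G a \<subseteq> carrier G" by (auto simp: centralizer_def)
  ultimately have "centralizer G a \<subset> carrier G" using g by blast
  then show ?thesis unfolding order_def by (intro psubset_card_mono) auto
qed

text \<open>Class equation: the noncentral conjugacy classes partition the complement of the centre,
  and the class of \<open>a\<close> has \<open>order G div card (centralizer G a)\<close>
  elements.\<close>

lemma dvd_card_noncentral:
  assumes d: "\<And>a. a \<in> carrier G \<Longrightarrow> a \<notin> center G \<Longrightarrow> d dvd order G div card (centralizer G a)"
  shows "d dvd order G - card (center G)"
proof -
  define \<phi> where "\<phi> = (\<lambda>g. \<lambda>h \<in> carrier G. g \<otimes> h \<otimes> inv g)"
  interpret act: group_action G "carrier G" \<phi> unfolding \<phi>_def by (rule action_by_conjugation)
  define \<C> where "\<C> = orbit G \<phi> ` (carrier G - center G)"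
  have orbit: "orbit G \<phi> a = {g \<otimes> a \<otimes> inv g | g. g \<in> carrier G}" if "a \<in> carrier G" for a
    using that by (auto simp: orbit_def \<phi>_def)
  have stab: "stabilizer G \<phi> a = centralizer G a" if "a \<in> carrier G" for a
  proof -
    have "g \<otimes> a \<otimes> inv g = a \<longleftrightarrow> g \<otimes> a = a \<otimes> g" if "g \<in> carrier G" for g
      using that \<open>a \<in> carrier G\<close> by (metis inv_solve_right m_closed)
    then show ?thesis using that by (auto simp: stabilizer_def centralizer_def \<phi>_def)
  qed
  have noncentral: "orbit G \<phi> a \<subseteq> carrier G - center G" if a: "a \<in> carrier G" "a \<notin> center G" for a
  proof
    fix x assume "x \<in> orbit G \<phi> a"
    then obtain g where g: "g \<in> carrier G" "x = g \<otimes> a \<otimes> inv g" using orbit[OF a(1)] by blast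
    have "x \<notin> center G"
    proof
      assume x: "x \<in> center G"
      have "inv g \<otimes> (x \<otimes> g) = a" using g a(1) by (simp add: m_assoc) (simp add: m_assoc[symmetric])
      moreover have "inv g \<otimes> (x \<otimes> g) = x"
        using center_commute[OF x g(1)] center_closed[OF x] g(1) by (simp add: m_assoc[symmetric])
      ultimately show False using x a by simp
    qed
    then show "x \<in> carrier G - center G" using g a by simp
  qed
  have union: "\<Union>\<C> = carrier G - center G"
    unfolding \<C>_def using noncentral act.orbit_refl by blast
  have "d dvd card (\<Union>\<C>)"
  proof (rule dvd_partition)
    show "finite (\<Union>\<C>)" unfolding union by simp
    show "\<forall>B\<in>\<C>. d dvd card B"
    proof
      fix B assume "B \<in> \<C>"
      then obtain a where a: "a \<in> carrier G" "a \<notin> center G" "B = orbit G \<phi> a" by (auto simp: \<C>_def)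
      have "card B * card (centralizer G a) = order G"
        using act.orbit_stabilizer_theorem[OF a(1)] stab[OF a(1)] a(3) by simp
      moreover have "order G > 0" by (simp add: order_gt_0_iff_finite)
      ultimately have "card B = order G div card (centralizer G a)"
        by (metis gr0_implies_Suc mult_0_right nonzero_mult_div_cancel_right old.nat.distinct(1))
      then show "d dvd card B" using d[OF a(1,2)] by simp
    qed
    show "\<forall>B\<in>\<C>. \<forall>B'\<in>\<C>. B \<noteq> B' \<longrightarrow> B \<inter> B' = {}"
      unfolding \<C>_def using act.disjoint_union by (auto simp: orbits_def)
  qed
  moreover have "card (carrier G - center G) = order G - card (center G)"
    unfolding order_def by (rule card_Diff_subset) (use finite_center center_closed[of _ G] in auto)
  ultimately show ?thesis by (simp add: union)
qed

text \<open>The class equation modulo two: centralizers of noncentral elements are proper subgroups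
  of a 2-group, so their index is even.\<close>

lemma even_card_center:
  assumes ord: "order G = 2 ^ n" "n > 0" shows "even (card (center G))"
proof -
  have "2 dvd order G - card (center G)"
  proof (rule dvd_card_noncentral)
    fix a assume a: "a \<in> carrier G" "a \<notin> center G"
    have "card (rcosets centralizer G a) * card (centralizer G a) = 2 ^ n"
      using lagrange[OF subgroup_centralizer[OF a(1)]] ord by simp
    moreover from this obtain k where "card (centralizer G a) = 2 ^ k" "k \<le> n"
      by (metis dvd_triv_right divides_primepow_nat two_is_prime_nat)
    moreover have "card (centralizer G a) < order G" by (rule card_centralizer_less[OF a])
    ultimately have "k < n" using ord by simp
    then show "2 dvd order G div card (centralizer G a)"
      using ord \<open>card (centralizer G a) = 2 ^ k\<close> by (simp add: power_diff[symmetric])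
  qed
  moreover have "card (center G) \<le> order G"
    unfolding order_def by (rule card_mono) (auto dest: center_closed)
  ultimately show ?thesis using ord by (metis dvd_diffD1 dvd_power)
qed

text \<open>No quotient of two different elements of \<open>1\<close>, \<open>a\<close>,
  \<open>b\<close>, \<open>ab\<close> is central, since otherwise \<open>a\<close> and
  \<open>b\<close> would commute.\<close>

lemma center_coset_cases:
  assumes a: "a \<in> carrier G" and b: "b \<in> carrier G" and ab: "a \<otimes> b \<noteq> b \<otimes> a"
  defines "Z \<equiv> center G"
  defines "D \<equiv> Z \<union> (\<lambda>z. z \<otimes> a) ` Z \<union> (\<lambda>z. z \<otimes> b) ` Z \<union> (\<lambda>z. z \<otimes> (a \<otimes> b)) ` Z"
  shows "card D = 4 * card Z" "D \<subseteq> carrier G"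
proof -
  have Zc: "z \<in> carrier G" if "z \<in> Z" for z using that center_closed by (auto simp: Z_def)
  have nc: "a \<notin> Z" "b \<notin> Z" "a \<otimes> b \<notin> Z"
    using ab center_commute[of a G b] center_commute[of b G a] central_product_commute[OF a b] a b
    by (auto simp: Z_def)
  have "z \<otimes> g \<in> Z \<longleftrightarrow> g \<in> Z" if "z \<in> Z" "g \<in> carrier G" for z g
    using that center_mult_iff by (simp add: Z_def)
  note iff = this
  have ne: "z \<otimes> a \<noteq> w \<otimes> b" if "z \<in> Z" "w \<in> Z" for z w
  proof
    assume eq: "z \<otimes> a = w \<otimes> b"
    have "z \<otimes> a \<otimes> b = w \<otimes> b \<otimes> b" using eq by simp
    also have "\<dots> = b \<otimes> w \<otimes> b"
      using center_commute[of w G b] that(2) b by (simp only: Z_def)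
    also have "\<dots> = b \<otimes> (w \<otimes> b)" using b Zc[OF that(2)] by (simp add: m_assoc)
    also have "\<dots> = b \<otimes> z \<otimes> a" using eq a b Zc[OF that(1)] by (simp add: m_assoc)
    also have "\<dots> = z \<otimes> (b \<otimes> a)"
      using center_commute[of z G b] that(1) a b Zc[OF that(1)] by (simp add: Z_def m_assoc[symmetric])
    finally show False using ab a b Zc[OF that(1)] by (simp add: m_assoc)
  qed
  have ne1: "z \<otimes> a \<noteq> w \<otimes> (a \<otimes> b)" if "z \<in> Z" "w \<in> Z" for z w
  proof
    assume eq: "z \<otimes> a = w \<otimes> (a \<otimes> b)"
    have "a \<otimes> (w \<otimes> b) = w \<otimes> a \<otimes> b"
      using center_commute[of w G a] that(2) a b Zc[OF that(2)] by (simp add: Z_def m_assoc[symmetric])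
    also have "\<dots> = a \<otimes> z"
      using eq center_commute[of z G a] that a b Zc[OF that(1)] Zc[OF that(2)] by (simp add: Z_def m_assoc)
    finally have "w \<otimes> b = z" using a b Zc that by simp
    then show False using iff[OF that(2) b] that(1) nc by simp
  qed
  have ne2: "z \<otimes> b \<noteq> w \<otimes> (a \<otimes> b)" if "z \<in> Z" "w \<in> Z" for z w
  proof
    assume "z \<otimes> b = w \<otimes> (a \<otimes> b)"
    then have "z = w \<otimes> a" using a b Zc that by (simp add: m_assoc[symmetric])
    then show False using iff[OF that(2) a] that(1) nc by simp
  qed
  have card: "card ((\<lambda>z. z \<otimes> g) ` Z) = card Z" if "g \<in> carrier G" for g
    by (rule card_image) (use that Zc in \<open>auto intro!: inj_onI\<close>)
  have fin: "finite Z" by (simp add: Z_def finite_center)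
  have d: "Z \<inter> (\<lambda>z. z \<otimes> a) ` Z = {}" "(Z \<union> (\<lambda>z. z \<otimes> a) ` Z) \<inter> (\<lambda>z. z \<otimes> b) ` Z = {}"
    "(Z \<union> (\<lambda>z. z \<otimes> a) ` Z \<union> (\<lambda>z. z \<otimes> b) ` Z) \<inter> (\<lambda>z. z \<otimes> (a \<otimes> b)) ` Z = {}"
    using iff a b nc ne ne1 ne2 by (auto simp: disjoint_iff)
  show "card D = 4 * card Z"
    unfolding D_def using fin by (simp add: card_Un_disjoint d card a b)
  show "D \<subseteq> carrier G" using a b Zc by (auto simp: D_def)
qed

lemma four_center_le_order:
  assumes "a \<in> carrier G" "b \<in> carrier G" "a \<otimes> b \<noteq> b \<otimes> a"
  shows "4 * card (center G) \<le> order G"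
  using center_coset_cases[OF assms] unfolding order_def by (metis card_mono finite_carrier)

text \<open>The quotient by the centre has order four and is not cyclic, hence is a Klein
  four-group; so squares and commutators are central.\<close>

lemma central_presentation_exists:
  assumes a: "a \<in> carrier G" and b: "b \<in> carrier G" and ab: "a \<otimes> b \<noteq> b \<otimes> a"
    and ord: "order G = 4 * card (center G)"
  shows "\<exists>c. central_presentation G a b c"
proof -
  define Z where "Z = center G"
  let ?D = "Z \<union> (\<lambda>z. z \<otimes> a) ` Z \<union> (\<lambda>z. z \<otimes> b) ` Z \<union> (\<lambda>z. z \<otimes> (a \<otimes> b)) ` Z"
  have "?D = carrier G"
    using center_coset_cases[OF a b ab] ord card_subset_eq[OF finite_carrier] by (simp add: Z_def order_def)
  then have cover: "\<exists>z\<in>Z. g = z \<or> g = z \<otimes> a \<or> g = z \<otimes> b \<or> g = z \<otimes> (a \<otimes> b)" if "g \<in> carrier G" for g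
    using that by blast
  have Zc: "z \<in> carrier G" if "z \<in> Z" for z using that center_closed by (auto simp: Z_def)
  have comm: "z \<otimes> g = g \<otimes> z" if "z \<in> Z" "g \<in> carrier G" for z g
    using center_commute that by (auto simp: Z_def)
  have nc: "a \<notin> Z" "b \<notin> Z" "a \<otimes> b \<notin> Z"
    using ab comm[of a b] comm[of b a] central_product_commute[OF a b] a b by (auto simp: Z_def)
  have cen: "g \<in> Z" if g: "g \<in> carrier G" "\<exists>z\<in>Z. g = z \<otimes> h" "h \<in> carrier G" "h \<notin> Z \<Longrightarrow> False" for g h
    using that center_mult by (auto simp: Z_def)
  have sq: "g \<otimes> g \<in> Z" if g: "g = a \<or> g = b" for g
  proof -
    obtain h where h: "{g, h} = {a, b}" using g by blast
    have gG: "g \<in> carrier G" "h \<in> carrier G" "g \<otimes> h \<noteq> h \<otimes> g" "g \<notin> Z"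
      using h a b ab nc by (auto simp: doubleton_eq_iff)
    \<comment> \<open>\<open>g g\<close> commutes with \<open>g\<close>, so it cannot lie in the
      central coset of an element \<open>k\<close> that does not.\<close>
    have nocomm: False if z: "z \<in> Z" and k: "k \<in> carrier G" "k \<otimes> g \<noteq> g \<otimes> k" and eq: "g \<otimes> g = z \<otimes> k" for z k
    proof -
      have "z \<otimes> (k \<otimes> g) = z \<otimes> k \<otimes> g" using Zc[OF z] k gG by (simp add: m_assoc)
      also have "\<dots> = g \<otimes> (z \<otimes> k)" unfolding eq[symmetric] using gG by (simp add: m_assoc)
      also have "\<dots> = z \<otimes> (g \<otimes> k)" using comm[OF z gG(1)] Zc[OF z] k gG by (simp add: m_assoc[symmetric])
      finally show False using k gG Zc[OF z] by simp
    qed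
    have ncab: "a \<otimes> b \<otimes> g \<noteq> g \<otimes> (a \<otimes> b)"
      using g a b ab by (auto simp: m_assoc) (simp add: m_assoc[symmetric])
    obtain z where z: "z \<in> Z" "g \<otimes> g = z \<or> g \<otimes> g = z \<otimes> a \<or> g \<otimes> g = z \<otimes> b \<or> g \<otimes> g = z \<otimes> (a \<otimes> b)"
      using cover[of "g \<otimes> g"] gG by auto
    have "g \<otimes> g \<noteq> z \<otimes> g"
    proof
      assume "g \<otimes> g = z \<otimes> g"
      then have "g = z" using gG Zc[OF z(1)] by simp
      then show False using gG z by simp
    qed
    moreover have "g \<otimes> g \<noteq> z \<otimes> h" using nocomm[OF z(1) gG(2)] gG(3) by auto
    moreover have "g \<otimes> g \<noteq> z \<otimes> (a \<otimes> b)" using nocomm[OF z(1) _ ncab] a b by auto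
    ultimately show ?thesis using z h by (auto simp: doubleton_eq_iff)
  qed
  obtain c where c: "c \<in> Z" "b \<otimes> a = c \<otimes> (a \<otimes> b)"
  proof -
    obtain z where z: "z \<in> Z" "b \<otimes> a = z \<or> b \<otimes> a = z \<otimes> a \<or> b \<otimes> a = z \<otimes> b \<or> b \<otimes> a = z \<otimes> (a \<otimes> b)"
      using cover[of "b \<otimes> a"] a b by auto
    have "b \<otimes> a \<noteq> z" using central_product_commute[OF b a] ab z by (auto simp: Z_def)
    moreover have "b \<otimes> a \<noteq> z \<otimes> a" using a b Zc[OF z(1)] z nc by auto
    moreover have "b \<otimes> a \<noteq> z \<otimes> b"
      using a b Zc[OF z(1)] z nc comm[OF z(1) b] by auto
    ultimately show ?thesis using that z by blast
  qed
  have "c \<noteq> \<one>" using c ab a b by auto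
  \<comment> \<open>Moving \<open>b\<close> past \<open>a\<close> twice costs \<open>c c\<close>,
    whereas the central \<open>b b\<close> passes freely.\<close>
  moreover have "c \<otimes> c = \<one>"
  proof -
    have "a \<otimes> (b \<otimes> b) = b \<otimes> (b \<otimes> a)" using comm[OF sq[of b] a] a b by (simp add: m_assoc)
    also have "\<dots> = b \<otimes> c \<otimes> (a \<otimes> b)" using c a b Zc[OF c(1)] by (simp add: m_assoc)
    also have "\<dots> = c \<otimes> (b \<otimes> a) \<otimes> b" using comm[OF c(1) b] a b Zc[OF c(1)] by (simp add: m_assoc[symmetric])
    also have "\<dots> = c \<otimes> c \<otimes> (a \<otimes> (b \<otimes> b))" using c(2) a b Zc[OF c(1)] by (simp add: m_assoc)
    finally show ?thesis using a b Zc[OF c(1)] by (metis m_closed r_cancel_one')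
  qed
  ultimately show ?thesis
    unfolding central_presentation_def using a b c sq cover by (auto simp: Z_def)
qed

end

section \<open>Groups of order sixteen with centre of order two\<close>

definition dihedral_like :: "('g, 'm) monoid_scheme \<Rightarrow> 'g \<Rightarrow> 'g \<Rightarrow> bool" where
  "dihedral_like M a b \<longleftrightarrow> a \<in> carrier M \<and> b \<in> carrier M \<and>
     a [^]\<^bsub>M\<^esub> (4::nat) \<noteq> \<one>\<^bsub>M\<^esub> \<and> a [^]\<^bsub>M\<^esub> (8::nat) = \<one>\<^bsub>M\<^esub> \<and>
     order M = 16 \<and> b \<notin> range (\<lambda>i::nat. a [^]\<^bsub>M\<^esub> i)"

context finite_group
begin

lemma index_two:
  assumes A: "subgroup A G" "order G = 2 * card A"
    and g: "g \<in> carrier G" "g \<notin> A" and h: "h \<in> carrier G" "h \<notin> A"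
  shows "g \<otimes> h \<in> A"
proof -
  interpret A: subgroup A G by fact
  have g': "inv g \<notin> A" using g A.m_inv_closed[of "inv g"] by auto
  have fin: "finite A" using A.subset by (rule finite_subset) simp
  have disj: "A \<inter> (\<lambda>x. inv g \<otimes> x) ` A = {}"
  proof (rule ccontr)
    assume "A \<inter> (\<lambda>x. inv g \<otimes> x) ` A \<noteq> {}"
    then obtain x where x: "x \<in> A" "inv g \<otimes> x \<in> A" by blast
    then have "inv g \<otimes> x \<otimes> inv x \<in> A" by simp
    then show False using x g g' by (simp add: m_assoc)
  qed
  have "card ((\<lambda>x. inv g \<otimes> x) ` A) = card A"
    by (rule card_image) (use g in \<open>auto intro!: inj_onI\<close>)
  then have "card (A \<union> (\<lambda>x. inv g \<otimes> x) ` A) = order G"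
    using A(2) fin disj by (simp add: card_Un_disjoint)
  moreover have "A \<union> (\<lambda>x. inv g \<otimes> x) ` A \<subseteq> carrier G" using g by auto
  ultimately have "A \<union> (\<lambda>x. inv g \<otimes> x) ` A = carrier G"
    by (intro card_subset_eq) (simp_all add: order_def)
  then obtain x where "x \<in> A" "h = inv g \<otimes> x" using h by blast
  then show ?thesis using g by (simp add: m_assoc[symmetric])
qed

text \<open>If no noncentral element had a centralizer of order eight, all noncentral classes would
  have size divisible by four, but \<open>16 - 2 = 14\<close> is not.\<close>

lemma exists_index_two_centralizer:
  assumes ord: "order G = 16" and Z: "card (center G) = 2"
  shows "\<exists>g\<in>carrier G - center G. card (centralizer G g) = 8"
proof (rule ccontr)
  assume no: "\<not> ?thesis"
  have "4 dvd order G - card (center G)"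
  proof (rule dvd_card_noncentral)
    fix a assume a: "a \<in> carrier G" "a \<notin> center G"
    have "card (rcosets centralizer G a) * card (centralizer G a) = 2 ^ 4"
      using lagrange[OF subgroup_centralizer[OF a(1)]] ord by simp
    then have "card (centralizer G a) dvd 2 ^ 4" by (metis dvd_triv_right)
    then obtain k where k: "card (centralizer G a) = 2 ^ k" "k \<le> 4"
      using divides_primepow_nat[of 2 "card (centralizer G a)" 4] by auto
    have "card (centralizer G a) < order G" by (rule card_centralizer_less[OF a])
    then have "k < 4" using k(1) ord power_increasing[of 4 k "2::nat"] by (cases "k < 4") auto
    moreover have "k \<noteq> 3" using no a k(1) by auto
    ultimately have "k \<in> {0, 1, 2}" by auto
    then show "4 dvd order G div card (centralizer G a)"
      using ord k(1) by auto
  qed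
  then show False using ord Z by simp
qed

text \<open>A centralizer \<open>A\<close> of order eight is abelian, and an outer \<open>b\<close>
  acts on it by an automorphism \<open>\<sigma>\<close> with
  \<open>\<sigma> (\<sigma> x) = x\<close> that fixes only central elements. So
  \<open>x (\<sigma> x)\<close> is always central. An \<open>a\<close> that \<open>\<sigma>\<close>
  moves by a noncentral factor then has order eight, and \<open>\<sigma> a = z a^-1\<close> with
  \<open>z\<close> central.\<close>

lemma dihedral_like_exists:
  assumes ord: "order G = 16" and Z: "card (center G) = 2"
  obtains a b where "dihedral_like G a b" "center G = {\<one>, a [^] (4::nat)}"
    "b \<otimes> a = inv a \<otimes> b \<or> b \<otimes> a = a [^] (3::nat) \<otimes> b" "b \<otimes> b = \<one> \<or> b \<otimes> b = a [^] (4::nat)"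
proof -
  obtain g where g: "g \<in> carrier G" "g \<notin> center G" "card (centralizer G g) = 8"
    using exists_index_two_centralizer[OF assms] by blast
  define A where "A = centralizer G g"
  have A: "subgroup A G" unfolding A_def by (rule subgroup_centralizer[OF g(1)])
  interpret A: subgroup A G by (rule A)
  have cA: "card A = 8" using g by (simp add: A_def)
  have two: "order G = 2 * card A" using ord cA by simp
  note index_two = index_two[OF A two]
  have gA: "g \<in> A" unfolding A_def centralizer_def using g(1) by blast
  obtain c where c: "center G = {\<one>, c}" "c \<noteq> \<one>"
  proof -
    obtain x y where xy: "center G = {x, y}" "x \<noteq> y" using Z unfolding card_2_iff by blast
    show ?thesis
    proof (cases "x = \<one>")
      case True then show ?thesis using that[of y] xy by blast
    next
      case False
      have "\<one> \<in> {x, y}" using one_center by (simp only: xy(1))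
      then have "y = \<one>" using False by simp
      then have "center G = {\<one>, x}" using xy(1) by blast
      then show ?thesis using that False by blast
    qed
  qed
  have ZA: "center G \<subseteq> A"
    unfolding A_def centralizer_def using center_commute[OF _ g(1)] center_closed[of _ G] by blast
  have cG: "c \<in> carrier G" using c center_closed[of c G] by auto
  \<comment> \<open>A nonabelian group of order eight has a centre of order at most two, but
    \<open>1\<close>, \<open>c\<close> and \<open>g\<close> are all central in
    \<open>A\<close>.\<close>
  have comm: "x \<otimes> y = y \<otimes> x" if x: "x \<in> A" and y: "y \<in> A" for x y
  proof (rule ccontr)
    assume ne: "x \<otimes> y \<noteq> y \<otimes> x"
    let ?A = "G\<lparr>carrier := A\<rparr>"
    have "group ?A" by (rule subgroup_imp_group[OF A])
    moreover have "finite A" using A.subset by (rule finite_subset) simp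
    ultimately interpret B: finite_group ?A by (simp add: finite_group_def finite_group_axioms_def)
    have "4 * card (center ?A) \<le> order ?A"
      using B.four_center_le_order[of x y] x y ne by simp
    then have "card (center ?A) \<le> 2" using cA by (simp add: order_def)
    moreover have "{\<one>, c, g} \<subseteq> center ?A"
    proof
      fix u assume u: "u \<in> {\<one>, c, g}"
      have uA: "u \<in> A" using u gA ZA c by blast
      moreover have "u \<otimes> y = y \<otimes> u" if "y \<in> A" for y
      proof -
        have y: "y \<in> carrier G" "y \<otimes> g = g \<otimes> y" using that unfolding A_def centralizer_def by blast+
        have "u = g \<or> u \<in> center G" using u c(1) by blast
        then show ?thesis
        proof
          assume "u = g" then show ?thesis using y by simp
        next
          assume "u \<in> center G" then show ?thesis using y(1) by (rule center_commute)
        qed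
      qed
      ultimately show "u \<in> center ?A" by (intro centerI) simp_all
    qed
    moreover have "card {\<one>, c, g} = 3"
    proof -
      have "g \<noteq> \<one>" "g \<noteq> c" using g(2) c(1) by blast+
      then show ?thesis using c(2) by simp
    qed
    ultimately show False using card_mono[OF B.finite_center, of "{\<one>, c, g}"] by simp
  qed
  obtain b where b: "b \<in> carrier G" "b \<notin> A"
  proof -
    have "A \<noteq> carrier G" using cA ord by (auto simp: order_def)
    then show ?thesis using that A.subset by blast
  qed
  have bi: "inv b \<notin> A" using b A.m_inv_closed[of "inv b"] by auto
  have mA: "u \<in> A" if "u \<otimes> v \<in> A" "v \<in> A" "u \<in> carrier G" for u v
  proof -
    have "u \<otimes> v \<otimes> inv v \<in> A" using that by simp
    then show ?thesis using that by (simp add: m_assoc)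
  qed
  \<comment> \<open>Every element outside \<open>A\<close> is \<open>b w\<close> with
    \<open>w\<close> in the abelian \<open>A\<close>, so commuting with \<open>b\<close>
    suffices.\<close>
  have fixed: "x \<in> center G" if x: "x \<in> A" "b \<otimes> x = x \<otimes> b" for x
  proof (rule centerI)
    fix y assume y: "y \<in> carrier G"
    show "x \<otimes> y = y \<otimes> x"
    proof (cases "y \<in> A")
      case True then show ?thesis using comm x by simp
    next
      case False
      define w where "w = inv b \<otimes> y"
      have w: "w \<in> A" unfolding w_def using index_two[of "inv b" y] b bi y False by simp
      have yw: "y = b \<otimes> w" using b y by (simp add: w_def m_assoc[symmetric])
      have "x \<otimes> (b \<otimes> w) = b \<otimes> x \<otimes> w" using x b w by (simp add: m_assoc[symmetric])
      also have "\<dots> = b \<otimes> w \<otimes> x" using comm[OF x(1) w] x(1) b w by (simp add: m_assoc)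
      finally show ?thesis by (simp add: yw)
    qed
  qed (use x in simp)
  define \<sigma> where "\<sigma> x = b \<otimes> x \<otimes> inv b" for x
  have \<sigma>A: "\<sigma> x \<in> A" if "x \<in> A" for x
  proof -
    have "b \<otimes> x \<notin> A" using mA[of b x] b that by blast
    then show ?thesis unfolding \<sigma>_def using index_two[of "b \<otimes> x" "inv b"] b bi that by simp
  qed
  have \<sigma>m: "\<sigma> (x \<otimes> y) = \<sigma> x \<otimes> \<sigma> y" if "x \<in> carrier G" "y \<in> carrier G" for x y
    using that b by (simp add: \<sigma>_def m_assoc) (simp add: m_assoc[symmetric])
  have \<sigma>b: "b \<otimes> x = \<sigma> x \<otimes> b" if "x \<in> carrier G" for x using that b by (simp add: \<sigma>_def m_assoc)
  have fix': "x \<in> center G" if "x \<in> A" "\<sigma> x = x" for x using fixed[of x] \<sigma>b[of x] that by simp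
  have bb: "b \<otimes> b \<in> A" using index_two b by simp
  have \<sigma>\<sigma>: "\<sigma> (\<sigma> x) = x" if "x \<in> A" for x
  proof -
    have "\<sigma> (\<sigma> x) = b \<otimes> b \<otimes> x \<otimes> inv (b \<otimes> b)" using b that by (simp add: \<sigma>_def inv_mult_group m_assoc)
    also have "\<dots> = x" using comm[OF bb that] b that by (simp add: m_assoc)
    finally show ?thesis .
  qed
  have prod_central: "x \<otimes> \<sigma> x \<in> center G" if "x \<in> A" for x
  proof (rule fix')
    show "x \<otimes> \<sigma> x \<in> A" using that \<sigma>A by simp
    have "\<sigma> (x \<otimes> \<sigma> x) = \<sigma> x \<otimes> x" using that \<sigma>A \<sigma>\<sigma> by (simp add: \<sigma>m)
    then show "\<sigma> (x \<otimes> \<sigma> x) = x \<otimes> \<sigma> x" using comm that \<sigma>A by simp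
  qed
  \<comment> \<open>Two \<open>x\<close> with the same \<open>inv x \<otimes> \<sigma> x\<close>
    differ by a fixed point of \<open>\<sigma>\<close>, so fibres have at most two elements, and
    eight elements cannot all be sent into the centre of order two.\<close>
  obtain a where a: "a \<in> A" "inv a \<otimes> \<sigma> a \<notin> center G"
  proof (rule ccontr)
    assume "\<not> thesis"
    then have all: "inv x \<otimes> \<sigma> x \<in> {\<one>, c}" if "x \<in> A" for x using that \<open>\<And>a. a \<in> A \<Longrightarrow> inv a \<otimes> \<sigma> a \<notin> center G \<Longrightarrow> thesis\<close> c by blast
    let ?F = "\<lambda>x. inv x \<otimes> \<sigma> x"
    have fib: "card {x \<in> A. ?F x = z} \<le> 2" for z
    proof (cases "\<exists>y\<in>A. ?F y = z")
      case True
      then obtain y where y: "y \<in> A" "?F y = z" by blast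
      have "x \<in> {y, c \<otimes> y}" if x: "x \<in> A" "?F x = z" for x
      proof -
        have "\<sigma> u = u \<otimes> (inv u \<otimes> \<sigma> u)" if u: "u \<in> A" for u
          using u \<sigma>A[OF u] by (simp add: m_assoc[symmetric])
        from this[OF x(1)] this[OF y(1)] have sx: "\<sigma> x = x \<otimes> z" "\<sigma> y = y \<otimes> z"
          by (simp_all only: x(2) y(2))
        have zA: "z \<in> A" unfolding y(2)[symmetric] using y(1) \<sigma>A[OF y(1)] by simp
        have iy: "\<sigma> (inv y) = inv (\<sigma> y)"
          using y(1) b by (simp add: \<sigma>_def inv_mult_group m_assoc)
        have "\<sigma> (x \<otimes> inv y) = x \<otimes> z \<otimes> inv (y \<otimes> z)" using x(1) y(1) by (simp add: \<sigma>m iy sx)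
        also have "\<dots> = x \<otimes> inv y" using x(1) y(1) zA by (simp add: inv_mult_group m_assoc) (simp add: m_assoc[symmetric])
        finally have "x \<otimes> inv y \<in> {\<one>, c}" using fix'[of "x \<otimes> inv y"] x(1) y(1) c(1) by simp
        moreover have "x = x \<otimes> inv y \<otimes> y" using x(1) y(1) by (simp add: m_assoc)
        ultimately show ?thesis using y(1) by auto
      qed
      then have "{x \<in> A. ?F x = z} \<subseteq> {y, c \<otimes> y}" by blast
      then have "card {x \<in> A. ?F x = z} \<le> card {y, c \<otimes> y}" by (intro card_mono) auto
      also have "\<dots> \<le> 2" by (simp add: card_insert_if)
      finally show ?thesis .
    next
      case False
      then have "{x \<in> A. ?F x = z} = {}" by blast
      then show ?thesis by (simp only: card.empty zero_le)
    qed
    have "A = {x \<in> A. ?F x = \<one>} \<union> {x \<in> A. ?F x = c}" using all by blast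
    then have "card A \<le> card {x \<in> A. ?F x = \<one>} + card {x \<in> A. ?F x = c}" by (metis card_Un_le)
    then show False using fib[of \<one>] fib[of c] cA by simp
  qed
  define z where "z = a \<otimes> \<sigma> a"
  have z: "z \<in> center G" using prod_central[OF a(1)] by (simp add: z_def)
  have aG: "a \<in> carrier G" using a by simp
  have zG: "z \<in> carrier G" using z by (rule center_closed)
  have \<sigma>a: "\<sigma> a = z \<otimes> inv a"
  proof -
    have "\<sigma> a = inv a \<otimes> z" using a \<sigma>A aG by (simp add: z_def m_assoc[symmetric])
    then show ?thesis using center_commute[OF z, of "inv a"] aG by simp
  qed
  have cc: "c \<otimes> c = \<one>"
  proof -
    have "c \<otimes> c \<in> {\<one>, c}" using center_mult[of c c] c by auto
    then show ?thesis using cG c by auto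
  qed
  have zz: "z \<otimes> z = \<one>" using z c cc by auto
  \<comment> \<open>If \<open>a^4 = 1\<close>, then
    \<open>inv a \<otimes> \<sigma> a = z a^2\<close> is fixed by \<open>\<sigma>\<close>, hence
    central, against the choice of \<open>a\<close>.\<close>
  have a4: "a [^] (4::nat) \<noteq> \<one>"
  proof
    assume 4: "a [^] (4::nat) = \<one>"
    have "a \<otimes> a \<otimes> (a \<otimes> a) = \<one>" using 4 aG by (simp add: numeral_eq_Suc m_assoc)
    then have ii: "inv (a \<otimes> a) = a \<otimes> a" using aG by (simp add: inv_equality)
    define r where "r = inv a \<otimes> \<sigma> a"
    have zi: "inv a \<otimes> z = z \<otimes> inv a" using center_commute[OF z, of "inv a"] aG by simp
    have ia: "inv a \<otimes> inv a = a \<otimes> a" using ii aG by (simp add: inv_mult_group)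
    have "r = inv a \<otimes> z \<otimes> inv a" unfolding r_def \<sigma>a using aG zG by (simp add: m_assoc)
    also have "\<dots> = z \<otimes> (inv a \<otimes> inv a)" unfolding zi using aG zG by (simp add: m_assoc)
    finally have r: "r = z \<otimes> (a \<otimes> a)" by (simp only: ia)
    have "\<sigma> r = \<sigma> z \<otimes> (\<sigma> a \<otimes> \<sigma> a)" using aG zG by (simp add: r \<sigma>m)
    also have "\<sigma> z = z"
      unfolding \<sigma>_def center_commute[OF z b(1), symmetric] using b(1) zG by (simp add: m_assoc)
    also have "\<sigma> a \<otimes> \<sigma> a = z \<otimes> (inv a \<otimes> z) \<otimes> inv a"
      unfolding \<sigma>a using aG zG by (simp add: m_assoc)
    also have "\<dots> = z \<otimes> z \<otimes> (inv a \<otimes> inv a)" unfolding zi using aG zG by (simp add: m_assoc)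
    also have "\<dots> = a \<otimes> a" using aG by (simp add: zz ia)
    finally have "\<sigma> r = r" by (simp add: r)
    moreover have "r \<in> A" unfolding r_def using a(1) \<sigma>A[OF a(1)] by simp
    ultimately have "r \<in> center G" by (intro fix')
    then show False using a(2) by (simp only: r_def)
  qed
  have pow_comm: "a [^] (i::nat) \<in> A" for i using a by (induction i) auto
  have a8: "a [^] (8::nat) = \<one>"
  proof -
    have "group (G\<lparr>carrier := A\<rparr>)" by (rule subgroup_imp_group[OF A])
    then have "a [^]\<^bsub>G\<lparr>carrier := A\<rparr>\<^esub> order (G\<lparr>carrier := A\<rparr>) = \<one>"
      using group.pow_order_eq_1[of "G\<lparr>carrier := A\<rparr>" a] a by simp
    then show ?thesis using cA by (simp add: order_def nat_pow_consistent[symmetric])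
  qed
  have \<sigma>pow: "\<sigma> (a [^] (i::nat)) = \<sigma> a [^] i" for i
    using aG b by (induction i) (simp_all add: \<sigma>m, simp add: \<sigma>_def)
  \<comment> \<open>\<open>\<sigma>\<close> fixes \<open>a^4\<close>, because \<open>z^4 = 1\<close>
    and \<open>a^4\<close> is its own inverse.\<close>
  have ac: "a [^] (4::nat) = c"
  proof -
    have "\<sigma> a [^] (4::nat) = z [^] (4::nat) \<otimes> inv a [^] (4::nat)"
      unfolding \<sigma>a using center_commute[OF z, of "inv a"] aG zG by (intro pow_mult_distrib) auto
    also have "z [^] (4::nat) = \<one>" using zz zG by (simp add: numeral_eq_Suc m_assoc)
    also have "inv a [^] (4::nat) = a [^] (4::nat)"
    proof -
      have "a [^] (4::nat) \<otimes> a [^] (4::nat) = \<one>" using a8 aG by (simp add: nat_pow_mult)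
      then have "inv (a [^] (4::nat)) = a [^] (4::nat)" using aG by (simp add: inv_equality)
      then show ?thesis using aG by (simp add: nat_pow_inv)
    qed
    finally have "\<sigma> (a [^] (4::nat)) = a [^] (4::nat)" using aG by (simp add: \<sigma>pow)
    then have "a [^] (4::nat) \<in> center G" using fix' pow_comm by simp
    then show ?thesis using c a4 by auto
  qed
  have "b \<notin> range (\<lambda>i::nat. a [^] i)" using pow_comm b by auto
  then have dl: "dihedral_like G a b" using aG b a4 a8 ord by (simp add: dihedral_like_def)
  have "b \<otimes> b \<in> center G" using fixed[OF bb] b by (simp add: m_assoc)
  then have bsq: "b \<otimes> b = \<one> \<or> b \<otimes> b = a [^] (4::nat)" using c ac by auto
  have "z = \<one> \<or> z = c" using z c by auto
  \<comment> \<open>For \<open>z = c = a^4\<close> the relation \<open>\<sigma> a = z a^-1\<close>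
    becomes \<open>\<sigma> a = a^3\<close>, the semidihedral action.\<close>
  moreover have "c \<otimes> inv a = a [^] (3::nat)"
  proof -
    have "a [^] (4::nat) = a [^] (3::nat) \<otimes> a" using aG by (simp add: numeral_eq_Suc)
    then show ?thesis using aG by (simp add: ac[symmetric] m_assoc)
  qed
  ultimately have "b \<otimes> a = inv a \<otimes> b \<or> b \<otimes> a = a [^] (3::nat) \<otimes> b"
    using \<sigma>b[OF aG] \<sigma>a aG by auto
  then show ?thesis using that dl c ac bsq by auto
qed

end

section \<open>Groups with central quotient of order four\<close>

text \<open>Isomorphism from a common multiplication table: the same index \<open>r\<close> has to
  name the product in both groups.\<close>

lemma iso_by_normal_form:
  assumes G: "bij_betw N S (carrier G)" and H: "bij_betw M S (carrier H)"
    and mult: "\<And>p q. p \<in> S \<Longrightarrow> q \<in> S \<Longrightarrow> \<exists>r\<in>S. N p \<otimes>\<^bsub>G\<^esub> N q = N r \<and> M p \<otimes>\<^bsub>H\<^esub> M q = M r"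
  shows "G \<cong> H"
proof -
  define \<phi> where "\<phi> = M \<circ> inv_into S N"
  have \<phi>N: "\<phi> (N p) = M p" if "p \<in> S" for p
    using G that by (simp add: \<phi>_def bij_betw_def)
  have "bij_betw \<phi> (carrier G) (carrier H)"
    unfolding \<phi>_def using bij_betw_trans[OF bij_betw_inv_into[OF G] H] .
  moreover have "\<phi> \<in> hom G H"
  proof (rule homI)
    have im: "carrier G = N ` S" using G by (simp add: bij_betw_def)
    fix x y assume "x \<in> carrier G" "y \<in> carrier G"
    then obtain p q where pq: "p \<in> S" "q \<in> S" "x = N p" "y = N q" unfolding im by blast
    then obtain r where "r \<in> S" "N p \<otimes>\<^bsub>G\<^esub> N q = N r" "M p \<otimes>\<^bsub>H\<^esub> M q = M r" using mult by blast
    then show "\<phi> (x \<otimes>\<^bsub>G\<^esub> y) = \<phi> x \<otimes>\<^bsub>H\<^esub> \<phi> y" using pq by (simp add: \<phi>N)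
  next
    fix x assume "x \<in> carrier G"
    then show "\<phi> x \<in> carrier H" using \<open>bij_betw \<phi> (carrier G) (carrier H)\<close> by (auto simp: bij_betw_def)
  qed
  ultimately show ?thesis by (auto simp: is_iso_def iso_def)
qed

section \<open>Normal forms \<open>z a^i b^j\<close> over the centre\<close>

locale central_pres = finite_group G for G (structure) +
  fixes a b c
  assumes pres: "central_presentation G a b c"
begin

lemma a [simp]: "a \<in> carrier G" and b [simp]: "b \<in> carrier G" and c_center: "c \<in> center G"
  and c_ne_one: "c \<noteq> \<one>" and c_square [simp]: "c \<otimes> c = \<one>" and ba: "b \<otimes> a = c \<otimes> (a \<otimes> b)"
  and aa_center: "a \<otimes> a \<in> center G" and bb_center: "b \<otimes> b \<in> center G"
  and cover: "g \<in> carrier G \<Longrightarrow> \<exists>z\<in>center G. g = z \<or> g = z \<otimes> a \<or> g = z \<otimes> b \<or> g = z \<otimes> (a \<otimes> b)"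
  using pres unfolding central_presentation_def by blast+

lemma c [simp]: "c \<in> carrier G"
  using c_center by (rule center_closed)

lemma ab_ne: "a \<otimes> b \<noteq> b \<otimes> a"
  using c_ne_one by (simp add: ba)

lemma central_left: "z \<in> center G \<Longrightarrow> x \<in> carrier G \<Longrightarrow> y \<in> carrier G \<Longrightarrow> x \<otimes> (z \<otimes> y) = z \<otimes> (x \<otimes> y)"
proof -
  assume z: "z \<in> center G" and xy: "x \<in> carrier G" "y \<in> carrier G"
  have "x \<otimes> (z \<otimes> y) = x \<otimes> z \<otimes> y" using center_closed[OF z] xy by (simp add: m_assoc)
  also have "x \<otimes> z = z \<otimes> x" using center_commute[OF z xy(1)] by simp
  finally show ?thesis using center_closed[OF z] xy by (simp add: m_assoc)
qed

definition pw :: "'a \<Rightarrow> bool \<Rightarrow> 'a" where "pw x i = (if i then x else \<one>)"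

lemma pw_closed [simp]: "x \<in> carrier G \<Longrightarrow> pw x i \<in> carrier G"
  by (simp add: pw_def)

lemma pw_center: "x \<in> center G \<Longrightarrow> pw x i \<in> center G"
  by (simp add: pw_def one_center)

definition nf :: "'a \<Rightarrow> bool \<Rightarrow> bool \<Rightarrow> 'a" where "nf z i j = z \<otimes> (pw a i \<otimes> pw b j)"

text \<open>Exponents add as booleans with carries: \<open>b^j\<close> passes \<open>a^k\<close> at
  the cost of \<open>c\<close> when both exponents are one, and a doubled \<open>a\<close> or
  \<open>b\<close> moves into the centre as its square.\<close>

lemma nf_mult:
  assumes z: "z \<in> center G" and w: "w \<in> center G"
  shows "nf z i j \<otimes> nf w k l =
    nf (z \<otimes> (w \<otimes> (pw c (j \<and> k) \<otimes> (pw (a \<otimes> a) (i \<and> k) \<otimes> pw (b \<otimes> b) (j \<and> l))))) (i \<noteq> k) (j \<noteq> l)"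
proof -
  define C S T where "C = pw c (j \<and> k)" and "S = pw (a \<otimes> a) (i \<and> k)" and "T = pw (b \<otimes> b) (j \<and> l)"
  define X Y X' Y' A B where "X = pw a i" and "Y = pw b j" and "X' = pw a k" and "Y' = pw b l"
    and "A = pw a (i \<noteq> k)" and "B = pw b (j \<noteq> l)"
  note defs = C_def S_def T_def X_def Y_def X'_def Y'_def A_def B_def
  have cen: "C \<in> center G" "S \<in> center G" "T \<in> center G"
    by (simp_all add: C_def S_def T_def pw_center c_center aa_center bb_center)
  have cl [simp]: "z \<in> carrier G" "w \<in> carrier G" "C \<in> carrier G" "S \<in> carrier G" "T \<in> carrier G"
    "X \<in> carrier G" "Y \<in> carrier G" "X' \<in> carrier G" "Y' \<in> carrier G" "A \<in> carrier G" "B \<in> carrier G"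
    using z w cen by (simp_all add: center_closed defs)
  have YX: "Y \<otimes> X' = C \<otimes> (X' \<otimes> Y)" by (cases j; cases k) (simp_all add: defs pw_def ba)
  have XX: "X \<otimes> X' = S \<otimes> A" by (cases i; cases k) (simp_all add: defs pw_def)
  have YY: "Y \<otimes> Y' = T \<otimes> B" by (cases j; cases l) (simp_all add: defs pw_def)
  have "nf z i j \<otimes> nf w k l = z \<otimes> (X \<otimes> (Y \<otimes> (w \<otimes> (X' \<otimes> Y'))))"
    by (simp add: nf_def defs[symmetric] m_assoc)
  also have "\<dots> = z \<otimes> (w \<otimes> (X \<otimes> (Y \<otimes> X' \<otimes> Y')))"
    by (simp add: central_left[OF w, of Y] central_left[OF w, of X] m_assoc)
  also have "\<dots> = z \<otimes> (w \<otimes> (C \<otimes> (X \<otimes> X' \<otimes> (Y \<otimes> Y'))))"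
    unfolding YX by (simp add: central_left[OF cen(1), of X] m_assoc)
  also have "\<dots> = z \<otimes> (w \<otimes> (C \<otimes> (S \<otimes> (T \<otimes> (A \<otimes> B)))))"
    unfolding XX YY by (simp add: central_left[OF cen(3), of A] m_assoc)
  also have "\<dots> = z \<otimes> (w \<otimes> (C \<otimes> (S \<otimes> T))) \<otimes> (A \<otimes> B)" by (simp add: m_assoc)
  finally show ?thesis by (simp only: nf_def defs)
qed

lemma nf_surj: assumes "g \<in> carrier G" shows "\<exists>z i j. z \<in> center G \<and> g = nf z i j"
proof -
  obtain z where z: "z \<in> center G" "g = z \<or> g = z \<otimes> a \<or> g = z \<otimes> b \<or> g = z \<otimes> (a \<otimes> b)"
    using cover[OF assms] by blast
  have "z = nf z False False" "z \<otimes> a = nf z True False" "z \<otimes> b = nf z False True" "z \<otimes> (a \<otimes> b) = nf z True True"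
    using center_closed[OF z(1)] by (simp_all add: nf_def pw_def)
  then show ?thesis using z by metis
qed

lemma nf_closed [simp]: "z \<in> center G \<Longrightarrow> nf z i j \<in> carrier G"
  by (simp add: nf_def center_closed)

lemma order_eq: "order G = 4 * card (center G)"
proof -
  let ?Z = "center G"
  let ?D = "?Z \<union> (\<lambda>z. z \<otimes> a) ` ?Z \<union> (\<lambda>z. z \<otimes> b) ` ?Z \<union> (\<lambda>z. z \<otimes> (a \<otimes> b)) ` ?Z"
  have "carrier G \<subseteq> ?D" using cover by blast
  then have "?D = carrier G" using center_coset_cases(2)[OF a b ab_ne] by blast
  then show ?thesis using center_coset_cases(1)[OF a b ab_ne] by (simp add: order_def)
qed

text \<open>Injectivity comes by counting: a surjection between finite sets of the same
  size.\<close>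

lemma nf_bij: "bij_betw (\<lambda>(z, i, j). nf z i j) (center G \<times> UNIV \<times> UNIV) (carrier G)"
proof -
  let ?S = "center G \<times> (UNIV :: bool set) \<times> (UNIV :: bool set)"
  have im: "(\<lambda>(z, i, j). nf z i j) ` ?S = carrier G"
  proof
    show "carrier G \<subseteq> (\<lambda>(z, i, j). nf z i j) ` ?S"
    proof
      fix g assume "g \<in> carrier G"
      then obtain z i j where "z \<in> center G" "g = nf z i j" using nf_surj by blast
      then show "g \<in> (\<lambda>(z, i, j). nf z i j) ` ?S" by (intro image_eqI[of _ _ "(z, i, j)"]) auto
    qed
  qed auto
  moreover have "inj_on (\<lambda>(z, i, j). nf z i j) ?S"
  proof (rule eq_card_imp_inj_on)
    show "finite ?S" using finite_center by simp
    show "card ((\<lambda>(z, i, j). nf z i j) ` ?S) = card ?S"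
      unfolding im card_cartesian_product card_UNIV_bool using order_eq by (simp add: order_def)
  qed
  ultimately show ?thesis by (simp add: bij_betw_def)
qed

lemma nf_inj:
  "z \<in> center G \<Longrightarrow> w \<in> center G \<Longrightarrow> nf z i j = nf w k l \<longleftrightarrow> z = w \<and> i = k \<and> j = l"
  using inj_on_eq_iff[OF bij_betw_imp_inj_on[OF nf_bij], of "(z, i, j)" "(w, k, l)"] by simp

lemma nf_center: assumes z: "z \<in> center G" shows "nf z i j \<in> center G \<longleftrightarrow> \<not> i \<and> \<not> j"
proof
  assume *: "nf z i j \<in> center G"
  have "nf (nf z i j) False False = nf z i j" using z by (simp add: nf_def pw_def center_closed)
  then show "\<not> i \<and> \<not> j" using nf_inj[OF * z] by auto
qed (use z in \<open>simp add: nf_def pw_def center_closed\<close>)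

text \<open>Elements with commutator \<open>c\<close> do not commute, so
  \<open>central_presentation_exists\<close> applies to them; cancellation shows that the commutator
  it provides is \<open>c\<close>.\<close>

lemma change_generators:
  assumes x: "x \<in> carrier G" and y: "y \<in> carrier G" and yx: "y \<otimes> x = c \<otimes> (x \<otimes> y)"
  shows "central_presentation G x y c"
proof -
  have "x \<otimes> y \<noteq> y \<otimes> x" using x y c_ne_one by (simp add: yx)
  then obtain c' where c': "central_presentation G x y c'"
    using central_presentation_exists[OF x y _ order_eq] by blast
  then have "y \<otimes> x = c' \<otimes> (x \<otimes> y)" "c' \<in> carrier G"
    by (auto simp: central_presentation_def center_closed)
  moreover from this have "c' \<otimes> (x \<otimes> y) = c \<otimes> (x \<otimes> y)" using yx by simp
  ultimately have "c' = c" using x y by simp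
  then show ?thesis using c' by simp
qed

lemma swap: "central_presentation G b a c"
  by (rule change_generators) (simp_all add: ba m_assoc[symmetric])

lemma product: "central_presentation G a (a \<otimes> b) c"
proof (rule change_generators)
  show "a \<otimes> b \<otimes> a = c \<otimes> (a \<otimes> (a \<otimes> b))"
    by (simp add: m_assoc ba central_left[OF c_center])
qed simp_all

lemma scale: assumes z: "z \<in> center G" shows "central_presentation G (z \<otimes> a) b c"
proof (rule change_generators)
  have "b \<otimes> (z \<otimes> a) = z \<otimes> (c \<otimes> (a \<otimes> b))" using z by (simp add: central_left[OF z] ba)
  also have "\<dots> = c \<otimes> (z \<otimes> (a \<otimes> b))" using z by (simp add: central_left[OF c_center] center_closed)
  finally show "b \<otimes> (z \<otimes> a) = c \<otimes> (z \<otimes> a \<otimes> b)" using z by (simp add: m_assoc center_closed)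
qed (use z in \<open>simp_all add: center_closed\<close>)

lemma nf_square:
  assumes z: "z \<in> center G"
  shows "nf z i j \<otimes> nf z i j = z \<otimes> (z \<otimes> (pw c (j \<and> i) \<otimes> (pw (a \<otimes> a) i \<otimes> pw (b \<otimes> b) j)))"
  unfolding nf_mult[OF z z] using z by (simp add: nf_def pw_def center_closed)

lemma product_square: "a \<otimes> b \<otimes> (a \<otimes> b) = c \<otimes> (a \<otimes> a \<otimes> (b \<otimes> b))"
proof -
  have "a \<otimes> b = nf \<one> True True" by (simp add: nf_def pw_def)
  then show ?thesis using nf_square[OF one_center, of True True] by (simp add: pw_def)
qed

lemma scale_square: assumes z: "z \<in> center G" shows "z \<otimes> a \<otimes> (z \<otimes> a) = z \<otimes> z \<otimes> (a \<otimes> a)"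
  using central_left[OF z, of a a] z by (simp add: m_assoc center_closed)

text \<open>The normal forms of \<open>g h\<close> and \<open>h g\<close> differ only in the power
  of \<open>c\<close>.\<close>

lemma commutator: assumes g: "g \<in> carrier G" and h: "h \<in> carrier G"
  shows "h \<otimes> g = g \<otimes> h \<or> h \<otimes> g = c \<otimes> (g \<otimes> h)"
proof -
  obtain z i j w k l where zw: "z \<in> center G" "w \<in> center G" and gh: "g = nf z i j" "h = nf w k l"
    using nf_surj[OF g] nf_surj[OF h] by blast
  define R where "R = pw (a \<otimes> a) (i \<and> k) \<otimes> pw (b \<otimes> b) (j \<and> l)"
  define X where "X = pw a (i \<noteq> k) \<otimes> pw b (j \<noteq> l)"
  have cl [simp]: "z \<in> carrier G" "w \<in> carrier G" "R \<in> carrier G" "X \<in> carrier G"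
    using zw by (simp_all add: center_closed R_def X_def)
  have gh': "g \<otimes> h = pw c (j \<and> k) \<otimes> (z \<otimes> (w \<otimes> (R \<otimes> X)))"
  proof -
    have "g \<otimes> h = z \<otimes> (w \<otimes> (pw c (j \<and> k) \<otimes> R)) \<otimes> X"
      unfolding gh nf_mult[OF zw] by (simp only: nf_def R_def X_def)
    then show ?thesis by (simp add: m_assoc central_left[OF pw_center[OF c_center]])
  qed
  have "(k \<noteq> i) = (i \<noteq> k)" "(l \<noteq> j) = (j \<noteq> l)" by auto
  then have "h \<otimes> g = w \<otimes> (z \<otimes> (pw c (l \<and> i) \<otimes> R)) \<otimes> X"
    unfolding gh nf_mult[OF zw(2,1)] by (simp only: nf_def R_def X_def conj_commute[of k] conj_commute[of l j])
  also have "\<dots> = pw c (l \<and> i) \<otimes> (w \<otimes> (z \<otimes> (R \<otimes> X)))"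
    by (simp add: m_assoc central_left[OF pw_center[OF c_center]])
  also have "w \<otimes> (z \<otimes> (R \<otimes> X)) = z \<otimes> (w \<otimes> (R \<otimes> X))" by (rule central_left[OF zw(1)]) simp_all
  finally have hg: "h \<otimes> g = pw c (l \<and> i) \<otimes> (z \<otimes> (w \<otimes> (R \<otimes> X)))" .
  show ?thesis unfolding gh' hg by (cases "l \<and> i"; cases "j \<and> k") (simp_all add: pw_def m_assoc[symmetric])
qed

end

text \<open>The groups with \<open>|G / Z(G)| = 4\<close>. The booleans are exponents: \<open>d\<^sup>2 = c\<^sup>e\<close>,
  \<open>a\<^sup>2 = c\<^sup>s d\<^sup>s'\<close> and \<open>b\<^sup>2 = c\<^sup>t d\<^sup>t'\<close>, and \<open>m\<close> tells whether \<open>d\<close> lies outside \<open>\<langle>c\<rangle>\<close>;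
  otherwise \<open>d = 1\<close>.\<close>

definition central_kind ::
    "bool \<Rightarrow> bool \<Rightarrow> bool \<times> bool \<Rightarrow> bool \<times> bool \<Rightarrow> ('g, 'm) monoid_scheme \<Rightarrow> 'g \<Rightarrow> 'g \<Rightarrow> 'g \<Rightarrow> 'g \<Rightarrow> bool" where
  "central_kind m e s t M a b c d \<longleftrightarrow> central_presentation M a b c \<and>
     center M = {\<one>\<^bsub>M\<^esub>, c, d, c \<otimes>\<^bsub>M\<^esub> d} \<and>
     (if m then d \<noteq> \<one>\<^bsub>M\<^esub> \<and> d \<noteq> c else d = \<one>\<^bsub>M\<^esub> \<and> \<not> snd s \<and> \<not> snd t) \<and>
     d \<otimes>\<^bsub>M\<^esub> d = (if e then c else \<one>\<^bsub>M\<^esub>) \<and>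
     a \<otimes>\<^bsub>M\<^esub> a = (if fst s then c else \<one>\<^bsub>M\<^esub>) \<otimes>\<^bsub>M\<^esub> (if snd s then d else \<one>\<^bsub>M\<^esub>) \<and>
     b \<otimes>\<^bsub>M\<^esub> b = (if fst t then c else \<one>\<^bsub>M\<^esub>) \<otimes>\<^bsub>M\<^esub> (if snd t then d else \<one>\<^bsub>M\<^esub>)"

text \<open>Multiplies elements \<open>c^p d^q\<close> in exponent form; the term with
  \<open>e\<close> is the carry from \<open>d d = c\<close>.\<close>

definition cmul :: "bool \<Rightarrow> bool \<times> bool \<Rightarrow> bool \<times> bool \<Rightarrow> bool \<times> bool" where
  "cmul e x y = (fst x \<noteq> (fst y \<noteq> (e \<and> snd x \<and> snd y)), snd x \<noteq> snd y)"

text \<open>Multiplication table of the normal forms \<open>c^p d^q a^i b^j\<close>. It depends only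
  on \<open>e\<close>, \<open>s\<close> and \<open>t\<close>, so two groups of the same kind share
  it.\<close>

definition kmul ::
    "bool \<Rightarrow> bool \<times> bool \<Rightarrow> bool \<times> bool \<Rightarrow> (bool \<times> bool) \<times> bool \<times> bool \<Rightarrow> (bool \<times> bool) \<times> bool \<times> bool
      \<Rightarrow> (bool \<times> bool) \<times> bool \<times> bool" where
  "kmul e s t = (\<lambda>(x, i, j) (y, k, l).
     (cmul e x (cmul e y (cmul e (j \<and> k, False) (cmul e (fst s \<and> i \<and> k, snd s \<and> i \<and> k) (fst t \<and> j \<and> l, snd t \<and> j \<and> l)))),
      i \<noteq> k, j \<noteq> l))"

locale central_kind_pres = central_pres G a b c for G (structure) and a b c +
  fixes d m e s t
  assumes kind: "central_kind m e s t G a b c d"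
begin

lemma d [simp]: "d \<in> carrier G" and d_center: "d \<in> center G"
  and center_eq: "center G = {\<one>, c, d, c \<otimes> d}"
  and dd: "d \<otimes> d = (if e then c else \<one>)"
  and aa: "a \<otimes> a = pw c (fst s) \<otimes> pw d (snd s)" and bb: "b \<otimes> b = pw c (fst t) \<otimes> pw d (snd t)"
proof -
  show c: "center G = {\<one>, c, d, c \<otimes> d}" "d \<otimes> d = (if e then c else \<one>)"
    "a \<otimes> a = pw c (fst s) \<otimes> pw d (snd s)" "b \<otimes> b = pw c (fst t) \<otimes> pw d (snd t)"
    using kind unfolding central_kind_def pw_def by blast+
  then show "d \<in> center G" by blast
  then show "d \<in> carrier G" by (rule center_closed)
qed

lemma m_cases: "m \<Longrightarrow> d \<noteq> \<one> \<and> d \<noteq> c" "\<not> m \<Longrightarrow> d = \<one> \<and> \<not> snd s \<and> \<not> snd t"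
  using kind unfolding central_kind_def by (auto split: if_splits)

definition ce :: "bool \<times> bool \<Rightarrow> 'a" where "ce x = pw c (fst x) \<otimes> pw d (snd x)"

lemma ce_center: "ce x \<in> center G"
  unfolding ce_def by (intro center_mult pw_center c_center d_center)

lemma ce_mult: "ce x \<otimes> ce y = ce (cmul e x y)"
proof -
  have dc: "d \<otimes> c = c \<otimes> d" using center_commute[OF d_center, of c] by simp
  have cc: "c \<otimes> (c \<otimes> g) = g" if "g \<in> carrier G" for g using that by (simp add: m_assoc[symmetric])
  have dcd: "d \<otimes> (c \<otimes> d) = c \<otimes> (d \<otimes> d)" by (rule central_left[OF c_center]) simp_all
  obtain p q p' q' where "x = (p, q)" "y = (p', q')" by fastforce
  then show ?thesis
    by (cases p; cases q; cases p'; cases q'; cases e)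
      (simp_all add: ce_def cmul_def pw_def dc dd cc dcd m_assoc)
qed

lemma ce_surj: "z \<in> center G \<Longrightarrow> \<exists>x. (\<not> m \<longrightarrow> \<not> snd x) \<and> z = ce x"
proof -
  have "ce (False, False) = \<one>" "ce (True, False) = c" "ce (False, True) = d" "ce (True, True) = c \<otimes> d"
    by (simp_all add: ce_def pw_def)
  moreover have "d = \<one>" if "\<not> m" using m_cases that by blast
  moreover assume "z \<in> center G"
  ultimately show ?thesis unfolding center_eq by (cases m) (metis empty_iff insert_iff snd_conv r_one c)+
qed

lemma card_center: "card (center G) = (if m then 4 else 2)"
proof (cases m)
  case True
  then have "d \<noteq> \<one>" "d \<noteq> c" using m_cases by auto
  moreover have "c \<otimes> d \<noteq> \<one>"
  proof
    assume "c \<otimes> d = \<one>"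
    then have "c \<otimes> (c \<otimes> d) = c" by simp
    then show False using \<open>d \<noteq> c\<close> by (simp add: m_assoc[symmetric])
  qed
  moreover have "c \<otimes> d \<noteq> c" "c \<otimes> d \<noteq> d" using \<open>d \<noteq> \<one>\<close> c_ne_one by simp_all
  ultimately have "card {\<one>, c, d, c \<otimes> d} = 4" using c_ne_one by (simp add: eq_commute)
  then show ?thesis using True by (simp add: center_eq)
next
  case False
  then have "d = \<one>" using m_cases by auto
  then have "center G = {\<one>, c}" unfolding center_eq by auto
  then show ?thesis using False c_ne_one by simp
qed

text \<open>Without \<open>m\<close> the element \<open>d\<close> is one, and its exponent is frozen
  to keep normal forms unique.\<close>

definition S :: "((bool \<times> bool) \<times> bool \<times> bool) set" where "S = {(x, i, j). \<not> m \<longrightarrow> \<not> snd x}"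

definition knf :: "(bool \<times> bool) \<times> bool \<times> bool \<Rightarrow> 'a" where "knf = (\<lambda>(x, i, j). nf (ce x) i j)"

lemma knf_mult: "knf p \<otimes> knf q = knf (kmul e s t p q)"
proof -
  obtain x i j y k l where pq: "p = (x, i, j)" "q = (y, k, l)" by (metis prod_cases3)
  have "pw c (j \<and> k) = ce (j \<and> k, False)" by (simp add: ce_def pw_def)
  moreover have "pw (a \<otimes> a) (i \<and> k) = ce (fst s \<and> i \<and> k, snd s \<and> i \<and> k)"
    unfolding aa by (cases "i \<and> k") (auto simp: ce_def pw_def)
  moreover have "pw (b \<otimes> b) (j \<and> l) = ce (fst t \<and> j \<and> l, snd t \<and> j \<and> l)"
    unfolding bb by (cases "j \<and> l") (auto simp: ce_def pw_def)
  ultimately show ?thesis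
    by (simp add: pq knf_def kmul_def nf_mult[OF ce_center ce_center] ce_mult)
qed

lemma kmul_S: "p \<in> S \<Longrightarrow> q \<in> S \<Longrightarrow> kmul e s t p q \<in> S"
  using m_cases by (auto simp: S_def kmul_def cmul_def)

lemma knf_bij: "bij_betw knf S (carrier G)"
proof -
  have im: "knf ` S = carrier G"
  proof
    show "knf ` S \<subseteq> carrier G" by (auto simp: knf_def ce_center)
    show "carrier G \<subseteq> knf ` S"
    proof
      fix g assume "g \<in> carrier G"
      then obtain z i j where z: "z \<in> center G" "g = nf z i j" using nf_surj by blast
      then obtain x where "\<not> m \<longrightarrow> \<not> snd x" "z = ce x" using ce_surj by blast
      then have "(x, i, j) \<in> S" "g = knf (x, i, j)" using z by (simp_all add: S_def knf_def)
      then show "g \<in> knf ` S" by blast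
    qed
  qed
  have "card S = (if m then 16 else 8)"
  proof (cases m)
    case True
    then have "S = ((UNIV :: bool set) \<times> (UNIV :: bool set)) \<times> (UNIV :: bool set) \<times> (UNIV :: bool set)"
      unfolding S_def by auto
    then have "card S = 2 * 2 * (2 * 2)" by (simp only: card_cartesian_product card_UNIV_bool)
    then show ?thesis using True by simp
  next
    case False
    then have "S = ((UNIV :: bool set) \<times> {False}) \<times> (UNIV :: bool set) \<times> (UNIV :: bool set)"
      unfolding S_def by auto
    then have "card S = 2 * card {False} * (2 * 2)" by (simp only: card_cartesian_product card_UNIV_bool)
    then show ?thesis using False by simp
  qed
  then have "card (knf ` S) = card S" unfolding im using order_eq card_center by (simp add: order_def)
  then have "inj_on knf S" by (rule eq_card_imp_inj_on[rotated]) simp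
  then show ?thesis using im by (simp add: bij_betw_def)
qed

end

lemma central_kind_iso:
  assumes "finite_group G" "finite_group H" "central_kind m e s t G a b c d" "central_kind m e s t H a' b' c' d'"
  shows "G \<cong> H"
proof -
  interpret G: finite_group G by fact
  interpret H: finite_group H by fact
  interpret G: central_kind_pres G a b c d m e s t
    by unfold_locales (use assms(3) in \<open>simp_all add: central_kind_def\<close>)
  interpret H: central_kind_pres H a' b' c' d' m e s t
    by unfold_locales (use assms(4) in \<open>simp_all add: central_kind_def\<close>)
  show ?thesis
  proof (rule iso_by_normal_form[OF G.knf_bij])
    show "bij_betw H.knf G.S (carrier H)" using H.knf_bij by (simp add: G.S_def H.S_def)
    show "\<exists>r\<in>G.S. G.knf p \<otimes>\<^bsub>G\<^esub> G.knf q = G.knf r \<and> H.knf p \<otimes>\<^bsub>H\<^esub> H.knf q = H.knf r"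
      if "p \<in> G.S" "q \<in> G.S" for p q
      using G.knf_mult H.knf_mult G.kmul_S[OF that] by blast
  qed
qed

section \<open>Groups of order sixteen with an element of order eight\<close>

text \<open>\<open>e\<close> gives the action of \<open>b\<close> on the cyclic group of
  \<open>a\<close>, with 7 standing for inversion modulo 8; \<open>f\<close> locates the square of
  \<open>b\<close> in that group.\<close>

definition dihedral_kind :: "nat \<Rightarrow> nat \<Rightarrow> ('g, 'm) monoid_scheme \<Rightarrow> 'g \<Rightarrow> 'g \<Rightarrow> bool" where
  "dihedral_kind e f M a b \<longleftrightarrow> a \<in> carrier M \<and> b \<in> carrier M \<and> order M = 16 \<and>
     a [^]\<^bsub>M\<^esub> (4::nat) \<noteq> \<one>\<^bsub>M\<^esub> \<and> a [^]\<^bsub>M\<^esub> (8::nat) = \<one>\<^bsub>M\<^esub> \<and> b \<notin> range (\<lambda>i::nat. a [^]\<^bsub>M\<^esub> i) \<and>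
     b \<otimes>\<^bsub>M\<^esub> a = a [^]\<^bsub>M\<^esub> e \<otimes>\<^bsub>M\<^esub> b \<and> b \<otimes>\<^bsub>M\<^esub> b = a [^]\<^bsub>M\<^esub> f"

locale dihedral_pres = finite_group G for G (structure) +
  fixes a b e f
  assumes kind: "dihedral_kind e f G a b" and e: "e = 3 \<or> e = 7" and f: "f = 0 \<or> f = 4"
begin

lemma a [simp]: "a \<in> carrier G" and b [simp]: "b \<in> carrier G" and ord_G: "order G = 16"
  and a4: "a [^] (4::nat) \<noteq> \<one>" and a8: "a [^] (8::nat) = \<one>" and b_notin: "b \<notin> range (\<lambda>i::nat. a [^] i)"
  and ba: "b \<otimes> a = a [^] e \<otimes> b" and bb: "b \<otimes> b = a [^] f"
  using kind unfolding dihedral_kind_def by blast+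

definition P :: "nat \<Rightarrow> 'a" where "P i = a [^] i"

lemma P_closed [simp]: "P i \<in> carrier G"
  by (simp add: P_def)

lemma P_0 [simp]: "P 0 = \<one>"
  by (simp add: P_def)

lemma P_add: "P i \<otimes> P j = P (i + j)"
  by (simp add: P_def nat_pow_mult)

lemma P_add': "x \<in> carrier G \<Longrightarrow> P i \<otimes> (P j \<otimes> x) = P (i + j) \<otimes> x"
  by (simp add: m_assoc[symmetric] P_add)

lemma ord_a: "ord a = 8"
proof -
  have "ord a dvd 8" "\<not> ord a dvd 4" using a4 a8 pow_eq_id[OF a] by auto
  then have "ord a dvd 2 ^ 3" by simp
  then obtain k where k: "ord a = 2 ^ k" "k \<le> 3" using divides_primepow_nat[of 2 "ord a" 3] by auto
  have "k = 3"
  proof (rule ccontr)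
    assume "k \<noteq> 3"
    then have "k \<le> 2" using k by simp
    then have "(2::nat) ^ k dvd 2 ^ 2" by (rule le_imp_power_dvd)
    then show False using k \<open>\<not> ord a dvd 4\<close> by simp
  qed
  then show ?thesis using k by simp
qed

lemma P_mod: "P i = P (i mod 8)"
proof -
  have "P i = P (8 * (i div 8)) \<otimes> P (i mod 8)" by (simp add: P_add)
  also have "P (8 * (i div 8)) = \<one>" using a8 by (simp add: P_def flip: nat_pow_pow)
  finally show ?thesis by simp
qed

lemma P_eq_iff: "P i = P j \<longleftrightarrow> i mod 8 = j mod 8"
proof
  assume "P i = P j"
  then have "P (i mod 8) = P (j mod 8)" using P_mod by metis
  moreover have "inj_on (\<lambda>x. a [^] x) {0 .. 7 :: nat}" using ord_inj[OF a] by (simp add: ord_a)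
  moreover have "i mod 8 \<in> {0 .. 7}" "j mod 8 \<in> {0 .. 7}" by auto
  ultimately show "i mod 8 = j mod 8" unfolding P_def by (meson inj_onD)
next
  assume "i mod 8 = j mod 8"
  then show "P i = P j" using P_mod by metis
qed

lemma P_eqI: "i mod 8 = j mod 8 \<Longrightarrow> P i = P j"
  by (simp add: P_eq_iff)

lemma P_inv: "inv (P i) = P (7 * i)"
  by (rule inv_equality) (simp_all add: P_add P_eq_iff[of _ 0, simplified])

lemma P_one_iff: "P i = \<one> \<longleftrightarrow> i mod 8 = 0"
  using P_eq_iff[of i 0] by simp

lemma b_P: "b \<otimes> P i = P (e * i) \<otimes> b"
proof (induction i)
  case (Suc i)
  have "b \<otimes> P (Suc i) = b \<otimes> P i \<otimes> a" by (simp add: P_def m_assoc)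
  also have "\<dots> = P (e * i) \<otimes> (b \<otimes> a)" unfolding Suc by (simp add: m_assoc)
  also have "\<dots> = P (e * i) \<otimes> (P e \<otimes> b)" by (simp add: ba P_def)
  finally show ?case by (simp add: P_add' algebra_simps)
qed simp

lemma b_P': "x \<in> carrier G \<Longrightarrow> b \<otimes> (P i \<otimes> x) = P (e * i) \<otimes> (b \<otimes> x)"
  by (simp add: m_assoc[symmetric] b_P)

lemma bb': "b \<otimes> b = P f"
  by (simp add: bb P_def)

lemma P_b_mult: "P i \<otimes> b \<otimes> (P k \<otimes> b) = P (i + e * k + f)"
  by (simp add: m_assoc b_P' bb' P_add' P_add add.assoc)

lemma P_b_P: "P i \<otimes> b \<otimes> P k = P (i + e * k) \<otimes> b"
  by (simp add: m_assoc b_P P_add')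

definition A :: "'a set" where "A = range P"

lemma P_in_A [simp]: "P i \<in> A"
  by (simp add: A_def)

lemma P_b_notin_A [simp]: "P i \<otimes> b \<notin> A"
proof
  assume "P i \<otimes> b \<in> A"
  then obtain j where "P i \<otimes> b = P j" by (auto simp: A_def)
  then have "P (7 * i) \<otimes> (P i \<otimes> b) = P (7 * i) \<otimes> P j" by simp
  moreover have "P (7 * i + i) = P 0" by (rule P_eqI) simp
  ultimately have "b = P (7 * i + j)" by (simp add: P_add' P_add del: mult_Suc)
  then show False using b_notin by (simp add: P_def)
qed

definition N :: "nat \<times> bool \<Rightarrow> 'a" where "N = (\<lambda>(i, j). if j then P i \<otimes> b else P i)"

lemma N_bij: "bij_betw N ({..<8} \<times> UNIV) (carrier G)"
proof -
  have inj: "inj_on N ({..<8} \<times> UNIV)"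
  proof (rule inj_onI)
    fix p q :: "nat \<times> bool" assume "p \<in> {..<8} \<times> UNIV" "q \<in> {..<8} \<times> UNIV" "N p = N q"
    moreover obtain i j k l where "p = (i, j)" "q = (k, l)" by fastforce
    moreover have "P u \<otimes> b \<noteq> P v" for u v using P_b_notin_A[of u] P_in_A[of v] by metis
    moreover from this have "P v \<noteq> P u \<otimes> b" for u v by metis
    ultimately show "p = q" by (cases j; cases l) (simp_all add: N_def P_eq_iff)
  qed
  moreover have "card (N ` ({..<8} \<times> UNIV)) = card (carrier G)"
    using ord_G by (simp add: card_image[OF inj] order_def card_cartesian_product)
  moreover have "N ` ({..<8} \<times> UNIV) \<subseteq> carrier G" by (auto simp: N_def)
  ultimately show ?thesis by (simp add: bij_betw_def card_subset_eq)
qed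

lemma A_cases: assumes "g \<in> carrier G" obtains i where "g \<in> A" "g = P i" | i where "g \<notin> A" "g = P i \<otimes> b"
proof -
  have "g \<in> N ` ({..<8} \<times> UNIV)" using assms N_bij by (simp add: bij_betw_def)
  then show ?thesis using that by (auto simp: N_def split: if_splits)
qed

definition nmul :: "nat \<times> bool \<Rightarrow> nat \<times> bool \<Rightarrow> nat \<times> bool" where
  "nmul = (\<lambda>(i, j) (k, l). ((i + (if j then e * k else k) + (if j \<and> l then f else 0)) mod 8, j \<noteq> l))"

lemma N_mult: "N p \<otimes> N q = N (nmul p q)"
proof -
  obtain i j k l where "p = (i, j)" "q = (k, l)" by fastforce
  then show ?thesis
    by (cases j; cases l)
      (simp_all add: N_def nmul_def P_b_mult P_b_P P_add P_add' flip: P_mod)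
qed

lemma A_subgroup: "subgroup A G"
  by (rule subgroupI) (auto simp: A_def P_add P_inv)

lemma A_index_two: "g \<in> carrier G - A \<Longrightarrow> h \<in> carrier G - A \<Longrightarrow> g \<otimes> h \<in> A"
  by (elim DiffE, erule A_cases; erule A_cases) (simp_all add: P_b_mult)

lemma A_comm: "g \<in> A \<Longrightarrow> h \<in> A \<Longrightarrow> g \<otimes> h = h \<otimes> g"
  by (auto simp: A_def P_add add.commute)

text \<open>All outer elements act alike on the abelian \<open>A\<close>; conjugation by
  \<open>g\<close> and by its inverse agree because \<open>e e\<close> is one modulo 8, as
  \<open>9 = 1 + 8\<close> and \<open>49 = 1 + 8 * 6\<close>.\<close>

lemma A_conj:
  assumes "g \<in> carrier G - A" shows "inv g \<otimes> P j \<otimes> g = P (e * j)"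
proof -
  obtain i where g: "g = P i \<otimes> b" using assms A_cases[of g] by blast
  have "i + 3 * (3 * j) = j + i + 8 * j" "i + 7 * (7 * j) = j + i + 8 * (6 * j)" by simp_all
  then have "(i + 3 * (3 * j)) mod 8 = (j + i) mod 8" "(i + 7 * (7 * j)) mod 8 = (j + i) mod 8"
    by (simp_all only: mod_mult_self2)
  then have "(j + i) mod 8 = (i + e * (e * j)) mod 8" using e by metis
  then have "P j \<otimes> g = g \<otimes> P (e * j)"
    unfolding g P_b_P by (simp add: P_add' P_eqI[of "j + i" "i + e * (e * j)"])
  then have "inv g \<otimes> (P j \<otimes> g) = P (e * j)" using assms by (simp add: m_assoc[symmetric])
  then show ?thesis using assms by (simp add: m_assoc)
qed

text \<open>Both \<open>3 * 4\<close> and \<open>7 * 4\<close> are 4 modulo 8.\<close>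

lemma P4_center: "P 4 \<in> center G"
proof (rule centerI)
  fix g assume "g \<in> carrier G"
  then show "P 4 \<otimes> g = g \<otimes> P 4"
  proof (cases rule: A_cases)
    case (1 i)
    then show ?thesis by (simp add: P_add add.commute)
  next
    case (2 i)
    have "i + 3 * 4 = 4 + i + 8 * 1" "i + 7 * 4 = 4 + i + 8 * 3" by simp_all
    then have "(i + 3 * 4) mod 8 = (4 + i) mod 8" "(i + 7 * 4) mod 8 = (4 + i) mod 8"
      by (simp_all only: mod_mult_self2)
    then have "(4 + i) mod 8 = (i + e * 4) mod 8" using e by metis
    then show ?thesis unfolding 2 P_b_P by (simp add: P_add' P_eqI[of "4 + i" "i + e * 4"])
  qed
qed simp

end

lemma dihedral_kind_iso:
  assumes "finite_group G" "finite_group H" "dihedral_kind e f G a b" "dihedral_kind e f H a' b'"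
    and "e = 3 \<or> e = 7" "f = 0 \<or> f = 4"
  shows "G \<cong> H"
proof -
  interpret G: finite_group G by fact
  interpret H: finite_group H by fact
  interpret G: dihedral_pres G a b e f by unfold_locales fact+
  interpret H: dihedral_pres H a' b' e f by unfold_locales fact+
  show ?thesis
  proof (rule iso_by_normal_form[OF G.N_bij H.N_bij])
    fix p q :: "nat \<times> bool" assume "p \<in> {..<8} \<times> UNIV" "q \<in> {..<8} \<times> UNIV"
    have "G.nmul p q \<in> {..<8} \<times> UNIV" by (cases p; cases q) (simp add: G.nmul_def)
    moreover have "G.nmul = H.nmul" by (simp add: G.nmul_def H.nmul_def)
    ultimately show "\<exists>r\<in>{..<8} \<times> UNIV. G.N p \<otimes>\<^bsub>G\<^esub> G.N q = G.N r \<and> H.N p \<otimes>\<^bsub>H\<^esub> H.N q = H.N r"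
      using G.N_mult H.N_mult by metis
  qed
qed

section \<open>Choosing generators with prescribed squares\<close>

context central_pres
begin

text \<open>The squares of \<open>a\<close>, \<open>b\<close> and \<open>ab\<close> multiply to \<open>c\<close>, and every ordering of two of these
  generators satisfies the same relations.\<close>

lemma central_kind_elementary:
  assumes Z: "center G = {\<one>, c, d, c \<otimes> d}" and d: "d \<otimes> d = \<one>"
  shows "\<exists>x y. central_presentation G x y c \<and>
    (x \<otimes> x = \<one> \<and> y \<otimes> y = \<one> \<or> x \<otimes> x = c \<and> y \<otimes> y = c \<or>
     x \<otimes> x = \<one> \<and> y \<otimes> y \<notin> {\<one>, c} \<or> x \<otimes> x = y \<otimes> y \<and> x \<otimes> x \<notin> {\<one>, c})"
proof -
  have dZ: "d \<in> center G" using Z by blast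
  have dG [simp]: "d \<in> carrier G" using dZ by (rule center_closed)
  have dc: "d \<otimes> c = c \<otimes> d" using center_commute[OF dZ, of c] by simp
  have cc: "c \<otimes> (c \<otimes> g) = g" "d \<otimes> (d \<otimes> g) = g" if "g \<in> carrier G" for g
    using that by (simp_all add: m_assoc[symmetric] d)
  have dcg: "d \<otimes> (c \<otimes> g) = c \<otimes> (d \<otimes> g)" if "g \<in> carrier G" for g
    using central_left[OF c_center, of d g] that by simp
  let ?Q = "\<lambda>s t. s = \<one> \<and> t = \<one> \<or> s = c \<and> t = c \<or> s = \<one> \<and> t \<notin> {\<one>, c} \<or> s = t \<and> s \<notin> {\<one>, c}"
  have eqs: "c \<otimes> d = \<one> \<longleftrightarrow> d = c" "c \<otimes> d = c \<longleftrightarrow> d = \<one>" "c \<otimes> d \<noteq> d" "c \<noteq> \<one>"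
    using cc(1)[of d] c_ne_one by auto
  \<comment> \<open>\<open>u\<close> stands for the square of \<open>ab\<close>; what remains is a
    check over the at most sixteen pairs of central values \<open>s\<close>,
    \<open>t\<close>.\<close>
  have main: "?Q s t \<or> ?Q t s \<or> ?Q s u \<or> ?Q u s \<or> ?Q t u \<or> ?Q u t"
    if "s \<in> center G" "t \<in> center G" "u = c \<otimes> (s \<otimes> t)" for s t u
  proof (cases "d = \<one> \<or> d = c")
    case True
    then have "center G = {\<one>, c}" unfolding Z by auto
    then have "s = \<one> \<or> s = c" "t = \<one> \<or> t = c" using that by auto
    then show ?thesis using that(3) by (elim disjE) (simp_all add: c_ne_one)
  next
    case False
    then have "c \<otimes> d \<noteq> \<one>" "c \<otimes> d \<noteq> c" "c \<otimes> d \<noteq> d" "d \<noteq> \<one>" "d \<noteq> c" using eqs by auto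
    moreover have "s = \<one> \<or> s = c \<or> s = d \<or> s = c \<otimes> d" "t = \<one> \<or> t = c \<or> t = d \<or> t = c \<otimes> d"
      using that unfolding Z by auto
    ultimately show ?thesis
      using that(3) by (elim disjE) (simp_all add: dc cc d dcg c_ne_one m_assoc)
  qed
  interpret ab: central_pres G a "a \<otimes> b" c by unfold_locales (rule product)
  interpret ba: central_pres G b a c by unfold_locales (rule swap)
  interpret bab: central_pres G b "b \<otimes> a" c by unfold_locales (rule ba.product)
  have "b \<otimes> a \<otimes> (b \<otimes> a) = c \<otimes> (a \<otimes> a \<otimes> (b \<otimes> b))"
    using ba.product_square center_commute[OF bb_center, of "a \<otimes> a"] by simp
  then show ?thesis
    using main[OF aa_center bb_center refl] pres product swap ab.swap ba.product bab.swap product_square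
    by metis
qed

text \<open>The centre is cyclic of order four. A generator with square \<open>c\<close> becomes an
  involution when multiplied by \<open>d\<close>; and if neither \<open>a a\<close> nor
  \<open>b b\<close> lies in \<open>{1, c}\<close>, then \<open>c (a a) (b b)\<close>, the square of
  \<open>ab\<close>, does.\<close>

lemma central_kind_cyclic:
  assumes Z: "center G = {\<one>, c, d, c \<otimes> d}" and d: "d \<otimes> d = c"
  shows "\<exists>x y. central_presentation G x y c \<and> x \<otimes> x = \<one> \<and> (y \<otimes> y = \<one> \<or> y \<otimes> y = d \<or> y \<otimes> y = c \<otimes> d)"
proof -
  have dZ: "d \<in> center G" using Z by blast
  have dG [simp]: "d \<in> carrier G" using dZ by (rule center_closed)
  have dc: "d \<otimes> c = c \<otimes> d" using center_commute[OF dZ, of c] by simp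
  have cc: "c \<otimes> (c \<otimes> g) = g" "d \<otimes> (d \<otimes> g) = c \<otimes> g" if "g \<in> carrier G" for g
    using that by (simp_all add: m_assoc[symmetric] d)
  have dcg: "d \<otimes> (c \<otimes> g) = c \<otimes> (d \<otimes> g)" if "g \<in> carrier G" for g
    using central_left[OF c_center, of d g] that by simp
  have red: "\<exists>x. central_presentation G x v c \<and> x \<otimes> x = \<one>"
    if p: "central_presentation G u v c" and uu: "u \<otimes> u = \<one> \<or> u \<otimes> u = c" for u v
  proof (cases "u \<otimes> u = \<one>")
    case False
    interpret p: central_pres G u v c by unfold_locales (rule p)
    have "d \<otimes> u \<otimes> (d \<otimes> u) = \<one>" using p.scale_square[OF dZ] uu False d by simp
    then show ?thesis using p.scale[OF dZ] by blast
  qed (use p in blast)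
  have fin: ?thesis if p: "central_presentation G u v c" and uu: "u \<otimes> u = \<one> \<or> u \<otimes> u = c" for u v
  proof -
    obtain x where x: "central_presentation G x v c" "x \<otimes> x = \<one>" using red[OF p uu] by blast
    interpret x: central_pres G x v c by unfold_locales (rule x)
    consider "v \<otimes> v = \<one> \<or> v \<otimes> v = c" | "v \<otimes> v = d \<or> v \<otimes> v = c \<otimes> d" using x.bb_center Z by blast
    then show ?thesis
    proof cases
      case 1
      obtain y where y: "central_presentation G y x c" "y \<otimes> y = \<one>" using red[OF x.swap 1] by blast
      then show ?thesis using central_pres.swap[of G y x c] x(2)
        by (auto simp: central_pres_def central_pres_axioms_def finite_group_axioms)
    next
      case 2
      then show ?thesis using x by blast
    qed
  qed
  interpret ab: central_pres G a "a \<otimes> b" c by unfold_locales (rule product)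
  consider "a \<otimes> a = \<one> \<or> a \<otimes> a = c" | "b \<otimes> b = \<one> \<or> b \<otimes> b = c"
    | "a \<otimes> a = d \<or> a \<otimes> a = c \<otimes> d" "b \<otimes> b = d \<or> b \<otimes> b = c \<otimes> d"
    using aa_center bb_center Z by blast
  then show ?thesis
  proof cases
    case 1
    then show ?thesis using fin[OF pres] by blast
  next
    case 2
    then show ?thesis using fin[OF swap] by blast
  next
    case 3
    have "a \<otimes> b \<otimes> (a \<otimes> b) = \<one> \<or> a \<otimes> b \<otimes> (a \<otimes> b) = c"
    proof -
      have "c \<otimes> (s \<otimes> t) = \<one> \<or> c \<otimes> (s \<otimes> t) = c"
        if "s = d \<or> s = c \<otimes> d" "t = d \<or> t = c \<otimes> d" for s t
        using that by (auto simp: dc cc d dcg m_assoc)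
      then show ?thesis unfolding product_square using 3 by blast
    qed
    then show ?thesis using fin[OF ab.swap] by blast
  qed
qed

end

section \<open>Classification\<close>

text \<open>\<open>C22_C4\<close> and \<open>C4_C4\<close> are the semidirect products \<open>C\<^sub>2\<^sup>2 \<rtimes> C\<^sub>4\<close> and \<open>C\<^sub>4 \<rtimes> C\<^sub>4\<close>,
  \<open>D8_C4\<close> is the central product of \<open>D\<^sub>8\<close> and \<open>C\<^sub>4\<close>, and \<open>M16\<close> is the modular group.\<close>

datatype kind = D8 | Q8 | D8_C2 | Q8_C2 | C22_C4 | C4_C4 | D8_C4 | M16 | D16 | SD16 | Q16

fun of_kind :: "kind \<Rightarrow> ('g, 'm) monoid_scheme \<Rightarrow> bool" where
  "of_kind D8 M = (\<exists>a b c d. central_kind False False (False, False) (False, False) M a b c d)"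
| "of_kind Q8 M = (\<exists>a b c d. central_kind False False (True, False) (True, False) M a b c d)"
| "of_kind D8_C2 M = (\<exists>a b c d. central_kind True False (False, False) (False, False) M a b c d)"
| "of_kind Q8_C2 M = (\<exists>a b c d. central_kind True False (True, False) (True, False) M a b c d)"
| "of_kind C22_C4 M = (\<exists>a b c d. central_kind True False (False, False) (False, True) M a b c d)"
| "of_kind C4_C4 M = (\<exists>a b c d. central_kind True False (False, True) (False, True) M a b c d)"
| "of_kind D8_C4 M = (\<exists>a b c d. central_kind True True (False, False) (False, False) M a b c d)"
| "of_kind M16 M = (\<exists>a b c d. central_kind True True (False, False) (False, True) M a b c d)"
| "of_kind D16 M = (\<exists>a b. dihedral_kind 7 0 M a b)"
| "of_kind SD16 M = (\<exists>a b. dihedral_kind 3 0 M a b)"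
| "of_kind Q16 M = (\<exists>a b. dihedral_kind 7 4 M a b)"

lemma of_kind_iso:
  assumes "finite_group G" "finite_group H" "of_kind k G" "of_kind k H"
  shows "G \<cong> H"
proof -
  note iso = central_kind_iso[OF assms(1,2)] dihedral_kind_iso[OF assms(1,2), of 7 0, simplified]
    dihedral_kind_iso[OF assms(1,2), of 3 0, simplified] dihedral_kind_iso[OF assms(1,2), of 7 4, simplified]
  show ?thesis using assms(3,4) by (cases k; simp only: of_kind.simps; blast intro: iso)
qed

context central_pres
begin

lemma of_kind_two:
  assumes "card (center G) = 2" shows "\<exists>k. of_kind k G"
proof -
  have "{\<one>, c} = center G"
    using assms c_ne_one c_center one_center finite_center by (intro card_subset_eq) auto
  then have Z: "center G = {\<one>, c, \<one>, c \<otimes> \<one>}" by auto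
  obtain x y where p: "central_presentation G x y c"
    and sq: "x \<otimes> x = \<one> \<and> y \<otimes> y = \<one> \<or> x \<otimes> x = c \<and> y \<otimes> y = c \<or>
     x \<otimes> x = \<one> \<and> y \<otimes> y \<notin> {\<one>, c} \<or> x \<otimes> x = y \<otimes> y \<and> x \<otimes> x \<notin> {\<one>, c}"
    using central_kind_elementary[OF Z] by auto
  have "x \<otimes> x \<in> center G" "y \<otimes> y \<in> center G" using p by (auto simp: central_presentation_def)
  then have "x \<otimes> x \<in> {\<one>, c}" "y \<otimes> y \<in> {\<one>, c}" using Z by auto
  then consider "x \<otimes> x = \<one>" "y \<otimes> y = \<one>" | "x \<otimes> x = c" "y \<otimes> y = c" using sq by auto
  then show ?thesis
  proof cases
    case 1
    then have "of_kind D8 G" using p Z unfolding of_kind.simps central_kind_def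
      by (intro exI[of _ x] exI[of _ y] exI[of _ c] exI[of _ \<one>]) simp
    then show ?thesis by blast
  next
    case 2
    then have "of_kind Q8 G" using p Z unfolding of_kind.simps central_kind_def
      by (intro exI[of _ x] exI[of _ y] exI[of _ c] exI[of _ \<one>]) simp
    then show ?thesis by blast
  qed
qed

text \<open>Any central \<open>t\<close> outside \<open>{1, c}\<close> can play the part of
  \<open>d\<close>. When a generator has its square outside \<open>{1, c}\<close>, that square is
  taken as \<open>d\<close>, which leaves only the listed exponent patterns.\<close>

lemma of_kind_four:
  assumes card: "card (center G) = 4" shows "\<exists>k. of_kind k G"
proof -
  have Z: "center G = {\<one>, c, t, c \<otimes> t}" if t: "t \<in> center G" "t \<noteq> \<one>" "t \<noteq> c" for t
  proof -
    have tG: "t \<in> carrier G" using t(1) by (rule center_closed)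
    have "c \<otimes> t \<noteq> \<one>"
    proof
      assume "c \<otimes> t = \<one>"
      then have "c \<otimes> (c \<otimes> t) = c" by simp
      then show False using t(3) tG by (simp add: m_assoc[symmetric])
    qed
    moreover have "c \<otimes> t \<noteq> c" "c \<otimes> t \<noteq> t" using t(2) tG c_ne_one by auto
    ultimately have "card {\<one>, c, t, c \<otimes> t} = card (center G)"
      using t c_ne_one by (simp add: card eq_commute)
    moreover have "{\<one>, c, t, c \<otimes> t} \<subseteq> center G" using t one_center c_center center_mult by blast
    ultimately show ?thesis using card_subset_eq[OF finite_center] by metis
  qed
  obtain d where d: "d \<in> center G" "d \<noteq> \<one>" "d \<noteq> c"
  proof -
    have "card {\<one>, c} < card (center G)" using c_ne_one by (simp add: card)
    then have "\<not> center G \<subseteq> {\<one>, c}" by (meson card_mono finite.emptyI finite.insertI leD)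
    then show ?thesis using that by blast
  qed
  have dG [simp]: "d \<in> carrier G" using d(1) by (rule center_closed)
  have "d \<otimes> d \<in> {\<one>, c, d, c \<otimes> d}" using center_mult[OF d(1,1)] Z[OF d] by simp
  then consider (1) "d \<otimes> d = \<one>" | (2) "d \<otimes> d = c" using d by auto
  then show ?thesis
  proof cases
    case 1
    obtain x y where p: "central_presentation G x y c"
      and sq: "x \<otimes> x = \<one> \<and> y \<otimes> y = \<one> \<or> x \<otimes> x = c \<and> y \<otimes> y = c \<or>
        x \<otimes> x = \<one> \<and> y \<otimes> y \<notin> {\<one>, c} \<or> x \<otimes> x = y \<otimes> y \<and> x \<otimes> x \<notin> {\<one>, c}"
      using central_kind_elementary[OF Z[OF d] 1] by blast
    have yZ: "y \<otimes> y \<in> center G" and yG: "y \<in> carrier G" using p by (auto simp: central_presentation_def)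
    have cdd: "c \<otimes> d \<otimes> (c \<otimes> d) = \<one>"
      using central_left[OF c_center, of d d] 1 by (simp add: m_assoc)
    have yy: "y \<otimes> y \<otimes> (y \<otimes> y) = \<one>"
      using yZ 1 cdd unfolding Z[OF d] by (elim insertE emptyE) simp_all
    from sq consider "x \<otimes> x = \<one>" "y \<otimes> y = \<one>" | "x \<otimes> x = c" "y \<otimes> y = c"
      | "x \<otimes> x = \<one>" "y \<otimes> y \<noteq> \<one>" "y \<otimes> y \<noteq> c" | "x \<otimes> x = y \<otimes> y" "y \<otimes> y \<noteq> \<one>" "y \<otimes> y \<noteq> c" by auto
    then show ?thesis
    proof cases
      case 1
      then have "of_kind D8_C2 G" using p Z[OF d] d \<open>d \<otimes> d = \<one>\<close> unfolding of_kind.simps central_kind_def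
        by (intro exI[of _ x] exI[of _ y] exI[of _ c] exI[of _ d]) simp
      then show ?thesis by blast
    next
      case 2
      then have "of_kind Q8_C2 G" using p Z[OF d] d \<open>d \<otimes> d = \<one>\<close> unfolding of_kind.simps central_kind_def
        by (intro exI[of _ x] exI[of _ y] exI[of _ c] exI[of _ d]) simp
      then show ?thesis by blast
    next
      case 3
      then have "of_kind C22_C4 G" using p Z[OF yZ 3(2,3)] yy yG unfolding of_kind.simps central_kind_def
        by (intro exI[of _ x] exI[of _ y] exI[of _ c] exI[of _ "y \<otimes> y"]) simp
      then show ?thesis by blast
    next
      case 4
      then have "of_kind C4_C4 G" using p Z[OF yZ 4(2,3)] yy yG unfolding of_kind.simps central_kind_def
        by (intro exI[of _ x] exI[of _ y] exI[of _ c] exI[of _ "y \<otimes> y"]) simp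
      then show ?thesis by blast
    qed
  next
    case 2
    obtain x y where p: "central_presentation G x y c" "x \<otimes> x = \<one>"
      and sq: "y \<otimes> y = \<one> \<or> y \<otimes> y = d \<or> y \<otimes> y = c \<otimes> d"
      using central_kind_cyclic[OF Z[OF d] 2] by blast
    show ?thesis
    proof (cases "y \<otimes> y = \<one>")
      case True
      then have "of_kind D8_C4 G" using p Z[OF d] d 2 unfolding of_kind.simps central_kind_def
        by (intro exI[of _ x] exI[of _ y] exI[of _ c] exI[of _ d]) simp
      then show ?thesis by blast
    next
      case False
      have yZ: "y \<otimes> y \<in> center G" and yG: "y \<in> carrier G" using p by (auto simp: central_presentation_def)
      have "c \<otimes> d \<otimes> (c \<otimes> d) = c"
        using central_left[OF c_center, of d d] 2 by (simp add: m_assoc)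
      then have yy: "y \<otimes> y \<otimes> (y \<otimes> y) = c" using sq False 2 by auto
      have yc: "y \<otimes> y \<noteq> c" using yy c_ne_one c_square by metis
      have "of_kind M16 G" using p Z[OF yZ False yc] yy yc False yG unfolding of_kind.simps central_kind_def
        by (intro exI[of _ x] exI[of _ y] exI[of _ c] exI[of _ "y \<otimes> y"]) simp
      then show ?thesis by blast
    qed
  qed
qed

end

context finite_group
begin

lemma of_kind_dihedral:
  assumes ord: "order G = 16" and Z: "card (center G) = 2" shows "\<exists>k. of_kind k G"
proof -
  obtain a b where dl: "dihedral_like G a b"
    and rel: "b \<otimes> a = inv a \<otimes> b \<or> b \<otimes> a = a [^] (3::nat) \<otimes> b" "b \<otimes> b = \<one> \<or> b \<otimes> b = a [^] (4::nat)"
    using dihedral_like_exists[OF ord Z] by blast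
  have ab: "a \<in> carrier G" "b \<in> carrier G" and a4: "a [^] (4::nat) \<noteq> \<one>" and a8: "a [^] (8::nat) = \<one>"
    and b: "b \<notin> range (\<lambda>i::nat. a [^] i)" using dl unfolding dihedral_like_def by blast+
  have kind: "dihedral_kind e f G a y"
    if "y \<in> carrier G" "y \<notin> range (\<lambda>i::nat. a [^] i)" "y \<otimes> a = a [^] e \<otimes> y" "y \<otimes> y = a [^] f" for y and e f :: nat
    unfolding dihedral_kind_def using that ab a4 a8 ord by blast
  have inva: "inv a = a [^] (7::nat)"
  proof (rule inv_equality)
    have "a [^] (7::nat) \<otimes> a = a [^] (7 + 1 :: nat)" using ab by (simp only: nat_pow_mult[symmetric] nat_pow_eone)
    then show "a [^] (7::nat) \<otimes> a = \<one>" using a8 by simp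
  qed (use ab in simp_all)
  consider (1) "b \<otimes> a = a [^] (7::nat) \<otimes> b" "b \<otimes> b = a [^] (0::nat)" | (2) "b \<otimes> a = a [^] (7::nat) \<otimes> b" "b \<otimes> b = a [^] (4::nat)"
    | (3) "b \<otimes> a = a [^] (3::nat) \<otimes> b" "b \<otimes> b = a [^] (0::nat)" | (4) "b \<otimes> a = a [^] (3::nat) \<otimes> b" "b \<otimes> b = a [^] (4::nat)"
    using rel inva by auto
  then show ?thesis
  proof cases
    case 1 then have "of_kind D16 G" using kind[OF ab(2) b 1] by auto
    then show ?thesis by blast
  next
    case 2 then have "of_kind Q16 G" using kind[OF ab(2) b 2] by auto
    then show ?thesis by blast
  next
    case 3 then have "of_kind SD16 G" using kind[OF ab(2) b 3] by auto
    then show ?thesis by blast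
  next
    \<comment> \<open>Passing from \<open>b\<close> to \<open>ab\<close> removes the square:
      \<open>(a b)^2 = a^(1 + 3 + 4) = 1\<close>, so this is again the semidihedral group.\<close>
    case 4
    interpret D: dihedral_pres G a b 3 4 by unfold_locales (use kind[OF ab(2) b 4] in simp_all)
    have y: "D.P 1 \<otimes> b \<otimes> (D.P 1 \<otimes> b) = D.P 8" unfolding D.P_b_mult by simp
    have "D.P 1 \<otimes> b \<otimes> D.P 1 = D.P 3 \<otimes> (D.P 1 \<otimes> b)" unfolding D.P_b_P by (simp add: D.P_add')
    moreover have "D.P 8 = \<one>" using a8 by (simp add: D.P_def)
    moreover have "D.P 1 \<otimes> b \<notin> range (\<lambda>i::nat. a [^] i)" using D.P_b_notin_A[of 1] by (simp add: D.A_def D.P_def)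
    ultimately have "dihedral_kind 3 0 G a (D.P 1 \<otimes> b)"
      using y ab by (intro kind) (simp_all add: D.P_def)
    then have "of_kind SD16 G" by auto
    then show ?thesis by blast
  qed
qed

text \<open>The centre has even order and index at least four, so its order is 2 or 4. An index
  other than four is left only for order 16 with a centre of order two.\<close>

lemma of_kind_exists:
  assumes ord: "order G = 2 ^ n" "order G \<le> 16" and nc: "\<not> comm_group G"
  shows "\<exists>k. of_kind k G"
proof -
  obtain a b where ab: "a \<in> carrier G" "b \<in> carrier G" "a \<otimes> b \<noteq> b \<otimes> a"
    using nc group_comm_groupI by blast
  have le: "4 * card (center G) \<le> order G" by (rule four_center_le_order[OF ab])
  have pos: "card (center G) > 0" using one_center finite_center by (auto simp: card_gt_0_iff)
  then have "2 ^ n > (2::nat) ^ 1" using le ord by simp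
  then have "n > 1" by (simp only: power_strict_increasing_iff)
  then have "even (card (center G))" using even_card_center[OF ord(1)] by simp
  then have Z: "card (center G) = 2 \<or> card (center G) = 4" using pos le ord by presburger
  have "n \<le> 4"
  proof -
    have "(2::nat) ^ n \<le> 2 ^ 4" using ord by simp
    then show ?thesis by (simp only: power_increasing_iff)
  qed
  then have "n \<in> {2, 3, 4}" using \<open>n > 1\<close> by auto
  then have ord': "order G = 8 \<or> order G = 16" using ord(1) le Z by auto
  have cen: "\<exists>k. of_kind k G" if eq: "order G = 4 * card (center G)"
  proof -
    obtain c where "central_presentation G a b c" using central_presentation_exists[OF ab eq] by blast
    then interpret central_pres G a b c by unfold_locales
    show ?thesis using Z of_kind_two of_kind_four by blast
  qed
  show ?thesis
  proof (cases "order G = 4 * card (center G)")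
    case True
    then show ?thesis by (rule cen)
  next
    case False
    then have "order G = 16" "card (center G) = 2" using ord' Z le by auto
    then show ?thesis by (rule of_kind_dihedral)
  qed
qed

end

section \<open>Invariants of the unitary subgroup\<close>

definition exponent_four :: "('g, 'm) monoid_scheme \<Rightarrow> bool" where
  "exponent_four M \<longleftrightarrow> (\<forall>x\<in>carrier M. (x \<otimes>\<^bsub>M\<^esub> x) \<otimes>\<^bsub>M\<^esub> (x \<otimes>\<^bsub>M\<^esub> x) = \<one>\<^bsub>M\<^esub>)"

definition central_squares :: "('g, 'm) monoid_scheme \<Rightarrow> bool" where
  "central_squares M \<longleftrightarrow>
     (\<forall>x\<in>carrier M. \<forall>y\<in>carrier M. (x \<otimes>\<^bsub>M\<^esub> x) \<otimes>\<^bsub>M\<^esub> y = y \<otimes>\<^bsub>M\<^esub> (x \<otimes>\<^bsub>M\<^esub> x))"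

text \<open>The identity is included: these are the elements of order dividing two.\<close>

definition involutions :: "('g, 'm) monoid_scheme \<Rightarrow> 'g set" where
  "involutions M = {x \<in> carrier M. x \<otimes>\<^bsub>M\<^esub> x = \<one>\<^bsub>M\<^esub>}"

definition commuting_involutions :: "('g, 'm) monoid_scheme \<Rightarrow> bool" where
  "commuting_involutions M \<longleftrightarrow>
     (\<forall>x\<in>involutions M. \<forall>y\<in>involutions M. x \<otimes>\<^bsub>M\<^esub> y = y \<otimes>\<^bsub>M\<^esub> x)"

definition central_involutions :: "('g, 'm) monoid_scheme \<Rightarrow> bool" where
  "central_involutions M \<longleftrightarrow>
     (\<forall>x\<in>involutions M. \<forall>y\<in>carrier M. x \<otimes>\<^bsub>M\<^esub> y = y \<otimes>\<^bsub>M\<^esub> x)"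

definition elementary_center :: "('g, 'm) monoid_scheme \<Rightarrow> bool" where
  "elementary_center M \<longleftrightarrow> center M \<subseteq> involutions M"

definition involution_products_four :: "('g, 'm) monoid_scheme \<Rightarrow> bool" where
  "involution_products_four M \<longleftrightarrow> (\<forall>x\<in>involutions M. \<forall>y\<in>involutions M.
     (x \<otimes>\<^bsub>M\<^esub> y \<otimes>\<^bsub>M\<^esub> (x \<otimes>\<^bsub>M\<^esub> y)) \<otimes>\<^bsub>M\<^esub> (x \<otimes>\<^bsub>M\<^esub> y \<otimes>\<^bsub>M\<^esub> (x \<otimes>\<^bsub>M\<^esub> y)) = \<one>\<^bsub>M\<^esub>)"

text \<open>Phrased through subgroups containing the involutions, so that a proof works with an
  arbitrary such \<open>K\<close> and a single proper \<open>K\<close> refutes it.\<close>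

definition generated_by_involutions :: "('g, 'm) monoid_scheme \<Rightarrow> bool" where
  "generated_by_involutions M \<longleftrightarrow> (\<forall>K. subgroup K M \<and> involutions M \<subseteq> K \<longrightarrow> K = carrier M)"

locale group_iso_pair = M: group M + N: group N for M (structure) and N (structure) +
  fixes \<phi> assumes iso: "\<phi> \<in> iso M N"
begin

lemma hom_mult: "x \<in> carrier M \<Longrightarrow> y \<in> carrier M \<Longrightarrow> \<phi> (x \<otimes>\<^bsub>M\<^esub> y) = \<phi> x \<otimes>\<^bsub>N\<^esub> \<phi> y"
  using iso by (simp add: iso_def hom_def)

lemma bij: "bij_betw \<phi> (carrier M) (carrier N)"
  using iso by (simp add: iso_def)

lemma inj: "x \<in> carrier M \<Longrightarrow> y \<in> carrier M \<Longrightarrow> \<phi> x = \<phi> y \<longleftrightarrow> x = y"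
  using bij by (meson bij_betw_imp_inj_on inj_onD)

lemma hom_one: "\<phi> \<one>\<^bsub>M\<^esub> = \<one>\<^bsub>N\<^esub>"
  using iso group_hom.hom_one[of M N \<phi>] M.group_axioms N.group_axioms
  by (simp add: group_hom_def group_hom_axioms_def iso_def)

lemma carrier_image: "carrier N = \<phi> ` carrier M"
  using bij by (simp add: bij_betw_def)

lemma involutions_image: "involutions N = \<phi> ` involutions M"
  by (auto simp: involutions_def carrier_image hom_mult[symmetric] hom_one[symmetric] inj)

lemma involutions_closed: "x \<in> involutions M \<Longrightarrow> x \<in> carrier M"
  by (simp add: involutions_def)

lemmas transport = carrier_image involutions_image involutions_closed hom_mult[symmetric]
  hom_one[symmetric] inj

lemma exponent_four_iso: "exponent_four N \<longleftrightarrow> exponent_four M"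
  by (simp add: exponent_four_def transport)

lemma central_squares_iso: "central_squares N \<longleftrightarrow> central_squares M"
  by (simp add: central_squares_def transport)

lemma commuting_involutions_iso: "commuting_involutions N \<longleftrightarrow> commuting_involutions M"
  by (simp add: commuting_involutions_def transport)

lemma central_involutions_iso: "central_involutions N \<longleftrightarrow> central_involutions M"
  by (simp add: central_involutions_def transport)

lemma elementary_center_iso: "elementary_center N \<longleftrightarrow> elementary_center M"
proof -
  have "\<phi> x \<in> center N \<longleftrightarrow> x \<in> center M" if "x \<in> carrier M" for x
    using that by (simp add: center_def transport)
  then have "center N = \<phi> ` center M" by (auto simp: carrier_image center_def[of N] center_def[of M])
  then show ?thesis
    by (auto simp: elementary_center_def transport center_def[of M] image_subset_iff)
qed

lemma involution_products_four_iso: "involution_products_four N \<longleftrightarrow> involution_products_four M"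
  by (simp add: involution_products_four_def transport)

text \<open>A subgroup of \<open>N\<close> containing the involutions pulls back along
  \<open>\<phi>\<close> to such a subgroup of \<open>M\<close>.\<close>

lemma generated_by_involutions_iso_imp:
  assumes "generated_by_involutions M" shows "generated_by_involutions N"
  unfolding generated_by_involutions_def
proof (intro allI impI)
  fix K assume K: "subgroup K N \<and> involutions N \<subseteq> K"
  then interpret K: subgroup K N by simp
  let ?L = "{x \<in> carrier M. \<phi> x \<in> K}"
  have "subgroup ?L M"
  proof (rule M.subgroupI)
    have "\<one>\<^bsub>M\<^esub> \<in> ?L" by (simp add: hom_one)
    then show "?L \<noteq> {}" by blast
  next
    fix x assume x: "x \<in> ?L"
    have "\<phi> (inv\<^bsub>M\<^esub> x) = inv\<^bsub>N\<^esub> \<phi> x"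
      using x by (intro N.inv_equality[symmetric]) (auto simp: hom_mult[symmetric] hom_one carrier_image)
    then show "inv\<^bsub>M\<^esub> x \<in> ?L" using x by simp
  qed (auto simp: hom_mult)
  moreover have "involutions M \<subseteq> ?L" using K by (auto simp: involutions_image involutions_closed)
  ultimately have "?L = carrier M" using assms unfolding generated_by_involutions_def by blast
  then have "carrier N \<subseteq> K" by (auto simp: carrier_image)
  then show "K = carrier N" using K.subset by blast
qed

end

section \<open>Characteristic two, class functions, and witnesses taken from the group\<close>

locale unitary_algebra = finite_group G for G (structure) +
  fixes F :: "'f::{field,finite} itself"
  assumes char_2: "CHAR('f) = 2"
begin

lemma add_self [simp]: "(x :: 'a \<Rightarrow> 'f) + x = 0" and add_self' [simp]: "(x :: 'a \<Rightarrow> 'f) + (x + y) = y"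
proof -
  show *: "x + x = 0" for x :: "'a \<Rightarrow> 'f" using CHAR_2_add_self[OF char_2] by (simp add: fun_eq_iff)
  show "x + (x + y) = y" by (simp add: add.assoc[symmetric] *)
qed

lemma add_eq_0_iff_char_2: "(u :: 'f) + v = 0 \<longleftrightarrow> u = v"
  using char_2 by (metis add_eq_0_iff uminus_CHAR_2)

lemma sum_square: "(\<Sum>s\<in>S. u s :: 'f)\<^sup>2 = (\<Sum>s\<in>S. (u s)\<^sup>2)"
proof (induction S rule: infinite_finite_induct)
  case (insert s S)
  have "(2 :: 'f) = 0" using CHAR_2_add_self[OF char_2, of 1] by simp
  then show ?case using insert by (simp add: power2_sum)
qed auto

lemmas sum_involution = sum_CHAR_2_involution[OF char_2]

lemma sum_free_involution:
  assumes "finite S" "\<And>s. s \<in> S \<Longrightarrow> \<theta> s \<in> S" "\<And>s. s \<in> S \<Longrightarrow> \<theta> (\<theta> s) = s"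
    "\<And>s. s \<in> S \<Longrightarrow> f (\<theta> s) = (f s :: 'f)" "\<And>s. s \<in> S \<Longrightarrow> \<theta> s \<noteq> s"
  shows "sum f S = 0"
proof -
  have "{s \<in> S. \<theta> s = s} = {}" using assms(5) by blast
  moreover have "sum f S = sum f {s \<in> S. \<theta> s = s}" using assms by (intro sum_involution)
  ultimately show ?thesis by (simp only: sum.empty)
qed

text \<open>For a class function \<open>x (k h^-1) = x (h^-1 k)\<close>, which turns one convolution
  formula into the other.\<close>

lemma class_function_central:
  assumes "\<And>g h. g \<in> carrier G \<Longrightarrow> h \<in> carrier G \<Longrightarrow> x (g \<otimes> h) = x (h \<otimes> g)"
  shows "x \<star> y = y \<star> (x :: 'a \<Rightarrow> 'f)"
proof (rule supported_eqI)
  fix k assume k: "k \<in> carrier G"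
  have "x (k \<otimes> inv h) * y h = y h * x (inv h \<otimes> k)" if "h \<in> carrier G" for h
    using assms[of k "inv h"] k that by simp
  then show "(x \<star> y) k = (y \<star> x) k"
    by (simp only: conv_pairs'[OF k, of x] conv_apply[OF k, of y] cong: sum.cong)
qed simp_all

text \<open>The two sides of the commutation with \<open>single h\<close>, read off at
  \<open>h g h\<close>, are the two values.\<close>

lemma central_class_function:
  assumes "\<And>h. h \<in> carrier G \<Longrightarrow> x \<star> single h = single h \<star> x" "g \<in> carrier G" "h \<in> carrier G"
  shows "x (g \<otimes> h) = (x (h \<otimes> g) :: 'f)"
proof -
  have "inv h \<otimes> (h \<otimes> g \<otimes> h) = g \<otimes> h" "h \<otimes> g \<otimes> h \<otimes> inv h = h \<otimes> g"
    using assms(2,3) by (simp add: m_assoc[symmetric], simp add: m_assoc)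
  then show ?thesis
    using fun_cong[OF assms(1)[of h], of "h \<otimes> g \<otimes> h"] assms(2,3)
    by (simp add: single_conv conv_single)
qed

abbreviation V :: "('a \<Rightarrow> 'f) monoid" where "V \<equiv> unitary_subgroup TYPE('f) G"

abbreviation U :: "('a \<Rightarrow> 'f) set" where "U \<equiv> unitaries G"

lemmas V_simps = carrier_unitary mult_unitary one_unitary

lemma group_V: "group V" by (rule group_unitary)

lemma involutions_V: "involutions V = {x \<in> supported G. star G x = x \<and> x \<star> x = single \<one> \<and> augmentation G x = 1}"
  unfolding involutions_def V_simps
  by (auto simp: involution_star symmetric_unitary, auto simp: unitaries_def)

lemma single_eq_iff: "single g = (single h :: 'a \<Rightarrow> 'f) \<longleftrightarrow> g = h"
  by (auto simp: single_def fun_eq_iff)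

lemma single_involution: "g \<in> carrier G \<Longrightarrow> g \<otimes> g = \<one> \<Longrightarrow> single g \<in> involutions V"
  by (simp add: involutions_def V_simps single_unitary single_conv_single)

lemma not_exponent_four_V:
  assumes "g \<in> carrier G" "g \<otimes> g \<otimes> (g \<otimes> g) \<noteq> \<one>" shows "\<not> exponent_four V"
  unfolding exponent_four_def V_simps using assms
  by (intro notI) (drule bspec[OF _ single_unitary[OF assms(1)]], simp add: single_conv_single single_eq_iff)

lemma not_central_squares_V:
  assumes "g \<in> carrier G" "h \<in> carrier G" "g \<otimes> g \<otimes> h \<noteq> h \<otimes> (g \<otimes> g)" shows "\<not> central_squares V"
  unfolding central_squares_def V_simps using assms
  by (intro notI) (drule bspec[OF _ single_unitary[OF assms(1)]], drule bspec[OF _ single_unitary[OF assms(2)]],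
      simp add: single_conv_single single_eq_iff)

lemma not_commuting_involutions_V:
  assumes "g \<in> carrier G" "h \<in> carrier G" "g \<otimes> g = \<one>" "h \<otimes> h = \<one>" "g \<otimes> h \<noteq> h \<otimes> g"
  shows "\<not> commuting_involutions V"
  unfolding commuting_involutions_def using assms single_involution[OF assms(1,3)] single_involution[OF assms(2,4)]
  by (intro notI) (drule bspec, assumption, drule bspec, assumption,
      simp add: V_simps single_conv_single single_eq_iff)

lemma not_involution_products_four_V:
  assumes "g \<in> carrier G" "h \<in> carrier G" "g \<otimes> g = \<one>" "h \<otimes> h = \<one>"
    "g \<otimes> h \<otimes> (g \<otimes> h) \<otimes> (g \<otimes> h \<otimes> (g \<otimes> h)) \<noteq> \<one>"
  shows "\<not> involution_products_four V"
  unfolding involution_products_four_def using assms single_involution[OF assms(1,3)] single_involution[OF assms(2,4)]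
  by (intro notI) (drule bspec, assumption, drule bspec, assumption,
      simp add: V_simps single_conv_single single_eq_iff)

lemma not_elementary_center_V:
  assumes z: "z \<in> center G" "z \<otimes> z \<noteq> \<one>" shows "\<not> elementary_center V"
proof
  assume el: "elementary_center V"
  have zG: "z \<in> carrier G" using z by (simp only: center_closed)
  have "single z \<star> y = y \<star> single z" for y :: "'a \<Rightarrow> 'f"
    by (rule class_function_central) (simp add: single_def central_product_iff[OF _ _ z(1)])
  then have "single z \<in> center V"
    by (intro centerI) (simp_all only: V_simps single_unitary[OF zG])
  then have "single z \<in> involutions V" using el unfolding elementary_center_def by blast
  then show False using z(2) zG by (simp add: involutions_def V_simps single_conv_single single_eq_iff)
qed

text \<open>\<open>N\<close> plays the part of a subgroup of index two, given by its parity rule.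
  \<open>\<chi>\<close> is the total coefficient outside \<open>N\<close>, and its zeros in
  \<open>V\<close> form a subgroup. Involutions lie in it, because inversion has no fixed point
  outside \<open>N\<close> and their coefficients cancel in pairs there; \<open>single b\<close>
  does not.\<close>

lemma not_generated_by_involutions_V:
  assumes N: "\<And>g h. g \<in> carrier G \<Longrightarrow> h \<in> carrier G \<Longrightarrow> g \<otimes> h \<in> N \<longleftrightarrow> (g \<in> N \<longleftrightarrow> h \<in> N)"
    and inv: "\<And>g. g \<in> carrier G \<Longrightarrow> g \<otimes> g = \<one> \<Longrightarrow> g \<in> N" and b: "b \<in> carrier G" "b \<notin> N"
  shows "\<not> generated_by_involutions V"
proof
  assume gen: "generated_by_involutions V"
  interpret V: group V by (rule group_V)
  define \<chi> where "\<chi> x = (\<Sum>g | g \<in> carrier G \<and> g \<notin> N. x g)" for x :: "'a \<Rightarrow> 'f"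
  let ?K = "{x \<in> U. \<chi> x = 0}"
  have invN: "inv g \<in> N \<longleftrightarrow> g \<in> N" if "g \<in> carrier G" for g
    using N[of g "inv g"] inv[of \<one>] that by simp
  have \<chi>_star: "\<chi> (star G x) = \<chi> x" for x
    unfolding \<chi>_def
    by (intro sum.reindex_bij_witness[where i = "\<lambda>h. inv h" and j = "\<lambda>h. inv h"]) (auto simp: star_apply invN)
  have "inv\<^bsub>V\<^esub> x = star G x" if "x \<in> U" for x
    using that unitary_star[OF that] by (intro V.inv_equality) (simp_all add: V_simps, simp add: unitaries_def)
  \<comment> \<open>The part of a product outside \<open>N\<close> is outside times inside plus
    inside times outside, so it has total zero once both factors have.\<close>
  moreover have "\<chi> (x \<star> y) = 0" if "\<chi> x = 0" "\<chi> y = 0" for x y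
  proof -
    have "\<chi> (x \<star> y) = (\<Sum>k | k \<in> carrier G \<and> k \<notin> N. \<Sum>h\<in>carrier G. x h * y (inv h \<otimes> k))"
      by (simp add: \<chi>_def conv_apply)
    also have "\<dots> = (\<Sum>h\<in>carrier G. \<Sum>k | k \<in> carrier G \<and> k \<notin> N. x h * y (inv h \<otimes> k))" by (rule sum.swap)
    also have "\<dots> = (\<Sum>h\<in>carrier G. x h * (\<Sum>k | k \<in> carrier G \<and> (k \<notin> N \<longleftrightarrow> h \<in> N). y k))"
      unfolding sum_distrib_left
      by (rule sum.cong, simp,
          rule sum.reindex_bij_witness[where i = "\<lambda>k. h \<otimes> k" and j = "\<lambda>k. inv h \<otimes> k" for h])
        (auto simp: m_assoc[symmetric] N invN)
    also have "\<dots> = (\<Sum>h\<in>carrier G. if h \<in> N then 0 else x h * (\<Sum>k | k \<in> carrier G \<and> k \<in> N. y k))"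
      using that(2) by (intro sum.cong) (auto simp: \<chi>_def)
    also have "\<dots> = \<chi> x * (\<Sum>k | k \<in> carrier G \<and> k \<in> N. y k)"
      unfolding \<chi>_def sum_distrib_right by (rule sum.mono_neutral_cong_right) auto
    finally show ?thesis using that by simp
  qed
  moreover have "\<chi> (single \<one>) = 0" using inv[of \<one>] by (auto simp: \<chi>_def single_def intro!: sum.neutral)
  ultimately have "subgroup ?K V"
    by (intro V.subgroupI) (auto simp: V_simps \<chi>_star unitary_star unitary_conv intro: single_unitary)
  moreover have "involutions V \<subseteq> ?K"
  proof
    fix x assume x: "x \<in> involutions V"
    then have "x \<in> U" "x (inv g) = x g" if "g \<in> carrier G" for g
      using that star_apply[of g x] by (auto simp: involutions_V symmetric_unitary)
    moreover have "\<chi> x = 0"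
      unfolding \<chi>_def
    proof (rule sum_free_involution[where \<theta> = "\<lambda>g. inv g"])
      fix g assume g: "g \<in> {g \<in> carrier G. g \<notin> N}"
      show "inv g \<noteq> g" using g inv[of g] r_inv[of g] by (metis mem_Collect_eq)
    qed (use \<open>\<And>g. g \<in> carrier G \<Longrightarrow> x (inv g) = x g\<close> in \<open>auto simp: invN\<close>)
    ultimately show "x \<in> ?K" by blast
  qed
  ultimately have "?K = U" using gen unfolding generated_by_involutions_def V_simps by blast
  then have "\<chi> (single b) = 0" using single_unitary[OF b(1)] by blast
  then show False using b by (simp add: \<chi>_def single_def)
qed

end

section \<open>The ideal of a central involution\<close>

locale central_involution_algebra = unitary_algebra G F
  for G (structure) and F :: "'f::{field,finite} itself" +
  fixes c
  assumes c_center: "c \<in> center G" and c_ne_one: "c \<noteq> \<one>" and c_square: "c \<otimes> c = \<one>"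
begin

declare c_ne_one [simp]

lemma c_closed [simp]: "c \<in> carrier G"
  using c_center by (rule center_closed)

lemma c_commute: "g \<in> carrier G \<Longrightarrow> g \<otimes> c = c \<otimes> g"
  using center_commute[OF c_center] by simp

lemma c_left_commute: "g \<in> carrier G \<Longrightarrow> h \<in> carrier G \<Longrightarrow> g \<otimes> (c \<otimes> h) = c \<otimes> (g \<otimes> h)"
  by (simp add: m_assoc[symmetric] c_commute)

lemma c_c [simp]: "g \<in> carrier G \<Longrightarrow> c \<otimes> (c \<otimes> g) = g"
  by (simp add: m_assoc[symmetric] c_square)

lemma c_mult_ne [simp]: "g \<in> carrier G \<Longrightarrow> c \<otimes> g \<noteq> g" "g \<in> carrier G \<Longrightarrow> g \<noteq> c \<otimes> g"
  by simp_all

lemma c_mult_eq: "g \<in> carrier G \<Longrightarrow> h \<in> carrier G \<Longrightarrow> c \<otimes> g = h \<longleftrightarrow> g = c \<otimes> h"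
  by (metis c_c)

lemma c_mult_c_mult: "g \<in> carrier G \<Longrightarrow> h \<in> carrier G \<Longrightarrow> c \<otimes> g \<otimes> (c \<otimes> h) = g \<otimes> h"
  by (simp add: m_assoc c_left_commute[of g])

lemma inv_c [simp]: "inv c = c"
  using c_square by (simp add: inv_equality)

lemma inv_c_mult: "g \<in> carrier G \<Longrightarrow> inv (c \<otimes> g) = c \<otimes> inv g"
  by (simp add: inv_mult_group c_commute)

text \<open>The ideal \<open>(1 + c) FG\<close>, the kernel of the projection to the group algebra of \<open>G / \<langle>c\<rangle>\<close>.\<close>

definition I :: "('a \<Rightarrow> 'f) set" where
  "I = {x \<in> supported G. \<forall>g\<in>carrier G. x (c \<otimes> g) = x g}"

lemma I_D: "x \<in> I \<Longrightarrow> g \<in> carrier G \<Longrightarrow> x (c \<otimes> g) = x g" and I_supported: "x \<in> I \<Longrightarrow> x \<in> supported G"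
  by (simp_all add: I_def)

lemma I_add: "x \<in> I \<Longrightarrow> y \<in> I \<Longrightarrow> x + y \<in> I"
  by (simp add: I_def)

lemma I_conv_left: "x \<in> I \<Longrightarrow> x \<star> y \<in> I"
  by (simp add: I_def conv_pairs' m_assoc)

lemma I_conv_right: "y \<in> I \<Longrightarrow> x \<star> y \<in> I"
  by (simp add: I_def conv_apply c_left_commute)

text \<open>This is \<open>(1 + c)^2 = 0\<close>: the terms at \<open>h\<close> and
  \<open>c h\<close> are equal.\<close>

lemma I_conv_I:
  assumes "x \<in> I" "y \<in> I" shows "x \<star> y = 0"
proof
  fix k
  show "(x \<star> y) k = 0 k"
  proof (cases "k \<in> carrier G")
    case k: True
    have "(\<Sum>h\<in>carrier G. x h * y (inv h \<otimes> k)) = 0"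
      by (rule sum_free_involution[where \<theta> = "\<lambda>h. c \<otimes> h"])
        (use assms k in \<open>auto simp: I_D inv_c_mult m_assoc\<close>)
    then show ?thesis using k by (simp add: conv_apply)
  qed (simp add: conv_outside)
qed

lemma augmentation_I: "x \<in> I \<Longrightarrow> augmentation G x = 0"
  unfolding augmentation_def
  by (rule sum_free_involution[where \<theta> = "\<lambda>h. c \<otimes> h"]) (auto simp: I_D)

lemma finite_supported: "finite (supported G :: ('a \<Rightarrow> 'f) set)"
  and card_supported: "card (supported G :: ('a \<Rightarrow> 'f) set) = card (UNIV :: 'f set) ^ card (carrier G)"
proof -
  have bij: "bij_betw (\<lambda>f. restrict f (carrier G)) (supported G :: ('a \<Rightarrow> 'f) set) (carrier G \<rightarrow>\<^sub>E UNIV)"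
    by (rule bij_betw_byWitness[where f' = "\<lambda>f g. if g \<in> carrier G then f g else 0"])
      (auto simp: supported_def fun_eq_iff PiE_def extensional_def)
  have "finite (carrier G \<rightarrow>\<^sub>E (UNIV :: 'f set))" by (intro finite_PiE) auto
  then show "finite (supported G :: ('a \<Rightarrow> 'f) set)" by (simp add: bij_betw_finite[OF bij])
  show "card (supported G :: ('a \<Rightarrow> 'f) set) = card (UNIV :: 'f set) ^ card (carrier G)"
    by (simp add: bij_betw_same_card[OF bij] card_PiE)
qed

text \<open>Multiplication by \<open>1 + c\<close> maps \<open>FG\<close> to \<open>I\<close>, and its fibres are cosets of \<open>I\<close>.\<close>

lemma card_I: "card (UNIV :: 'f set) ^ card (carrier G) \<le> card I * card I"
proof -
  define p where "p x = (\<lambda>g. if g \<in> carrier G then x g + x (c \<otimes> g) else 0)" for x :: "'a \<Rightarrow> 'f"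
  have fin: "finite I" using finite_supported by (rule finite_subset[rotated]) (auto simp: I_def)
  have "p x \<in> I" for x by (auto simp: p_def I_def supported_def add.commute)
  then have sub: "p ` supported G \<subseteq> I" by blast
  have fib: "card {x \<in> supported G. p x = y} \<le> card I" if y: "y \<in> p ` supported G" for y
  proof -
    obtain x0 where x0: "x0 \<in> supported G" "p x0 = y" using y by blast
    have "x0 + x \<in> I" if "x \<in> supported G" "p x = y" for x
    proof -
      have "x0 (c \<otimes> g) + x (c \<otimes> g) = x0 g + x g" if "g \<in> carrier G" for g
      proof -
        have "x0 g + x0 (c \<otimes> g) = x g + x (c \<otimes> g)"
          using \<open>g \<in> carrier G\<close> fun_cong[OF trans[OF x0(2) \<open>p x = y\<close>[symmetric]], of g] by (simp add: p_def)
        then have "(x0 (c \<otimes> g) + x (c \<otimes> g)) + (x0 g + x g) = 0"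
          by (metis (no_types, lifting) CHAR_2_add_self[OF char_2] add.assoc add.commute)
        then show ?thesis by (simp add: add_eq_0_iff_char_2)
      qed
      then show ?thesis using that x0 by (simp add: I_def)
    qed
    then have "(\<lambda>x. x0 + x) ` {x \<in> supported G. p x = y} \<subseteq> I" by blast
    then show ?thesis using fin by (intro card_inj_on_le[of "\<lambda>x. x0 + x"]) (auto intro: inj_onI)
  qed
  have "card (supported G :: ('a \<Rightarrow> 'f) set) = (\<Sum>y\<in>p ` supported G. card {x \<in> supported G. p x = y})"
  proof -
    have "(supported G :: ('a \<Rightarrow> 'f) set) = (\<Union>y\<in>p ` supported G. {x \<in> supported G. p x = y})" by blast
    moreover have "card (\<Union>y\<in>p ` supported G. {x \<in> supported G. p x = y}) =
        (\<Sum>y\<in>p ` supported G. card {x \<in> supported G. p x = y})"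
      by (rule card_UN_disjoint) (use finite_supported in auto)
    ultimately show ?thesis by simp
  qed
  also have "\<dots> \<le> card (p ` supported G) * card I"
    using sum_bounded_above[of "p ` supported G" "\<lambda>y. card {x \<in> supported G. p x = y}" "card I"] fib by simp
  also have "\<dots> \<le> card I * card I" using card_mono[OF fin sub] by simp
  finally show ?thesis by (simp add: card_supported)
qed

lemma one_add_I_involution:
  assumes x: "x \<in> I" "star G x = x" shows "single \<one> + x \<in> involutions V"
proof -
  have "star G (single \<one> + x) = single \<one> + x" by (simp add: star_add star_single x)
  moreover have "(single \<one> + x) \<star> (single \<one> + x) = single \<one>"
    using x I_supported[OF x(1)] by (simp add: conv_add_left conv_add_right I_conv_I add.assoc)
  ultimately show ?thesis
    using x I_supported[OF x(1)] by (simp add: involutions_V augmentation_add augmentation_single augmentation_I)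
qed

text \<open>If all squares are \<open>1\<close> or \<open>c\<close>, then \<open>inv g\<close> is
  \<open>g\<close> or \<open>c g\<close>, so every element of \<open>I\<close> is fixed by
  \<open>star G\<close> and \<open>1 + I\<close> lies in \<open>V\<close>. Squaring turns the bound
  on \<open>card I\<close> into one without a halved exponent.\<close>

lemma card_V_lower:
  assumes "\<And>g. g \<in> carrier G \<Longrightarrow> g \<otimes> g = \<one> \<or> g \<otimes> g = c"
  shows "card (UNIV :: 'f set) ^ card (carrier G) \<le> card (carrier V) * card (carrier V)"
proof -
  have "star G x = x" if x: "x \<in> I" for x
  proof (rule supported_eqI)
    fix g assume g: "g \<in> carrier G"
    have "inv g = g \<or> inv g = c \<otimes> g"
      using assms[OF g] g by (metis c_closed c_commute c_square inv_equality m_assoc m_closed)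
    then show "star G x g = x g" using g x by (auto simp: star_apply I_D)
  qed (simp_all add: I_supported x)
  then have "(\<lambda>x. single \<one> + x) ` I \<subseteq> carrier V"
    using one_add_I_involution by (auto simp: involutions_def)
  moreover have "finite (carrier V)"
    using finite_supported by (rule finite_subset[rotated]) (auto simp: V_simps unitary_supported)
  ultimately have "card I \<le> card (carrier V)" by (intro card_inj_on_le[of "\<lambda>x. single \<one> + x"]) (auto intro: inj_onI)
  then have "card I * card I \<le> card (carrier V) * card (carrier V)" by (rule mult_le_mono) fact
  then show ?thesis using card_I by linarith
qed

text \<open>Discarding the zero element is enough; the comparison of orders needs only
  strictness.\<close>

lemma card_V_upper: "card (carrier V) < card (UNIV :: 'f set) ^ card (carrier G)"
proof -
  have "0 \<notin> (unitaries G :: ('a \<Rightarrow> 'f) set)" by (auto simp: unitaries_def augmentation_def)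
  moreover have "0 \<in> (supported G :: ('a \<Rightarrow> 'f) set)" by (simp add: supported_def)
  ultimately have "carrier V \<subset> supported G" unfolding V_simps using unitary_supported by blast
  then show ?thesis using psubset_card_mono[OF finite_supported] by (simp add: card_supported)
qed

end

section \<open>Commutator subgroup of order two\<close>

locale class_two_algebra = central_involution_algebra G F c
  for G (structure) and F :: "'f::{field,finite} itself" and c +
  assumes commutator: "g \<in> carrier G \<Longrightarrow> h \<in> carrier G \<Longrightarrow> h \<otimes> g = g \<otimes> h \<or> h \<otimes> g = c \<otimes> (g \<otimes> h)"
begin

lemma square_central: assumes "g \<in> carrier G" shows "g \<otimes> g \<in> center G"
proof (rule centerI)
  fix h assume h: "h \<in> carrier G"
  have eq: "h \<otimes> (g \<otimes> g) = h \<otimes> g \<otimes> g" using assms h by (simp add: m_assoc)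
  from commutator[OF assms h] show "g \<otimes> g \<otimes> h = h \<otimes> (g \<otimes> g)"
  proof
    assume "h \<otimes> g = g \<otimes> h"
    then show ?thesis using assms h by (simp add: eq) (simp add: m_assoc)
  next
    assume hg: "h \<otimes> g = c \<otimes> (g \<otimes> h)"
    have "h \<otimes> (g \<otimes> g) = c \<otimes> (g \<otimes> h) \<otimes> g" by (simp only: eq hg)
    also have "\<dots> = c \<otimes> (g \<otimes> (h \<otimes> g))" using assms h by (simp add: m_assoc)
    also have "\<dots> = g \<otimes> g \<otimes> h" unfolding hg using assms h by (simp add: m_assoc c_left_commute[of g])
    finally show ?thesis by simp
  qed
qed (use assms in simp)

lemma c_mult_center_iff: "k \<in> carrier G \<Longrightarrow> c \<otimes> k \<in> center G \<longleftrightarrow> k \<in> center G"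
proof -
  have *: "c \<otimes> k \<in> center G" if k: "k \<in> center G" for k
  proof (rule centerI)
    fix y assume "y \<in> carrier G"
    then show "c \<otimes> k \<otimes> y = y \<otimes> (c \<otimes> k)"
      using center_closed[OF k] center_commute[OF k, of y] by (simp add: m_assoc c_left_commute[of y])
  qed (simp add: center_closed[OF k])
  assume "k \<in> carrier G"
  then show ?thesis using *[of k] *[of "c \<otimes> k"] by auto
qed

text \<open>Over a field of characteristic two the mixed terms \<open>gh + hg\<close> of a square lie in \<open>(1 + c) FG\<close>.\<close>

lemma square_class_function:
  fixes x :: "'a \<Rightarrow> 'f"
  assumes g: "g \<in> carrier G" and h: "h \<in> carrier G"
  shows "(x \<star> x) (g \<otimes> h) = (x \<star> x) (h \<otimes> g)"
proof (cases "h \<otimes> g = g \<otimes> h")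
  case False
  define k where "k = g \<otimes> h"
  have k: "k \<in> carrier G" using g h by (simp add: k_def)
  have hg: "h \<otimes> g = c \<otimes> k" using commutator[OF g h] False by (simp add: k_def)
  have nc: "k \<notin> center G" using False central_product_commute[OF g h] by (auto simp: k_def)
  let ?P = "\<lambda>k. {(u, v) \<in> carrier G \<times> carrier G. u \<otimes> v = k}"
  have fin: "finite (?P k)" for k by (rule finite_subset[of _ "carrier G \<times> carrier G"]) auto
  have "(x \<star> x) k + (x \<star> x) (c \<otimes> k) = (\<Sum>(u, v)\<in>?P k \<union> ?P (c \<otimes> k). x u * x v)"
    using k fin by (subst sum.union_disjoint) (auto simp: conv_pairs)
  \<comment> \<open>Swapping the factors sends a factorisation of \<open>k\<close> to one of
    \<open>k\<close> or \<open>c k\<close>. It has no fixed point, because squares are central and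
    \<open>k\<close> is not.\<close>
  also have "\<dots> = 0"
  proof (rule sum_free_involution[where \<theta> = prod.swap])
    fix p assume p: "p \<in> ?P k \<union> ?P (c \<otimes> k)"
    obtain u v where uv: "p = (u, v)" by fastforce
    have c': "u \<in> carrier G" "v \<in> carrier G" "u \<otimes> v = k \<or> u \<otimes> v = c \<otimes> k" using p by (auto simp: uv)
    then have "v \<otimes> u = k \<or> v \<otimes> u = c \<otimes> k" using commutator[OF c'(1,2)] k by auto
    then show "prod.swap p \<in> ?P k \<union> ?P (c \<otimes> k)" using c' by (auto simp: uv)
    have "u \<noteq> v" using c' square_central[of u] nc c_mult_center_iff[OF k] by auto
    then show "prod.swap p \<noteq> p" by (simp add: uv)
  qed (use fin in \<open>auto simp: mult.commute\<close>)
  finally show ?thesis by (simp add: add_eq_0_iff_char_2 hg flip: k_def)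
qed simp

lemma central_squares_V: "central_squares V"
  unfolding central_squares_def V_simps
  by (intro ballI class_function_central square_class_function)

text \<open>A noncentral \<open>u\<close> is conjugate to \<open>c u\<close>, by any
  \<open>v\<close> that does not commute with it.\<close>

lemma class_function_c:
  assumes x: "\<And>g h. g \<in> carrier G \<Longrightarrow> h \<in> carrier G \<Longrightarrow> x (g \<otimes> h) = x (h \<otimes> g)"
    and u: "u \<in> carrier G" "u \<notin> center G"
  shows "x (c \<otimes> u) = x u"
proof -
  obtain v where v: "v \<in> carrier G" "u \<otimes> v \<noteq> v \<otimes> u" using u centerI by metis
  then have "v \<otimes> u = c \<otimes> (u \<otimes> v)" using commutator[OF u(1) v(1)] by auto
  then have "v \<otimes> u \<otimes> inv v = c \<otimes> u" using u v by (simp add: m_assoc)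
  moreover have "x (v \<otimes> u \<otimes> inv v) = x (inv v \<otimes> (v \<otimes> u))" using u v by (intro x) auto
  moreover have "inv v \<otimes> (v \<otimes> u) = u" using u v by (simp add: m_assoc[symmetric])
  ultimately show ?thesis by simp
qed

lemma sum_diagonal:
  fixes x :: "'a \<Rightarrow> 'f"
  shows "(\<Sum>p \<in> {p \<in> {(u, v) \<in> carrier G \<times> carrier G. u \<otimes> v = k}. fst p = snd p}. x (fst p) * x (snd p))
    = (\<Sum>u | u \<in> carrier G \<and> u \<otimes> u = k. (x u)\<^sup>2)"
proof -
  have "{p \<in> {(u, v) \<in> carrier G \<times> carrier G. u \<otimes> v = k}. fst p = snd p}
      = (\<lambda>u. (u, u)) ` {u \<in> carrier G. u \<otimes> u = k}" by auto
  then show ?thesis by (simp add: sum.reindex inj_on_def power2_eq_square)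
qed

text \<open>Two cancellations leave only the central square roots of \<open>k\<close>.
  Factorisations off the diagonal are paired by \<open>\<theta>\<close>; then a noncentral
  \<open>u\<close> is paired with \<open>c u\<close>, which has the same square and, by
  \<open>class_function_c\<close>, the same coefficient.\<close>

lemma class_function_square:
  assumes x: "\<And>g h. g \<in> carrier G \<Longrightarrow> h \<in> carrier G \<Longrightarrow> x (g \<otimes> h) = (x (h \<otimes> g) :: 'f)"
    and k: "k \<in> carrier G"
  shows "(x \<star> x) k = (\<Sum>u | u \<in> center G \<and> u \<otimes> u = k. (x u)\<^sup>2)"
proof -
  let ?P = "{(u, v) \<in> carrier G \<times> carrier G. u \<otimes> v = k}"
  \<comment> \<open>Commuting factors are swapped; for noncommuting ones a swap would change the
    product from \<open>k\<close> to \<open>c k\<close>, so both are multiplied by \<open>c\<close>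
    instead.\<close>
  define \<theta> where "\<theta> p = (if fst p \<otimes> snd p = snd p \<otimes> fst p then (snd p, fst p) else (c \<otimes> fst p, c \<otimes> snd p))" for p
  have fin: "finite ?P" by (rule finite_subset[of _ "carrier G \<times> carrier G"]) auto
  have "(x \<star> x) k = (\<Sum>p\<in>?P. x (fst p) * x (snd p))"
    by (simp add: conv_pairs[OF k] case_prod_unfold)
  also have "\<dots> = (\<Sum>p\<in>{p \<in> ?P. \<theta> p = p}. x (fst p) * x (snd p))"
  proof (rule sum_involution[OF fin])
    fix p assume p: "p \<in> ?P"
    obtain u v where uv: "p = (u, v)" by fastforce
    have c': "u \<in> carrier G" "v \<in> carrier G" "u \<otimes> v = k" using p by (auto simp: uv)
    have e: "c \<otimes> u \<otimes> (c \<otimes> v) = u \<otimes> v" "c \<otimes> v \<otimes> (c \<otimes> u) = v \<otimes> u"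
      using c' by (simp_all add: c_mult_c_mult)
    have nc: "u \<notin> center G" "v \<notin> center G" if "u \<otimes> v \<noteq> v \<otimes> u"
      using that c'(1,2) center_commute by metis+
    show "\<theta> p \<in> ?P" "\<theta> (\<theta> p) = p" using c' e by (auto simp: uv \<theta>_def)
    show "x (fst (\<theta> p)) * x (snd (\<theta> p)) = x (fst p) * x (snd p)"
      using nc c' by (simp add: uv \<theta>_def class_function_c[where x = x, OF x] mult.commute)
  qed
  also have "{p \<in> ?P. \<theta> p = p} = {p \<in> ?P. fst p = snd p}"
  proof -
    have "\<theta> p = p \<longleftrightarrow> fst p = snd p" if "p \<in> ?P" for p
      using that by (cases "fst p = snd p") (auto simp: \<theta>_def prod_eq_iff)
    then show ?thesis by blast
  qed
  also have "(\<Sum>p\<in>\<dots>. x (fst p) * x (snd p)) = (\<Sum>u | u \<in> carrier G \<and> u \<otimes> u = k. (x u)\<^sup>2)"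
    by (rule sum_diagonal)
  also have "\<dots> = (\<Sum>u \<in> {u \<in> carrier G. u \<otimes> u = k \<and> u \<in> center G} \<union> {u \<in> carrier G. u \<otimes> u = k \<and> u \<notin> center G}. (x u)\<^sup>2)"
    by (rule sum.cong) auto
  also have "\<dots> = (\<Sum>u \<in> {u \<in> carrier G. u \<otimes> u = k \<and> u \<in> center G}. (x u)\<^sup>2)
      + (\<Sum>u \<in> {u \<in> carrier G. u \<otimes> u = k \<and> u \<notin> center G}. (x u)\<^sup>2)"
    by (rule sum.union_disjoint) auto
  also have "(\<Sum>u \<in> {u \<in> carrier G. u \<otimes> u = k \<and> u \<notin> center G}. (x u)\<^sup>2) = 0"
    by (rule sum_free_involution[where \<theta> = "\<lambda>u. c \<otimes> u"])
      (auto simp: class_function_c[where x = x, OF x] c_mult_center_iff c_mult_c_mult)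
  also have "{u \<in> carrier G. u \<otimes> u = k \<and> u \<in> center G} = {u. u \<in> center G \<and> u \<otimes> u = k}"
    using center_closed[of _ G] by blast
  finally show ?thesis by simp
qed

text \<open>The factorisations of a central \<open>z\<close> are closed under swapping, so only the
  diagonal survives, whatever \<open>x\<close> is.\<close>

lemma square_at_center:
  fixes x :: "'a \<Rightarrow> 'f"
  assumes z: "z \<in> center G" shows "(x \<star> x) z = (\<Sum>u | u \<in> carrier G \<and> u \<otimes> u = z. (x u)\<^sup>2)"
proof -
  let ?P = "{(u, v) \<in> carrier G \<times> carrier G. u \<otimes> v = z}"
  have fin: "finite ?P" by (rule finite_subset[of _ "carrier G \<times> carrier G"]) auto
  have "(x \<star> x) z = (\<Sum>p\<in>?P. x (fst p) * x (snd p))"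
    by (simp add: conv_pairs[OF center_closed[OF z]] case_prod_unfold)
  also have "\<dots> = (\<Sum>p\<in>{p \<in> ?P. prod.swap p = p}. x (fst p) * x (snd p))"
  proof (rule sum_involution[OF fin])
    fix p assume "p \<in> ?P"
    then show "prod.swap p \<in> ?P" using central_product_iff[OF _ _ z] by auto
  qed (auto simp: mult.commute)
  also have "{p \<in> ?P. prod.swap p = p} = {p \<in> ?P. fst p = snd p}" by (auto simp: prod_eq_iff)
  also have "(\<Sum>p\<in>\<dots>. x (fst p) * x (snd p)) = (\<Sum>u | u \<in> carrier G \<and> u \<otimes> u = z. (x u)\<^sup>2)"
    by (rule sum_diagonal)
  finally show ?thesis .
qed

text \<open>\<open>x x\<close> is a class function, so its square collects at \<open>k\<close> the
  squares of \<open>(x x) u\<close> over central \<open>u\<close> with \<open>u u = k\<close>, that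
  is, \<open>x v ^ 4\<close> over all \<open>v\<close> with \<open>v^4 = k\<close>. As every
  \<open>v^4\<close> is one, everything sits at the identity and adds up to the fourth power of the
  augmentation.\<close>

lemma exponent_four_V:
  assumes exp: "\<And>g. g \<in> carrier G \<Longrightarrow> g \<otimes> g \<otimes> (g \<otimes> g) = \<one>"
  shows "exponent_four V"
  unfolding exponent_four_def V_simps
proof
  fix x :: "'a \<Rightarrow> 'f" assume x: "x \<in> U"
  show "x \<star> x \<star> (x \<star> x) = single \<one>"
  proof (rule supported_eqI)
    fix k assume k: "k \<in> carrier G"
    let ?Z = "{u. u \<in> center G \<and> u \<otimes> u = k}"
    have finZ: "finite ?Z" by (rule finite_subset[OF _ finite_carrier]) (auto dest: center_closed)
    have "(x \<star> x \<star> (x \<star> x)) k = (\<Sum>u\<in>?Z. ((x \<star> x) u)\<^sup>2)"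
      by (rule class_function_square[where x = "x \<star> x", OF square_class_function k])
    also have "\<dots> = (\<Sum>u\<in>?Z. \<Sum>v | v \<in> carrier G \<and> v \<otimes> v = u. (x v) ^ 4)"
      by (rule sum.cong) (auto simp: square_at_center sum_square simp flip: power_mult)
    also have "\<dots> = (\<Sum>v\<in>(\<Union>u\<in>?Z. {v \<in> carrier G. v \<otimes> v = u}). (x v) ^ 4)"
      by (rule sum.UNION_disjoint[symmetric]) (use finZ in auto)
    also have "(\<Union>u\<in>?Z. {v \<in> carrier G. v \<otimes> v = u}) = (if k = \<one> then carrier G else {})"
      using square_central exp by auto
    also have "(\<Sum>v\<in>(if k = \<one> then carrier G else {}). (x v) ^ 4) = single \<one> k"
    proof -
      have "(\<Sum>v\<in>carrier G. (x v) ^ 4) = ((\<Sum>v\<in>carrier G. x v)\<^sup>2)\<^sup>2"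
        by (simp add: sum_square flip: power_mult)
      also have "\<dots> = 1" using x by (simp add: unitaries_def augmentation_def)
      finally show ?thesis by (simp add: single_def)
    qed
    finally show "(x \<star> x \<star> (x \<star> x)) k = single \<one> k" .
  qed simp_all
qed

text \<open>A central \<open>x\<close> is a class function, so its square involves only coefficients
  on the centre, all landing at the identity. They sum to the full augmentation, because noncentral
  coefficients cancel in pairs \<open>u\<close>, \<open>c u\<close>.\<close>

lemma elementary_center_V:
  assumes el: "\<And>z. z \<in> center G \<Longrightarrow> z \<otimes> z = \<one>"
  shows "elementary_center V"
  unfolding elementary_center_def
proof
  fix x assume x: "x \<in> center V"
  then have xU: "x \<in> U" using center_closed[OF x] by (simp add: V_simps)
  have "x \<star> single h = single h \<star> x" if "h \<in> carrier G" for h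
    using center_commute[OF x, of "single h"] that by (simp only: V_simps single_unitary)
  then have cl: "x (g \<otimes> h) = x (h \<otimes> g)" if "g \<in> carrier G" "h \<in> carrier G" for g h
    by (rule central_class_function[OF _ that])
  have "x \<star> x = single \<one>"
  proof (rule supported_eqI)
    fix k assume k: "k \<in> carrier G"
    have "(x \<star> x) k = (\<Sum>u | u \<in> center G \<and> u \<otimes> u = k. (x u)\<^sup>2)"
      by (rule class_function_square[where x = x, OF cl k])
    also have "{u. u \<in> center G \<and> u \<otimes> u = k} = (if k = \<one> then center G else {})"
      using el by auto
    also have "(\<Sum>u\<in>(if k = \<one> then center G else {}). (x u)\<^sup>2) = single \<one> k"
    proof -
      have "carrier G = center G \<union> {u \<in> carrier G. u \<notin> center G}" using center_closed[of _ G] by blast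
      then have "augmentation G x = sum x (center G) + sum x {u \<in> carrier G. u \<notin> center G}"
        unfolding augmentation_def
        by (subst sum.union_disjoint[symmetric]) (auto intro: finite_subset[OF _ finite_carrier])
      also have "sum x {u \<in> carrier G. u \<notin> center G} = 0"
        by (rule sum_free_involution[where \<theta> = "\<lambda>u. c \<otimes> u"])
          (auto simp: class_function_c[where x = x, OF cl] c_mult_center_iff)
      finally have "sum x (center G) = 1" using xU by (simp add: unitaries_def)
      then show ?thesis by (simp add: single_def sum_square[symmetric])
    qed
    finally show "(x \<star> x) k = single \<one> k" .
  qed simp_all
  then show "x \<in> involutions V" using xU by (simp add: involutions_def V_simps)
qed

text \<open>Symmetry under inversion becomes invariance under \<open>c\<close> on noncentral
  elements, which makes \<open>x\<close> a class function. The hypothesis says that noncentral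
  elements square to \<open>c\<close>, as in the quaternion group.\<close>

lemma central_involutions_V:
  assumes inv: "\<And>g. g \<in> carrier G \<Longrightarrow> g \<notin> center G \<Longrightarrow> inv g = c \<otimes> g"
  shows "central_involutions V"
  unfolding central_involutions_def V_simps
proof (intro ballI class_function_central)
  fix x g h assume x: "x \<in> involutions V" and g: "g \<in> carrier G" and h: "h \<in> carrier G"
  have sym: "x (inv k) = x k" if "k \<in> carrier G" for k
    using x star_apply[OF that, of x] by (simp add: involutions_V)
  show "x (g \<otimes> h) = x (h \<otimes> g)"
  proof (cases "h \<otimes> g = g \<otimes> h")
    case False
    then have "g \<otimes> h \<notin> center G" using central_product_commute[OF g h] by blast
    then have "x (c \<otimes> (g \<otimes> h)) = x (g \<otimes> h)" using sym[of "g \<otimes> h"] inv[of "g \<otimes> h"] g h by simp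
    then show ?thesis using commutator[OF g h] False by auto
  qed simp
qed

end

section \<open>Commuting symmetric elements\<close>

context unitary_algebra
begin

text \<open>In characteristic two the square is \<open>1 + b^2 + b^-2\<close>, and
  \<open>b^2 = b^-2\<close> when \<open>b^4 = 1\<close>. It serves where the involutions of
  \<open>G\<close> are too few.\<close>

lemma one_add_b_add_inv_b:
  assumes b: "b \<in> carrier G" "b \<otimes> b \<otimes> (b \<otimes> b) = \<one>" and e: "e = single \<one> + (single b + single (inv b))"
  shows "e \<in> involutions V"
proof -
  have "inv b \<otimes> inv b = b \<otimes> b" using b by (simp add: inv_mult_group[symmetric] inv_equality)
  then have "e \<star> e = single \<one>"
    unfolding e using b
    by (simp add: conv_add_left conv_add_right single_conv_single add.assoc add.left_commute add.commute)
  moreover have "star G e = e"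
    using b by (simp add: e star_add star_single add.commute)
  moreover have "augmentation G e = 1"
    using CHAR_2_add_self[OF char_2, of 1] b by (simp add: e augmentation_add augmentation_single)
  moreover have "e \<in> supported G" using b by (simp add: e)
  ultimately show ?thesis by (simp add: involutions_V)
qed

text \<open>At \<open>a b\<close> the left side has the coefficient of \<open>e\<close> at
  \<open>b\<close>, which is one; the right side has that at the conjugate of \<open>b\<close>,
  which is zero.\<close>

lemma one_add_b_add_inv_b_noncommuting:
  assumes b: "b \<in> carrier G" "b \<noteq> \<one>" "b \<noteq> inv b" and a: "a \<in> carrier G"
    and conj: "a \<otimes> b \<otimes> inv a \<noteq> b" "a \<otimes> b \<otimes> inv a \<noteq> inv b"
    and e: "e = single \<one> + (single b + single (inv b))"
  shows "single a \<star> e \<noteq> (e \<star> single a :: 'a \<Rightarrow> 'f)"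
proof
  assume "single a \<star> e = (e \<star> single a :: 'a \<Rightarrow> 'f)"
  from fun_cong[OF this, of "a \<otimes> b"]
  have "e (inv a \<otimes> (a \<otimes> b)) = (e (a \<otimes> b \<otimes> inv a) :: 'f)"
    using a b by (simp add: single_conv conv_single)
  moreover have "inv a \<otimes> (a \<otimes> b) = b" using a b by (simp add: m_assoc[symmetric])
  moreover have "a \<otimes> b \<otimes> inv a \<noteq> \<one>"
    using a b by (metis inv_solve_right' l_cancel_one' m_closed one_closed r_inv l_one)
  ultimately show False using b conj by (simp add: e single_def)
qed

lemma not_central_involutions_V:
  assumes "e \<in> involutions V" "a \<in> carrier G" "single a \<star> e \<noteq> e \<star> single a"
  shows "\<not> central_involutions V"
  unfolding central_involutions_def V_simps using assms single_unitary[OF assms(2)] by metis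

end

context class_two_algebra
begin

text \<open>Pairs with \<open>g h = h g = k\<close> occur in both products and cancel, so only
  noncommuting pairs contribute.\<close>

lemma symmetric_product_pairs:
  fixes x y :: "'a \<Rightarrow> 'f"
  assumes k: "k \<in> carrier G"
  shows "(x \<star> y) k + (y \<star> x) k = (\<Sum>(g, h) \<in> {(g, h) \<in> carrier G \<times> carrier G.
    g \<otimes> h \<noteq> h \<otimes> g \<and> (g \<otimes> h = k \<or> h \<otimes> g = k)}. x g * y h)"
proof -
  define P where "P = {(g, h) \<in> carrier G \<times> carrier G. g \<otimes> h = k}"
  define Q where "Q = {(g, h) \<in> carrier G \<times> carrier G. h \<otimes> g = k}"
  define f where "f p = x (fst p) * y (snd p)" for p
  have fin: "finite P" "finite Q" unfolding P_def Q_def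
    by (rule finite_subset[of _ "carrier G \<times> carrier G"]; auto)+
  have "(y \<star> x) k = sum f Q"
    unfolding conv_pairs[OF k] Q_def f_def
    by (rule sum.reindex_bij_witness[where i = prod.swap and j = prod.swap]) (auto simp: mult.commute)
  moreover have "(x \<star> y) k = sum f P"
    by (simp add: conv_pairs[OF k] P_def f_def case_prod_unfold)
  moreover have "sum f P = sum f (P \<inter> Q) + sum f (P - Q)" "sum f Q = sum f (P \<inter> Q) + sum f (Q - P)"
    using fin by (metis sum.Int_Diff, metis sum.Int_Diff Int_commute)
  moreover have "sum f (P - Q) + sum f (Q - P) = sum f ((P - Q) \<union> (Q - P))"
    using fin by (intro sum.union_disjoint[symmetric]) auto
  moreover have "s + u + (s + v) = u + v" for s u v :: 'f
    using CHAR_2_add_self[OF char_2, of s] by (metis add.assoc add.commute add_0)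
  moreover have "(P - Q) \<union> (Q - P) = {(g, h) \<in> carrier G \<times> carrier G.
      g \<otimes> h \<noteq> h \<otimes> g \<and> (g \<otimes> h = k \<or> h \<otimes> g = k)}"
    unfolding P_def Q_def by auto
  ultimately show ?thesis by (simp add: f_def case_prod_unfold)
qed

text \<open>Coefficients do not change when a factor is inverted, and inverting suitable factors
  permutes the noncommuting pairs of \<open>symmetric_product_pairs\<close> without fixed points, so
  \<open>x y + y x\<close> vanishes.\<close>

lemma commuting_involutions_V:
  assumes d: "d \<in> center G" "d \<otimes> d = \<one>" "d \<noteq> \<one>"
    and inv: "\<And>g. g \<in> carrier G \<Longrightarrow> g \<notin> center G \<Longrightarrow> inv g = c \<otimes> g \<or> inv g = d \<otimes> g"
  shows "commuting_involutions V"
  unfolding commuting_involutions_def V_simps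
proof (intro ballI)
  fix x y assume xy: "x \<in> involutions V" "y \<in> involutions V"
  have sym: "x (inv g) = x g" "y (inv g) = y g" if "g \<in> carrier G" for g
    using xy star_apply[OF that, of x] star_apply[OF that, of y] by (simp_all add: involutions_V)
  have dG [simp]: "d \<in> carrier G" using d(1) by (rule center_closed)
  have d_left: "g \<otimes> (d \<otimes> h) = d \<otimes> (g \<otimes> h)" if "g \<in> carrier G" "h \<in> carrier G" for g h
    using that center_commute[OF d(1) that(1)] by (simp add: m_assoc[symmetric])
  have dd: "d \<otimes> g \<otimes> (d \<otimes> h) = g \<otimes> h" if "g \<in> carrier G" "h \<in> carrier G" for g h
  proof -
    have "d \<otimes> g \<otimes> (d \<otimes> h) = d \<otimes> (g \<otimes> (d \<otimes> h))" using that by (simp add: m_assoc)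
    also have "\<dots> = d \<otimes> d \<otimes> (g \<otimes> h)" using that by (simp add: d_left[of g h] m_assoc)
    finally show ?thesis using that by (simp add: d(2))
  qed
  show "x \<star> y = y \<star> x"
  proof (rule supported_eqI)
    fix k assume k: "k \<in> carrier G"
    let ?S = "{(g, h) \<in> carrier G \<times> carrier G. g \<otimes> h \<noteq> h \<otimes> g \<and> (g \<otimes> h = k \<or> h \<otimes> g = k)}"
    \<comment> \<open>Inverting one factor with \<open>inv g = c g\<close> exchanges
      \<open>g h\<close> and \<open>h g\<close>. If neither factor allows this, both are inverted,
      multiplying each by \<open>d\<close>, and \<open>d d = 1\<close> keeps the product.\<close>
    define \<theta> where "\<theta> p = (if inv (fst p) = c \<otimes> fst p then (inv (fst p), snd p)
      else if inv (snd p) = c \<otimes> snd p then (fst p, inv (snd p)) else (inv (fst p), inv (snd p)))" for p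
    have "(x \<star> y) k + (y \<star> x) k = (\<Sum>p\<in>?S. x (fst p) * y (snd p))"
      by (simp add: symmetric_product_pairs[OF k] case_prod_unfold)
    also have "\<dots> = 0"
    proof (rule sum_free_involution[where \<theta> = \<theta>])
      show "finite ?S" by (rule finite_subset[of _ "carrier G \<times> carrier G"]) auto
      fix p assume p: "p \<in> ?S"
      obtain g h where gh: "p = (g, h)" by fastforce
      have s: "g \<in> carrier G" "h \<in> carrier G" "g \<otimes> h \<noteq> h \<otimes> g" "g \<otimes> h = k \<or> h \<otimes> g = k"
        using p by (auto simp: gh)
      have nc: "g \<notin> center G" "h \<notin> center G" using s center_commute by metis+
      have hg: "h \<otimes> g = c \<otimes> (g \<otimes> h)" using commutator[OF s(1,2)] s(3) by auto
      have eq: "inv u = c \<otimes> u \<longleftrightarrow> inv (inv u) = c \<otimes> inv u" if "u \<in> carrier G" for u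
        using that by (metis inv_closed inv_inv c_mult_eq)
      show "\<theta> (\<theta> p) = p" using s eq by (auto simp: \<theta>_def gh)
      show "x (fst (\<theta> p)) * y (snd (\<theta> p)) = x (fst p) * y (snd p)"
        using s sym(1)[OF s(1)] sym(2)[OF s(2)] by (auto simp: \<theta>_def gh)
      consider (1) "inv g = c \<otimes> g" | (2) "inv g \<noteq> c \<otimes> g" "inv h = c \<otimes> h"
        | (3) "inv g \<noteq> c \<otimes> g" "inv h \<noteq> c \<otimes> h" "inv g = d \<otimes> g" "inv h = d \<otimes> h"
        using inv s nc by blast
      then have \<theta>p: "\<theta> p \<in> ?S \<and> \<theta> p \<noteq> p"
      proof cases
        case 1
        have "c \<otimes> g \<otimes> h = h \<otimes> g" "h \<otimes> (c \<otimes> g) = g \<otimes> h"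
          using s hg by (simp_all add: m_assoc c_left_commute[of h])
        then show ?thesis using 1 s by (auto simp: \<theta>_def gh)
      next
        case 2
        have "g \<otimes> (c \<otimes> h) = h \<otimes> g" "c \<otimes> h \<otimes> g = g \<otimes> h"
          using s hg by (simp_all add: m_assoc c_left_commute[of g])
        then show ?thesis using 2 s by (auto simp: \<theta>_def gh)
      next
        case 3
        then show ?thesis using s d(3) by (auto simp: \<theta>_def gh dd)
      qed
      show "\<theta> p \<in> ?S" using \<theta>p by (rule conjunct1)
      show "\<theta> p \<noteq> p" using \<theta>p by (rule conjunct2)
    qed
    finally show "(x \<star> y) k = (y \<star> x) k" by (simp add: add_eq_0_iff_char_2)
  qed simp_all
qed

end

section \<open>Abelian subgroups of index two\<close>

context central_involution_algebra
begin

text \<open>Inside \<open>A\<close> products commute; mixed products lie outside \<open>A\<close>,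
  where \<open>x\<close> vanishes; for two outer elements \<open>h g\<close> is the conjugate of
  \<open>g h\<close> by an outer element.\<close>

lemma class_function_index_two:
  fixes x :: "'a \<Rightarrow> 'f"
  assumes A: "subgroup A G" "\<And>g h. g \<in> carrier G - A \<Longrightarrow> h \<in> carrier G - A \<Longrightarrow> g \<otimes> h \<in> A"
    and comm: "\<And>g h. g \<in> A \<Longrightarrow> h \<in> A \<Longrightarrow> g \<otimes> h = h \<otimes> g"
    and outside: "\<And>k. k \<notin> A \<Longrightarrow> x k = 0"
    and conj: "\<And>k g. k \<in> A \<Longrightarrow> g \<in> carrier G - A \<Longrightarrow> x (inv g \<otimes> k \<otimes> g) = x k"
    and gh: "g \<in> carrier G" "h \<in> carrier G"
  shows "x (g \<otimes> h) = x (h \<otimes> g)"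
proof -
  interpret A: subgroup A G by fact
  have mem: "u \<otimes> v \<notin> A" "v \<otimes> u \<notin> A" if uv: "u \<in> A" "v \<in> carrier G - A" for u v
  proof -
    have u: "u \<in> carrier G" using uv by simp
    show "u \<otimes> v \<notin> A"
    proof
      assume "u \<otimes> v \<in> A"
      then have "inv u \<otimes> (u \<otimes> v) \<in> A" using uv by simp
      then show False using uv u by (simp add: m_assoc[symmetric])
    qed
    show "v \<otimes> u \<notin> A"
    proof
      assume "v \<otimes> u \<in> A"
      then have "v \<otimes> u \<otimes> inv u \<in> A" using uv by simp
      then show False using uv u by (simp add: m_assoc)
    qed
  qed
  have eq: "inv g \<otimes> (g \<otimes> h) \<otimes> g = h \<otimes> g" using gh by (simp add: m_assoc[symmetric])
  show ?thesis
  proof (cases "g \<in> A"; cases "h \<in> A")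
    assume "g \<in> A" "h \<in> A"
    then show ?thesis by (simp add: comm)
  next
    assume "g \<notin> A" "h \<notin> A"
    then show ?thesis using conj[of "g \<otimes> h" g] A(2)[of g h] gh by (simp add: eq)
  qed (use mem gh outside in \<open>simp_all\<close>)
qed

definition part :: "'a set \<Rightarrow> ('a \<Rightarrow> 'f) \<Rightarrow> 'a \<Rightarrow> 'f" where
  "part S x = (\<lambda>g. if g \<in> S then x g else 0)"

text \<open>An involution splits along \<open>A\<close>. Its symmetry makes the part on
  \<open>A\<close> a class function, since outer elements invert \<open>A\<close>, and puts the
  outer part into \<open>I\<close>, since \<open>inv g = c g\<close> there. Outer parts of two
  involutions multiply to zero.\<close>

lemma commuting_involutions_index_two:
  assumes A: "subgroup A G" "\<And>g h. g \<in> carrier G - A \<Longrightarrow> h \<in> carrier G - A \<Longrightarrow> g \<otimes> h \<in> A"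
    and comm: "\<And>g h. g \<in> A \<Longrightarrow> h \<in> A \<Longrightarrow> g \<otimes> h = h \<otimes> g"
    and conj: "\<And>k g. k \<in> A \<Longrightarrow> g \<in> carrier G - A \<Longrightarrow> inv g \<otimes> k \<otimes> g = inv k"
    and cA: "c \<in> A" and inv: "\<And>g. g \<in> carrier G - A \<Longrightarrow> inv g = c \<otimes> g"
  shows "commuting_involutions V"
  unfolding commuting_involutions_def V_simps
proof (intro ballI)
  interpret A: subgroup A G by fact
  let ?B = "carrier G - A"
  have cB: "c \<otimes> g \<in> A \<longleftrightarrow> g \<in> A" if "g \<in> carrier G" for g
    using that cA by (metis A.m_closed c_c)
  have parts: "x = part A x + part ?B x \<and> part A x \<star> y = y \<star> part A x \<and> part ?B x \<in> I"
    if x: "x \<in> involutions V" for x y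
  proof (intro conjI)
    have sym: "x (inv g) = x g" if "g \<in> carrier G" for g
      using x star_apply[OF that, of x] by (simp add: involutions_V)
    show "x = part A x + part ?B x"
      using x by (auto simp: part_def fun_eq_iff involutions_V supportedD)
    show "part A x \<star> y = y \<star> part A x"
      by (rule class_function_central, rule class_function_index_two[OF A comm])
        (auto simp: part_def conj sym)
    show "part ?B x \<in> I"
      using inv sym by (force simp: I_def part_def supported_def cB)
  qed
  fix x y assume x: "x \<in> involutions V" and y: "y \<in> involutions V"
  define a b m n where "a = part A x" and "b = part A y" and "m = part ?B x" and "n = part ?B y"
  have xy: "x = a + m" "y = b + n" using parts[OF x] parts[OF y] by (simp_all only: a_def b_def m_def n_def)
  have mn: "m \<in> I" "n \<in> I" using parts[OF x] parts[OF y] by (simp_all only: m_def n_def)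
  have "a \<star> b = b \<star> a" "a \<star> n = n \<star> a" "b \<star> m = m \<star> b"
    using parts[OF x] parts[OF y] unfolding a_def b_def by blast+
  then show "x \<star> y = y \<star> x"
    by (simp add: xy conv_add_left conv_add_right I_conv_I[OF mn] I_conv_I[OF mn(2,1)] add.left_commute add.commute)
qed

text \<open>The generator \<open>1 + c\<close> of \<open>I\<close>. It turns membership in
  \<open>I\<close> into a vanishing product, by \<open>I_iff\<close>.\<close>

definition E :: "'a \<Rightarrow> 'f" where "E = single \<one> + single c"

lemma E_apply: "x \<in> supported G \<Longrightarrow> k \<in> carrier G \<Longrightarrow> (E \<star> x) k = x (c \<otimes> k) + x k"
  by (simp add: E_def conv_add_left single_conv add.commute)

lemma E_central: "E \<star> x = x \<star> E"
proof -
  have "single z \<star> x = x \<star> single z" if "z \<in> center G" for z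
    by (rule class_function_central) (simp add: single_def central_product_iff[OF _ _ that])
  moreover have "\<one> \<in> center G" by (intro centerI) auto
  ultimately show ?thesis using c_center by (simp add: E_def conv_add_left conv_add_right)
qed

lemma I_iff: "x \<in> supported G \<Longrightarrow> x \<in> I \<longleftrightarrow> E \<star> x = 0"
proof -
  assume x: "x \<in> supported G"
  have "E \<star> x = 0 \<longleftrightarrow> (\<forall>k\<in>carrier G. (E \<star> x) k = 0)"
    using conv_outside[of _ E x] unfolding fun_eq_iff zero_fun_apply by blast
  then have "E \<star> x = 0 \<longleftrightarrow> (\<forall>k\<in>carrier G. x (c \<otimes> k) + x k = 0)"
    by (simp add: E_apply[OF x])
  then show ?thesis using x by (simp add: I_def add_eq_0_iff_char_2)
qed

text \<open>The aim is that \<open>w = x y + y x\<close> lies in \<open>I\<close>: then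
  \<open>(x y)^2 = 1 + x w y\<close> with \<open>x w y\<close> in \<open>I\<close>, and the fourth
  power is one because \<open>I\<close> has square zero. Each involution is split into parts on
  \<open>A\<close>, on the outer involutions \<open>?B\<close> and on the other outer elements
  \<open>?C\<close>. The last part lies in \<open>I\<close>, and the others commute modulo
  \<open>I\<close>.\<close>

lemma involution_products_four_index_two:
  assumes A: "subgroup A G" "\<And>g h. g \<in> carrier G - A \<Longrightarrow> h \<in> carrier G - A \<Longrightarrow> g \<otimes> h \<in> A"
    and comm: "\<And>g h. g \<in> A \<Longrightarrow> h \<in> A \<Longrightarrow> g \<otimes> h = h \<otimes> g"
    and conj: "\<And>k g. k \<in> A \<Longrightarrow> g \<in> carrier G - A \<Longrightarrow> inv g \<otimes> k \<otimes> g = inv k \<or> inv g \<otimes> k \<otimes> g = c \<otimes> inv k"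
    and cA: "c \<in> A"
    and inv: "\<And>g. g \<in> carrier G - A \<Longrightarrow> g \<otimes> g \<noteq> \<one> \<Longrightarrow> inv g = c \<otimes> g"
    and B: "\<And>g h. g \<in> carrier G - A \<Longrightarrow> h \<in> carrier G - A \<Longrightarrow> g \<otimes> g = \<one> \<Longrightarrow> h \<otimes> h = \<one> \<Longrightarrow>
      h \<otimes> g = g \<otimes> h \<or> h \<otimes> g = c \<otimes> (g \<otimes> h)"
  shows "involution_products_four V"
  unfolding involution_products_four_def V_simps
proof (intro ballI)
  interpret A: subgroup A G by fact
  let ?B = "{g \<in> carrier G - A. g \<otimes> g = \<one>}" and ?C = "{g \<in> carrier G - A. g \<otimes> g \<noteq> \<one>}"
  have cB: "c \<otimes> g \<in> A \<longleftrightarrow> g \<in> A" if "g \<in> carrier G" for g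
    using that cA by (metis A.m_closed c_c)
  have supp: "part S x \<in> supported G" if "x \<in> supported G" for S x
    using that by (simp add: supported_def part_def)
  have parts: "x = part A x + (part ?B x + part ?C x) \<and> part A x \<star> y + y \<star> part A x \<in> I \<and> part ?C x \<in> I"
    if x: "x \<in> involutions V" for x y
  proof (intro conjI)
    have sym: "x (inv g) = x g" if "g \<in> carrier G" for g
      using x star_apply[OF that, of x] by (simp add: involutions_V)
    have xs: "x \<in> supported G" using x by (simp add: involutions_V)
    show "x = part A x + (part ?B x + part ?C x)"
      using xs by (auto simp: part_def fun_eq_iff supportedD)
    have Ek: "(E \<star> part A x) k = (if k \<in> A then x (c \<otimes> k) + x k else 0)" for k
      using supp[OF xs, of A] cB by (cases "k \<in> carrier G") (auto simp: E_apply part_def conv_outside)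
    have sym_c: "x (c \<otimes> inv k) = x (c \<otimes> k)" if "k \<in> A" for k
      using sym[of "c \<otimes> k"] that by (simp add: inv_c_mult)
    \<comment> \<open>Multiplication by \<open>1 + c\<close> absorbs the possible factor
      \<open>c\<close> in the conjugation, so \<open>E \<star> part A x\<close> is a class function
      although \<open>part A x\<close> need not be.\<close>
    have cl: "(E \<star> part A x) (inv g \<otimes> k \<otimes> g) = (E \<star> part A x) k"
      if k: "k \<in> A" and g: "g \<in> carrier G - A" for k g
      using conj[OF k g]
    proof
      assume "inv g \<otimes> k \<otimes> g = inv k"
      then show ?thesis using k by (simp add: Ek sym sym_c)
    next
      assume "inv g \<otimes> k \<otimes> g = c \<otimes> inv k"
      then show ?thesis using k cB[of "inv k"] by (simp add: Ek sym sym_c add.commute)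
    qed
    have "E \<star> part A x \<star> y = y \<star> (E \<star> part A x)"
      by (rule class_function_central, rule class_function_index_two[OF A comm])
        (simp_all add: cl, simp add: Ek)
    then have "E \<star> (part A x \<star> y + y \<star> part A x) = 0"
      by (simp add: conv_add_right flip: conv_assoc) (simp add: E_central conv_assoc)
    then show "part A x \<star> y + y \<star> part A x \<in> I" by (subst I_iff) auto
    have "x (c \<otimes> g) = x g" if "g \<in> ?C" for g using inv[of g] sym[of g] that by auto
    then show "part ?C x \<in> I"
      using xs by (auto simp: I_def part_def supported_def cB c_mult_c_mult)
  qed
  \<comment> \<open>\<open>E\<close> sums over the factorisations of \<open>k\<close> and of
    \<open>c k\<close> together, and swapping two outer involutions stays among these.\<close>
  have BB: "part ?B x \<star> part ?B y + part ?B y \<star> part ?B x \<in> I" for x y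
  proof (subst I_iff)
    show "E \<star> (part ?B x \<star> part ?B y + part ?B y \<star> part ?B x) = 0"
    proof (rule supported_eqI)
      fix k assume k: "k \<in> carrier G"
      let ?P = "\<lambda>k. {(u, v) \<in> carrier G \<times> carrier G. u \<otimes> v = k}"
      have fin: "finite (?P k)" for k by (rule finite_subset[of _ "carrier G \<times> carrier G"]) auto
      have eq: "(E \<star> (w \<star> z)) k = (\<Sum>p\<in>?P k \<union> ?P (c \<otimes> k). w (fst p) * z (snd p))" for w z
      proof -
        have "(\<Sum>p\<in>?P k \<union> ?P (c \<otimes> k). w (fst p) * z (snd p)) = (w \<star> z) k + (w \<star> z) (c \<otimes> k)"
          using k fin by (subst sum.union_disjoint) (auto simp: conv_pairs case_prod_unfold)
        then show ?thesis using k by (simp add: E_apply add.commute)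
      qed
      have "(E \<star> (part ?B x \<star> part ?B y)) k
          = (\<Sum>p\<in>(?P k \<union> ?P (c \<otimes> k)) \<inter> ?B \<times> ?B. part ?B x (fst p) * part ?B y (snd p))"
        unfolding eq using fin by (intro sum.mono_neutral_right) (auto simp: part_def)
      also have "\<dots> = (\<Sum>p\<in>(?P k \<union> ?P (c \<otimes> k)) \<inter> ?B \<times> ?B. part ?B y (fst p) * part ?B x (snd p))"
      proof (rule sum.reindex_bij_witness[where i = prod.swap and j = prod.swap])
        have sw: "prod.swap p \<in> (?P k \<union> ?P (c \<otimes> k)) \<inter> ?B \<times> ?B"
          if p: "p \<in> (?P k \<union> ?P (c \<otimes> k)) \<inter> ?B \<times> ?B" for p
        proof -
          obtain u v where uv: "p = (u, v)" by fastforce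
          then have "u \<otimes> v = k \<or> u \<otimes> v = c \<otimes> k" "u \<in> ?B" "v \<in> ?B" using p by auto
          moreover from this have "v \<otimes> u = k \<or> v \<otimes> u = c \<otimes> k" using B[of u v] k by auto
          ultimately show ?thesis using uv by auto
        qed
        show "prod.swap p \<in> (?P k \<union> ?P (c \<otimes> k)) \<inter> ?B \<times> ?B"
          if "p \<in> (?P k \<union> ?P (c \<otimes> k)) \<inter> ?B \<times> ?B" for p using sw[OF that] .
        show "prod.swap p \<in> (?P k \<union> ?P (c \<otimes> k)) \<inter> ?B \<times> ?B"
          if "p \<in> (?P k \<union> ?P (c \<otimes> k)) \<inter> ?B \<times> ?B" for p using sw[OF that] .
      qed (auto simp: mult.commute)
      also have "\<dots> = (E \<star> (part ?B y \<star> part ?B x)) k"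
        unfolding eq using fin by (intro sum.mono_neutral_left) (auto simp: part_def)
      finally show "(E \<star> (part ?B x \<star> part ?B y + part ?B y \<star> part ?B x)) k = 0 k"
        unfolding conv_add_right plus_fun_apply zero_fun_apply add_eq_0_iff_char_2 .
    qed simp_all
  qed simp
  fix x y assume x: "x \<in> involutions V" and y: "y \<in> involutions V"
  define a b where "a = part A x" and "b = part A y"
  define m n where "m = part ?B x + part ?C x" and "n = part ?B y + part ?C y"
  have xy: "x = a + m" "y = b + n" using parts[OF x] parts[OF y] by (simp_all only: a_def b_def m_def n_def)
  have CI: "part ?C x \<in> I" "part ?C y \<in> I" using parts[OF x] parts[OF y] by blast+
  have ab: "a \<star> y + y \<star> a \<in> I" "b \<star> m + m \<star> b \<in> I"
    using parts[OF x] parts[OF y] unfolding a_def b_def by blast+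
  have "m \<star> n + n \<star> m = (part ?B x \<star> part ?B y + part ?B y \<star> part ?B x)
      + (part ?C x \<star> n + part ?B x \<star> part ?C y + part ?C y \<star> m + part ?B y \<star> part ?C x)"
    by (simp add: m_def n_def conv_add_left conv_add_right add.assoc add.left_commute add.commute)
  also have "\<dots> \<in> I"
    by (intro I_add BB I_conv_left[OF CI(1)] I_conv_right[OF CI(1)] I_conv_left[OF CI(2)] I_conv_right[OF CI(2)])
  finally have mn: "m \<star> n + n \<star> m \<in> I" .
  define w where "w = x \<star> y + y \<star> x"
  have "w = (a \<star> y + y \<star> a) + ((b \<star> m + m \<star> b) + (m \<star> n + n \<star> m))"
    by (simp add: w_def xy conv_add_left conv_add_right add.assoc add.left_commute add.commute)
  also have "\<dots> \<in> I" by (intro I_add ab mn)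
  finally have w: "w \<in> I" .
  have xx: "x \<star> x = single \<one>" "y \<star> y = single \<one>" "x \<in> supported G" "y \<in> supported G"
    using x y by (simp_all add: involutions_V)
  have yx: "y \<star> x = x \<star> y + w" by (simp add: w_def)
  have "x \<star> y \<star> (x \<star> y) = x \<star> (y \<star> x) \<star> y" by (simp add: conv_assoc)
  also have "\<dots> = x \<star> x \<star> (y \<star> y) + x \<star> w \<star> y" by (simp add: yx conv_add_left conv_add_right conv_assoc)
  also have "\<dots> = single \<one> + x \<star> w \<star> y" by (simp add: xx)
  finally have sq: "x \<star> y \<star> (x \<star> y) = single \<one> + x \<star> w \<star> y" .
  have "x \<star> w \<star> y \<in> I" using w by (simp add: I_conv_left I_conv_right)
  then have "(single \<one> + x \<star> w \<star> y) \<star> (single \<one> + x \<star> w \<star> y) = single \<one>"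
    using I_supported[of "x \<star> w \<star> y"]
    by (simp add: conv_add_left conv_add_right I_conv_I add.assoc)
  then show "x \<star> y \<star> (x \<star> y) \<star> (x \<star> y \<star> (x \<star> y)) = single \<one>" by (simp add: sq)
qed

end

section \<open>Generation by involutions\<close>

definition scale :: "'f::comm_ring_1 \<Rightarrow> ('g \<Rightarrow> 'f) \<Rightarrow> 'g \<Rightarrow> 'f" where
  "scale s x = (\<lambda>g. s * x g)"

context finite_group
begin

lemma scale_conv: "scale s x \<star> y = scale s (x \<star> y)" "x \<star> scale s y = scale s (x \<star> y)"
  by (simp_all add: scale_def conv_smult_left conv_smult_right)

lemma scale_add: "scale s (x + y) = scale s x + scale s y"
  by (simp add: scale_def fun_eq_iff algebra_simps)

lemma scale_scale: "scale s (scale t x) = scale (s * t) x"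
  by (simp add: scale_def fun_eq_iff algebra_simps)

lemma scale_one [simp]: "scale 1 x = x"
  by (simp add: scale_def)

lemma scale_add_left: "scale (s + t) x = scale s x + scale t x"
  by (simp add: scale_def fun_eq_iff algebra_simps)

lemma scale_supported [simp]: "x \<in> supported G \<Longrightarrow> scale s x \<in> supported G"
  by (simp add: scale_def supported_def)

lemma star_scale: "star G (scale s x) = scale s (star G x)"
  by (simp add: star_def scale_def fun_eq_iff)

lemma augmentation_scale: "augmentation G (scale s x) = s * augmentation G x"
  by (simp add: augmentation_def scale_def sum_distrib_left)

end

section \<open>Two noncommuting involutions over an elementary centre\<close>

locale involution_pair_algebra = class_two_algebra G F c
  for G (structure) and F :: "'f::{field,finite} itself" and c +
  fixes a b
  assumes a [simp]: "a \<in> carrier G" and b [simp]: "b \<in> carrier G"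
    and aa [simp]: "a \<otimes> a = \<one>" and bb [simp]: "b \<otimes> b = \<one>" and ab_ne: "a \<otimes> b \<noteq> b \<otimes> a"
    and el: "z \<in> center G \<Longrightarrow> z \<otimes> z = \<one>"
    and cosets: "g \<in> carrier G \<Longrightarrow> \<exists>z\<in>center G. g = z \<or> g = z \<otimes> a \<or> g = z \<otimes> b \<or> g = z \<otimes> (a \<otimes> b)"
begin

lemma inv_a [simp]: "inv a = a" and inv_b [simp]: "inv b = b"
  by (rule inv_equality; simp)+

lemma ba: "b \<otimes> a = c \<otimes> (a \<otimes> b)"
  using commutator[OF a b] ab_ne by auto

lemma noncentral: "a \<notin> center G" "b \<notin> center G" "a \<otimes> b \<notin> center G"
  using ab_ne center_commute[of a G b] center_commute[of b G a] central_product_commute[OF a b] by auto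

lemma products:
  "a \<otimes> (b \<otimes> a) = c \<otimes> b" "a \<otimes> b \<otimes> a = c \<otimes> b" "a \<otimes> b \<otimes> b = a" "b \<otimes> (b \<otimes> a) = a" "a \<otimes> (a \<otimes> b) = b"
  "b \<otimes> (a \<otimes> b) = c \<otimes> a" "a \<otimes> b \<otimes> (b \<otimes> a) = \<one>" "a \<otimes> b \<otimes> (a \<otimes> b) = c"
proof -
  have 1: "a \<otimes> (b \<otimes> a) = c \<otimes> (a \<otimes> (a \<otimes> b))" by (simp add: ba c_left_commute[of a])
  show 2: "a \<otimes> (a \<otimes> b) = b" by (simp add: m_assoc[symmetric])
  show 3: "a \<otimes> (b \<otimes> a) = c \<otimes> b" using 1 2 by simp
  show 4: "a \<otimes> b \<otimes> a = c \<otimes> b" using 3 by (simp add: m_assoc)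
  show 5: "a \<otimes> b \<otimes> b = a" by (simp add: m_assoc)
  show 6: "b \<otimes> (b \<otimes> a) = a" by (simp add: m_assoc[symmetric])
  show "b \<otimes> (a \<otimes> b) = c \<otimes> a"
    by (simp add: m_assoc[symmetric] ba) (simp add: m_assoc)
  show "a \<otimes> b \<otimes> (b \<otimes> a) = \<one>" using 6 by (simp add: m_assoc)
  have "a \<otimes> b \<otimes> (a \<otimes> b) = a \<otimes> b \<otimes> a \<otimes> b" by (simp add: m_assoc)
  also have "\<dots> = c" unfolding 4 by (simp add: m_assoc)
  finally show "a \<otimes> b \<otimes> (a \<otimes> b) = c" .
qed

lemma inv_ab: "inv (a \<otimes> b) = b \<otimes> a"
  by (simp add: inv_mult_group)

text \<open>The group algebra of the centre, over which \<open>FG\<close> is free on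
  \<open>1\<close>, \<open>a\<close>, \<open>b\<close>, \<open>ab\<close>.\<close>

definition Z :: "('a \<Rightarrow> 'f) set" where "Z = {y. \<forall>g. g \<notin> center G \<longrightarrow> y g = 0}"

lemma Z_supported: "y \<in> Z \<Longrightarrow> y \<in> supported G"
  unfolding Z_def supported_def using center_closed[of _ G] by blast

lemma Z_central: assumes "y \<in> Z" shows "y \<star> w = w \<star> y"
proof (rule class_function_central)
  fix g h assume gh: "g \<in> carrier G" "h \<in> carrier G"
  show "y (g \<otimes> h) = y (h \<otimes> g)"
  proof (cases "g \<otimes> h \<in> center G \<or> h \<otimes> g \<in> center G")
    case True
    then show ?thesis using central_product_commute gh by metis
  next
    case False
    then show ?thesis using assms by (simp add: Z_def)
  qed
qed

lemma Z_add: "y \<in> Z \<Longrightarrow> y' \<in> Z \<Longrightarrow> y + y' \<in> Z"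
  by (simp add: Z_def)

lemma Z_conv: assumes "y \<in> Z" "y' \<in> Z" shows "y \<star> y' \<in> Z"
  unfolding Z_def
proof (intro CollectI allI impI)
  fix k assume nc: "k \<notin> center G"
  show "(y \<star> y') k = 0"
  proof (cases "k \<in> carrier G")
    case k: True
    have "y h * y' (inv h \<otimes> k) = 0" if "h \<in> carrier G" for h
      using assms nc center_mult_iff[of "inv h" k] center_inv[of h] k by (auto simp: Z_def)
    then have "(\<Sum>h\<in>carrier G. y h * y' (inv h \<otimes> k)) = 0" by (intro sum.neutral) blast
    then show ?thesis using k by (simp add: conv_apply)
  qed (simp add: conv_outside)
qed

lemma Z_star: assumes "y \<in> Z" shows "star G y = y"
proof (rule supported_eqI)
  fix k assume k: "k \<in> carrier G"
  show "star G y k = y k"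
  proof (cases "k \<in> center G")
    case True
    then have "inv k = k" using el k by (simp add: inv_equality)
    then show ?thesis using k by (simp add: star_apply)
  next
    case False
    then have "inv k \<notin> center G" using center_inv[of "inv k"] k by auto
    then show ?thesis using False assms k by (simp add: star_apply Z_def)
  qed
qed (simp_all add: Z_supported assms)

text \<open>Squaring is additive in characteristic two and every central element squares to one, so
  the squared coefficients add up at the identity. Hence elements of \<open>Z\<close> with nonzero
  augmentation are invertible.\<close>

lemma Z_square: assumes y: "y \<in> Z" shows "y \<star> y = scale ((augmentation G y)\<^sup>2) (single \<one>)"
proof (rule supported_eqI)
  fix k assume k: "k \<in> carrier G"
  have cl: "y (g \<otimes> h) = y (h \<otimes> g)" if "g \<in> carrier G" "h \<in> carrier G" for g h
    by (rule central_class_function[OF _ that]) (rule Z_central[OF y])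
  have "augmentation G y = sum y (center G)"
    unfolding augmentation_def
    by (rule sum.mono_neutral_right) (use y center_closed[of _ G] in \<open>auto simp: Z_def\<close>)
  moreover have "{u. u \<in> center G \<and> u \<otimes> u = k} = (if k = \<one> then center G else {})" using el by auto
  ultimately show "(y \<star> y) k = scale ((augmentation G y)\<^sup>2) (single \<one>) k"
    using class_function_square[where x = y, OF cl k] by (simp add: scale_def single_def sum_square)
qed simp_all

lemma Z_square_conv: "y \<in> Z \<Longrightarrow> w \<in> supported G \<Longrightarrow> y \<star> (y \<star> w) = scale ((augmentation G y)\<^sup>2) w"
  by (simp add: conv_assoc[symmetric] Z_square scale_conv)

lemma Z_term:
  assumes "y \<in> Z" "y' \<in> Z" "g \<in> carrier G" "h \<in> carrier G"
  shows "y \<star> single g \<star> (y' \<star> single h) = y \<star> y' \<star> single (g \<otimes> h)"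
proof -
  have "y \<star> single g \<star> (y' \<star> single h) = y \<star> (single g \<star> y') \<star> single h" by (simp only: conv_assoc)
  also have "single g \<star> y' = y' \<star> single g" using Z_central[OF assms(2)] by simp
  finally show ?thesis using assms by (simp add: conv_assoc single_conv_single)
qed

lemma star_Z_term: "y \<in> Z \<Longrightarrow> h \<in> carrier G \<Longrightarrow> star G (y \<star> single h) = y \<star> single (inv h)"
  using Z_central[of y "single (inv h)"] by (simp add: star_conv star_single Z_star)

text \<open>\<open>y\<close> and \<open>y' h\<close> commute, and by \<open>Z_square\<close> the
  square of their sum is the scalar \<open>s^2\<close>.\<close>

lemma normalized_involution:
  assumes y: "y \<in> Z" "y' \<in> Z" and h: "h \<in> carrier G" "h \<otimes> h = \<one>"
    and s: "s = augmentation G y + augmentation G y'" "s \<noteq> 0"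
  shows "scale (1 / s) (y + y' \<star> single h) \<in> involutions V"
proof -
  let ?w = "y + y' \<star> single h"
  have "inv h = h" using h by (simp add: inv_equality)
  then have "star G ?w = ?w" using y h by (simp add: star_add star_Z_term Z_star)
  moreover have "?w \<star> ?w = scale (s\<^sup>2) (single \<one>)"
  proof -
    have "y' \<star> single h \<star> (y' \<star> single h) = y' \<star> y'"
      using Z_term[OF y(2,2) h(1,1)] h(2) Z_conv[OF y(2,2)] Z_supported by simp
    moreover have "y' \<star> single h \<star> y = y \<star> (y' \<star> single h)" using Z_central[OF y(1)] by simp
    moreover have "s\<^sup>2 = (augmentation G y)\<^sup>2 + (augmentation G y')\<^sup>2"
      using CHAR_2_add_self[OF char_2, of "augmentation G y * augmentation G y'"]
      by (simp add: s(1) power2_eq_square algebra_simps)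
    ultimately show ?thesis
      by (simp add: conv_add_left conv_add_right Z_square y scale_add_left add.assoc)
  qed
  ultimately show ?thesis
    using s h y Z_supported[OF y(1)]
    by (simp add: involutions_V star_scale scale_conv scale_scale augmentation_scale augmentation_add
        augmentation_conv augmentation_single power2_eq_square)
qed

definition coef :: "'a \<Rightarrow> ('a \<Rightarrow> 'f) \<Rightarrow> 'a \<Rightarrow> 'f" where
  "coef h x = (\<lambda>z. if z \<in> center G then x (z \<otimes> h) else 0)"

lemma coef_Z: "coef h x \<in> Z"
  by (simp add: coef_def Z_def)

lemma coset_iff:
  assumes z: "z \<in> center G" and h: "h \<in> {\<one>, a, b, a \<otimes> b}" "h' \<in> {\<one>, a, b, a \<otimes> b}"
  shows "z \<otimes> h \<otimes> inv h' \<in> center G \<longleftrightarrow> h = h'"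
proof -
  have hG: "h \<in> carrier G" "h' \<in> carrier G" using h by auto
  have "z \<otimes> h \<otimes> inv h' \<in> center G \<longleftrightarrow> h \<otimes> inv h' \<in> center G"
    using center_mult_iff[OF z, of "h \<otimes> inv h'"] hG center_closed[OF z] by (simp add: m_assoc)
  moreover have "h \<otimes> inv h' \<in> center G \<longleftrightarrow> h = h'"
  proof
    assume *: "h \<otimes> inv h' \<in> center G"
    show "h = h'"
    proof (rule ccontr)
      assume ne: "h \<noteq> h'"
      have "c \<otimes> b \<notin> center G" "b \<otimes> a \<notin> center G" using c_mult_center_iff noncentral by (simp_all add: ba)
      then show False using h ne * noncentral by (auto simp: inv_ab products)
    qed
  qed (use hG one_center in simp)
  ultimately show ?thesis by simp
qed

lemma decompose:
  assumes x: "x \<in> supported G"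
  shows "x = coef \<one> x + coef a x \<star> single a + coef b x \<star> single b + coef (a \<otimes> b) x \<star> single (a \<otimes> b)"
proof (rule supported_eqI)
  fix k assume k: "k \<in> carrier G"
  obtain z h where zh: "z \<in> center G" "h \<in> {\<one>, a, b, a \<otimes> b}" "k = z \<otimes> h"
    using cosets[OF k] center_closed[of _ G] by fastforce
  have zG: "z \<in> carrier G" using zh(1) by (rule center_closed)
  have ev: "(coef h' x \<star> single h') k = (if h = h' then x k else 0)"
    if h': "h' \<in> {\<one>, a, b, a \<otimes> b}" for h'
  proof -
    have h'G: "h' \<in> carrier G" using h' by auto
    have "(coef h' x \<star> single h') k = coef h' x (k \<otimes> inv h')" using k h'G by (simp add: conv_single)
    also have "\<dots> = (if h = h' then x (k \<otimes> inv h' \<otimes> h') else 0)"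
      using coset_iff[OF zh(1,2) h'] by (simp add: coef_def zh(3))
    finally show ?thesis using k h'G by (simp add: m_assoc)
  qed
  have e1: "coef \<one> x k = (if h = \<one> then x k else 0)"
    using ev[of \<one>] Z_supported[OF coef_Z] by simp
  have d: "a \<noteq> \<one>" "b \<noteq> \<one>" "a \<otimes> b \<noteq> \<one>" "a \<noteq> b" "a \<noteq> a \<otimes> b" "b \<noteq> a \<otimes> b"
    using noncentral one_center ab_ne coset_iff[OF one_center, of b "a \<otimes> b"] by (auto simp: inv_ab products)
  show "x k = (coef \<one> x + coef a x \<star> single a + coef b x \<star> single b + coef (a \<otimes> b) x \<star> single (a \<otimes> b)) k"
    using zh(2) d by (auto simp: e1 ev)
qed (simp_all add: x Z_supported[OF coef_Z])

text \<open>Among the products occurring in \<open>x (star G x)\<close>, only those with group part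
  \<open>ab\<close> or \<open>ba = c ab\<close> reach the coset of \<open>ab\<close>.\<close>

lemma eval:
  assumes y: "y \<in> Z" and z: "z \<in> center G"
  shows "(y \<star> single \<one>) (z \<otimes> (a \<otimes> b)) = 0" "(y \<star> single a) (z \<otimes> (a \<otimes> b)) = 0"
    "(y \<star> single b) (z \<otimes> (a \<otimes> b)) = 0" "(y \<star> single (c \<otimes> b)) (z \<otimes> (a \<otimes> b)) = 0"
    "(y \<star> single (a \<otimes> b)) (z \<otimes> (a \<otimes> b)) = y z" "(y \<star> single (b \<otimes> a)) (z \<otimes> (a \<otimes> b)) = y (c \<otimes> z)"
proof -
  have zG: "z \<in> carrier G" using z by (rule center_closed)
  have ev: "(y \<star> single h) (z \<otimes> (a \<otimes> b)) = y (z \<otimes> (a \<otimes> b) \<otimes> inv h)" if "h \<in> carrier G" for h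
    using that zG by (simp add: conv_single)
  have 0: "(y \<star> single h) (z \<otimes> (a \<otimes> b)) = 0" if "h \<in> {\<one>, a, b}" for h
  proof -
    have "a \<otimes> b \<noteq> h" using that coset_iff[OF one_center, of "a \<otimes> b" b] coset_iff[OF one_center, of "a \<otimes> b" a]
      noncentral one_center ab_ne by (auto simp: products inv_ab)
    then have "z \<otimes> (a \<otimes> b) \<otimes> inv h \<notin> center G" using coset_iff[OF z, of "a \<otimes> b" h] that by auto
    moreover have "h \<in> carrier G" using that by auto
    ultimately show ?thesis using y by (simp add: ev Z_def)
  qed
  then show "(y \<star> single \<one>) (z \<otimes> (a \<otimes> b)) = 0" "(y \<star> single a) (z \<otimes> (a \<otimes> b)) = 0"
    and "(y \<star> single b) (z \<otimes> (a \<otimes> b)) = 0" by simp_all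
  show "(y \<star> single (a \<otimes> b)) (z \<otimes> (a \<otimes> b)) = y z" using zG by (simp add: ev m_assoc)
  have e: "z \<otimes> (a \<otimes> b) \<otimes> inv (c \<otimes> h) = c \<otimes> (z \<otimes> (a \<otimes> b) \<otimes> inv h)" if "h \<in> carrier G" for h
    using that zG by (simp add: inv_c_mult c_left_commute[of "z \<otimes> (a \<otimes> b)"])
  have "y (c \<otimes> g) = 0" if "g \<in> carrier G" "g \<notin> center G" for g
    using y that c_mult_center_iff[of g] by (simp add: Z_def)
  moreover have "z \<otimes> (a \<otimes> b) \<otimes> b \<notin> center G"
    using center_mult_iff[OF z, of a] noncentral zG by (simp add: m_assoc products)
  ultimately show "(y \<star> single (c \<otimes> b)) (z \<otimes> (a \<otimes> b)) = 0" using zG by (simp add: ev e)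
  show "(y \<star> single (b \<otimes> a)) (z \<otimes> (a \<otimes> b)) = y (c \<otimes> z)"
    unfolding ba using zG by (simp add: ev e) (simp add: m_assoc)
qed

text \<open>For \<open>x = \<alpha> + \<beta>a + \<gamma>b + \<delta>ab\<close> with coefficients in the group algebra of the centre,
  unitarity of \<open>x\<close> includes the equation \<open>\<alpha>\<delta> = \<beta>\<gamma>\<close> modulo \<open>(1 + c) FG\<close>.\<close>

lemma unitary_coefs:
  assumes x: "x \<in> U"
  shows "coef \<one> x \<star> coef (a \<otimes> b) x + coef a x \<star> coef b x \<in> I"
proof -
  define \<alpha> \<beta> \<gamma> \<delta> where "\<alpha> = coef \<one> x" and "\<beta> = coef a x" and "\<gamma> = coef b x" and "\<delta> = coef (a \<otimes> b) x"
  have Z: "\<alpha> \<in> Z" "\<beta> \<in> Z" "\<gamma> \<in> Z" "\<delta> \<in> Z" by (simp_all add: \<alpha>_def \<beta>_def \<gamma>_def \<delta>_def coef_Z)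
  have eq: "x = \<alpha> \<star> single \<one> + \<beta> \<star> single a + \<gamma> \<star> single b + \<delta> \<star> single (a \<otimes> b)"
    using decompose[OF unitary_supported[OF x]] Z_supported[OF Z(1)]
    by (simp add: \<alpha>_def \<beta>_def \<gamma>_def \<delta>_def)
  have eqs: "star G x = \<alpha> \<star> single \<one> + \<beta> \<star> single a + \<gamma> \<star> single b + \<delta> \<star> single (b \<otimes> a)"
    unfolding eq star_add using Z by (simp only: star_Z_term one_closed a b m_closed inv_ab inv_one inv_a inv_b)
  let ?\<omega> = "\<alpha> \<star> \<delta> + \<beta> \<star> \<gamma>"
  have "?\<omega> (c \<otimes> z) = ?\<omega> z" if z: "z \<in> center G" for z
  proof -
    have zab: "z \<otimes> (a \<otimes> b) \<noteq> \<one>" using center_mult_iff[OF z, of "a \<otimes> b"] noncentral one_center by auto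
    \<comment> \<open>The coefficients of \<open>x (star G x) = 1\<close> on the coset of
      \<open>ab\<close> vanish; \<open>b a = c (a b)\<close> shifts two of the four contributing
      terms by \<open>c\<close>.\<close>
    have "(x \<star> star G x) (z \<otimes> (a \<otimes> b)) = 0" using x zab by (simp add: unitaries_def single_def)
    moreover have "(x \<star> star G x) (z \<otimes> (a \<otimes> b)) =
        (\<alpha> \<star> \<delta>) (c \<otimes> z) + (\<beta> \<star> \<gamma>) z + (\<gamma> \<star> \<beta>) (c \<otimes> z) + (\<delta> \<star> \<alpha>) z"
      unfolding eqs by (subst eq)
        (simp only: conv_add_left conv_add_right Z_term Z one_closed a b m_closed l_one r_one aa bb products
          plus_fun_apply eval[OF Z_conv z] add_0_left add_0_right add.assoc add.left_commute add.commute)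
    ultimately have "?\<omega> (c \<otimes> z) + ?\<omega> z = 0"
      using Z_central[OF Z(3), of \<beta>] Z_central[OF Z(4), of \<alpha>] by (simp add: algebra_simps)
    then show ?thesis by (simp only: add_eq_0_iff_char_2)
  qed
  moreover have "?\<omega> \<in> Z" using Z by (intro Z_add Z_conv)
  ultimately have "?\<omega> (c \<otimes> g) = ?\<omega> g" if "g \<in> carrier G" for g
    using that c_mult_center_iff[of g] by (cases "g \<in> center G") (auto simp: Z_def)
  then show ?thesis using Z_supported[OF \<open>?\<omega> \<in> Z\<close>] by (simp add: I_def \<alpha>_def \<beta>_def \<gamma>_def \<delta>_def)
qed

lemma scale_I: "x \<in> I \<Longrightarrow> scale s x \<in> I"
  by (simp add: I_def scale_def supported_def)

text \<open>With capitals for augmentations, \<open>x\<close> is compared with the product of the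
  involutions \<open>\<alpha> / A\<close>, \<open>(\<alpha> + \<beta> a) / (A + B)\<close> and
  \<open>(\<alpha> + \<gamma> b) / (A + C)\<close>. That product has \<open>\<beta> \<gamma>\<close>
  at \<open>ab\<close> where \<open>\<alpha> \<delta>\<close> is wanted, and these agree modulo
  \<open>I\<close> by \<open>unitary_coefs\<close>. The remaining factor lies in
  \<open>1 + I\<close> and is itself an involution.\<close>

lemma generated_if_unit:
  assumes K: "subgroup K V" "involutions V \<subseteq> K" and x: "x \<in> U" and A: "augmentation G (coef \<one> x) \<noteq> 0"
  shows "x \<in> K"
proof -
  define \<alpha> \<beta> \<gamma> \<delta> where "\<alpha> = coef \<one> x" and "\<beta> = coef a x" and "\<gamma> = coef b x" and "\<delta> = coef (a \<otimes> b) x"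
  define A B C D where "A = augmentation G \<alpha>" and "B = augmentation G \<beta>" and "C = augmentation G \<gamma>"
    and "D = augmentation G \<delta>"
  have Z: "\<alpha> \<in> Z" "\<beta> \<in> Z" "\<gamma> \<in> Z" "\<delta> \<in> Z" by (simp_all add: \<alpha>_def \<beta>_def \<gamma>_def \<delta>_def coef_Z)
  have eq: "x = \<alpha> + \<beta> \<star> single a + \<gamma> \<star> single b + \<delta> \<star> single (a \<otimes> b)"
    using decompose[OF unitary_supported[OF x]] by (simp add: \<alpha>_def \<beta>_def \<gamma>_def \<delta>_def)
  define \<omega> where "\<omega> = \<alpha> \<star> \<delta> + \<beta> \<star> \<gamma>"
  have \<omega>: "\<omega> \<in> I" using unitary_coefs[OF x] by (simp add: \<omega>_def \<alpha>_def \<beta>_def \<gamma>_def \<delta>_def)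
  have "augmentation G x = 1" using x by (simp add: unitaries_def)
  then have sum1: "A + B + C + D = 1"
    unfolding eq by (simp add: augmentation_add augmentation_conv augmentation_single A_def B_def C_def D_def)
  have ADBC: "A * D = B * C"
    using augmentation_I[OF \<omega>] by (simp add: \<omega>_def augmentation_add augmentation_conv A_def B_def C_def D_def add_eq_0_iff_char_2)
  \<comment> \<open>This identity makes both denominators nonzero, and later gives the normalisation
    \<open>A (A + B) (A + C) = A^2\<close>.\<close>
  have "(A + B) * (A + C) = A * (A + B + C) + B * C" by (simp add: algebra_simps)
  also have "\<dots> = A * (A + B + C + D)" by (simp add: ADBC[symmetric] algebra_simps)
  finally have ABAC: "(A + B) * (A + C) = A" by (simp add: sum1)
  have A0: "A \<noteq> 0" using A by (simp add: A_def \<alpha>_def)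
  then have nz: "A + B \<noteq> 0" "A + C \<noteq> 0" using ABAC by auto
  define l p q where "l = scale (1 / A) \<alpha>" and "p = scale (1 / (A + B)) (\<alpha> + \<beta> \<star> single a)"
    and "q = scale (1 / (A + C)) (\<alpha> + \<gamma> \<star> single b)"
  have "0 \<in> Z" by (simp add: Z_def)
  then have lpq: "l \<in> involutions V" "p \<in> involutions V" "q \<in> involutions V"
    using normalized_involution[OF Z(1) \<open>0 \<in> Z\<close> one_closed, of A] normalized_involution[OF Z(1,2) a aa, of "A + B"]
      normalized_involution[OF Z(1,3) b bb, of "A + C"] A0 nz
    by (simp_all add: l_def p_def q_def A_def B_def C_def augmentation_def)
  define y where "y = l \<star> p \<star> q"
  have "\<alpha> \<star> (\<alpha> + \<beta> \<star> single a) \<star> (\<alpha> + \<gamma> \<star> single b) = scale (A\<^sup>2) x + \<alpha> \<star> \<omega> \<star> single (a \<otimes> b)"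
  proof -
    have "\<alpha> \<star> (\<beta> \<star> single a \<star> (\<gamma> \<star> single b)) = \<alpha> \<star> (\<beta> \<star> \<gamma>) \<star> single (a \<otimes> b)"
      unfolding Z_term[OF Z(2,3) a b] by (simp only: conv_assoc)
    also have "\<beta> \<star> \<gamma> = \<omega> + \<alpha> \<star> \<delta>" by (simp add: \<omega>_def add.commute add.left_commute)
    also have "\<alpha> \<star> (\<omega> + \<alpha> \<star> \<delta>) \<star> single (a \<otimes> b) = \<alpha> \<star> \<omega> \<star> single (a \<otimes> b) + scale (A\<^sup>2) (\<delta> \<star> single (a \<otimes> b))"
      using Z Z_supported[OF Z(4)] by (simp add: conv_add_left conv_add_right Z_square_conv A_def scale_conv)
    finally have t: "\<alpha> \<star> (\<beta> \<star> single a \<star> (\<gamma> \<star> single b)) =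
        \<alpha> \<star> \<omega> \<star> single (a \<otimes> b) + scale (A\<^sup>2) (\<delta> \<star> single (a \<otimes> b))" .
    have "\<beta> \<star> single a \<star> \<alpha> = \<alpha> \<star> (\<beta> \<star> single a)" using Z_central[OF Z(1)] by simp
    then have "\<alpha> \<star> (\<beta> \<star> single a \<star> \<alpha>) = scale (A\<^sup>2) (\<beta> \<star> single a)"
      using Z by (simp add: Z_square_conv A_def)
    moreover have "\<alpha> \<star> (\<alpha> \<star> \<alpha>) = scale (A\<^sup>2) \<alpha>" "\<alpha> \<star> (\<alpha> \<star> (\<gamma> \<star> single b)) = scale (A\<^sup>2) (\<gamma> \<star> single b)"
      using Z Z_supported by (simp_all add: Z_square_conv A_def)
    ultimately show ?thesis
      unfolding conv_assoc[of \<alpha> "\<alpha> + \<beta> \<star> single a"]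
      by (simp only: eq conv_add_left conv_add_right scale_add t add.assoc add.left_commute add.commute)
  qed
  moreover have "y = scale (1 / A\<^sup>2) (\<alpha> \<star> (\<alpha> + \<beta> \<star> single a) \<star> (\<alpha> + \<gamma> \<star> single b))"
  proof -
    have "(A + C) * ((A + B) * A) = (A + B) * (A + C) * A" by (simp only: mult.assoc mult.commute mult.left_commute)
    then have "(A + C) * ((A + B) * A) = A\<^sup>2" by (simp only: ABAC power2_eq_square)
    then show ?thesis by (simp add: y_def l_def p_def q_def scale_conv scale_scale mult.assoc)
  qed
  ultimately have y: "y = x + scale (1 / A\<^sup>2) (\<alpha> \<star> \<omega> \<star> single (a \<otimes> b))"
    using A0 by (simp add: scale_add scale_scale)
  define i where "i = scale (1 / A\<^sup>2) (\<alpha> \<star> \<omega> \<star> single (a \<otimes> b))"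
  have i: "i \<in> I" unfolding i_def by (intro scale_I I_conv_left I_conv_right \<omega>)
  have xy: "x = y + i" by (simp add: y i_def add.assoc)
  have inK: "involutions V \<subseteq> U" by (auto simp: involutions_def V_simps)
  have yU: "y \<in> U" unfolding y_def using lpq inK by (intro unitary_conv) auto
  interpret K: subgroup K V by fact
  have yK: "y \<in> K" unfolding y_def using lpq K(2) K.m_closed by (simp add: V_simps subset_iff)
  let ?j = "star G y \<star> i"
  have j: "?j \<in> I" using i by (rule I_conv_right)
  have "star G y \<star> x = single \<one> + ?j" using yU by (simp add: xy conv_add_right unitaries_def)
  moreover have "(single \<one> + ?j) \<star> (single \<one> + ?j) = single \<one>"
    using j I_supported[OF j] by (simp add: conv_add_left conv_add_right I_conv_I add.assoc)
  moreover have "star G y \<star> x \<in> U" using x yU by (intro unitary_conv unitary_star)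
  ultimately have "star G y \<star> x \<in> K" using K(2) by (auto simp: involutions_def V_simps)
  then have "y \<star> (star G y \<star> x) \<in> K" using yK K.m_closed by (simp add: V_simps)
  moreover have "y \<star> (star G y \<star> x) = x"
    using yU unitary_supported[OF x] by (simp add: conv_assoc[symmetric] unitaries_def)
  ultimately show ?thesis by simp
qed

text \<open>The augmentations of the four coefficients sum to one, so some coefficient has a nonzero
  one. Multiplying by the inverse of its coset representative \<open>h\<close>, a product of
  involutions, moves it to the identity coset.\<close>

lemma generated_by_involutions_V: "generated_by_involutions V"
  unfolding generated_by_involutions_def
proof (intro allI impI)
  fix K assume K: "subgroup K V \<and> involutions V \<subseteq> K"
  interpret K: subgroup K V using K by simp
  have gen: "x \<in> K" if x: "x \<in> U" for x
  proof -
    have "coef \<one> x \<star> single \<one> = coef \<one> x" using Z_supported[OF coef_Z] by simp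
    then have "augmentation G x = augmentation G (coef \<one> x) + augmentation G (coef a x)
        + augmentation G (coef b x) + augmentation G (coef (a \<otimes> b) x)"
      by (subst decompose[OF unitary_supported[OF x]])
        (simp add: augmentation_add augmentation_conv augmentation_single)
    then have "\<exists>h\<in>{\<one>, a, b, a \<otimes> b}. augmentation G (coef h x) \<noteq> 0"
      using x by (auto simp: unitaries_def)
    then obtain h where h: "h \<in> {\<one>, a, b, a \<otimes> b}" "augmentation G (coef h x) \<noteq> 0" by blast
    have hG: "h \<in> carrier G" using h by auto
    have sa: "single a \<in> K" "single b \<in> K" "single \<one> \<in> K"
      using K single_involution[OF a aa] single_involution[OF b bb] single_involution[of \<one>] by auto
    then have "single a \<star> single b \<in> K" using K.m_closed by (simp add: V_simps)
    then have hK: "single h \<in> K" using h sa by (auto simp: single_conv_single)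
    let ?x = "x \<star> single (inv h)"
    have xU: "?x \<in> U" using x hG by (intro unitary_conv single_unitary) auto
    have "coef \<one> ?x = coef h x"
      using hG center_closed[of _ G] by (auto simp: coef_def conv_single)
    then have "?x \<in> K" using generated_if_unit[of K ?x] K xU h(2) by simp
    then have "?x \<star> single h \<in> K" using hK K.m_closed by (simp add: V_simps)
    moreover have "?x \<star> single h = x"
      using hG unitary_supported[OF x] by (simp add: conv_assoc single_conv_single)
    ultimately show ?thesis by simp
  qed
  have "K \<subseteq> U" using K.subset by (simp add: V_simps)
  then show "K = carrier V" using gen by (auto simp: V_simps)
qed

end

section \<open>The invariants of the eleven groups\<close>

lemma central_involutions_imp_commuting: "central_involutions M \<Longrightarrow> commuting_involutions M"
  unfolding central_involutions_def commuting_involutions_def involutions_def by blast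

section \<open>Properties of the groups with central quotient of order four\<close>

locale central_kind_algebra = central_kind_pres G a b c d m e s t
  for G (structure) and a b c d m e s t +
  fixes F :: "'f::{field,finite} itself"
  assumes char_2: "CHAR('f) = 2"
begin

sublocale U: class_two_algebra G F c
  by unfold_locales (use char_2 c_center c_ne_one commutator in auto)

lemma center_square: "z \<in> center G \<Longrightarrow> z \<otimes> z = \<one> \<or> e \<and> z \<otimes> z = c"
proof -
  assume "z \<in> center G"
  then obtain x where "z = ce x" using ce_surj by blast
  moreover have "cmul e x x = (e \<and> snd x, False)" by (auto simp: cmul_def)
  ultimately have "z \<otimes> z = pw c (e \<and> snd x)" by (simp add: ce_mult) (simp add: ce_def pw_def)
  then show ?thesis by (simp add: pw_def split: if_splits)
qed

lemma square_nf_cases: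
  assumes z: "z \<in> center G" and s: "\<not> snd s" "\<not> snd t"
  shows "nf z i j \<otimes> nf z i j \<in> {\<one>, c}"
proof -
  have zG: "z \<in> carrier G" using z by (rule center_closed)
  have "nf z i j \<otimes> nf z i j = z \<otimes> z \<otimes> (pw c (j \<and> i) \<otimes> (pw (a \<otimes> a) i \<otimes> pw (b \<otimes> b) j))"
    unfolding nf_square[OF z] using zG by (simp add: m_assoc)
  moreover have "z \<otimes> z \<in> {\<one>, c}" using center_square[OF z] by auto
  moreover have "pw (a \<otimes> a) i \<in> {\<one>, c}" "pw (b \<otimes> b) j \<in> {\<one>, c}" "pw c (j \<and> i) \<in> {\<one>, c}"
    using s by (auto simp: aa bb pw_def)
  moreover have "x \<otimes> y \<in> {\<one>, c}" if "x \<in> {\<one>, c}" "y \<in> {\<one>, c}" for x y using that by auto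
  ultimately show ?thesis by metis
qed

text \<open>Squares are central. Without \<open>e\<close> the centre is elementary; with
  \<open>e\<close>, and with \<open>a a\<close> and \<open>b b\<close> in \<open>{1, c}\<close>, all
  squares lie in \<open>{1, c}\<close>.\<close>

lemma exponent_four:
  assumes "\<not> e \<or> \<not> snd s \<and> \<not> snd t" shows "exponent_four U.V"
proof (rule U.exponent_four_V)
  fix g assume g: "g \<in> carrier G"
  show "g \<otimes> g \<otimes> (g \<otimes> g) = \<one>"
  proof (cases e)
    case True
    obtain z i j where "z \<in> center G" "g = nf z i j" using nf_surj[OF g] by blast
    then have "g \<otimes> g = \<one> \<or> g \<otimes> g = c" using square_nf_cases assms True by blast
    then show ?thesis by (elim disjE) simp_all
  next
    case False
    then show ?thesis using center_square[OF U.square_central[OF g]] by blast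
  qed
qed

lemma not_exponent_four:
  assumes "e" "t = (False, True)" shows "\<not> exponent_four U.V"
proof (rule U.not_exponent_four_V[OF b])
  show "b \<otimes> b \<otimes> (b \<otimes> b) \<noteq> \<one>" using assms dd c_ne_one by (simp add: bb pw_def)
qed

lemma dihedral_not_commuting:
  assumes "s = (False, False)" "t = (False, False)" shows "\<not> commuting_involutions U.V"
  using assms ab_ne by (intro U.not_commuting_involutions_V[of a b]) (simp_all add: aa bb pw_def)

lemma elementary_center: "\<not> e \<Longrightarrow> elementary_center U.V"
  by (rule U.elementary_center_V) (use center_square in blast)

lemma not_elementary_center: "e \<Longrightarrow> \<not> elementary_center U.V"
  by (rule U.not_elementary_center_V[OF d_center]) (simp add: dd c_ne_one)

lemma quaternion_central_involutions:
  assumes "\<not> e" "s = (True, False)" "t = (True, False)" shows "central_involutions U.V"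
proof (rule U.central_involutions_V)
  fix g assume g: "g \<in> carrier G" "g \<notin> center G"
  obtain z i j where z: "z \<in> center G" "g = nf z i j" using nf_surj[OF g(1)] by blast
  then have ij: "i \<or> j" using g nf_center by blast
  have zz: "z \<otimes> z = \<one>" using center_square[OF z(1)] assms by blast
  have "g \<otimes> g = z \<otimes> z \<otimes> (pw c (j \<and> i) \<otimes> (pw (a \<otimes> a) i \<otimes> pw (b \<otimes> b) j))"
    unfolding z nf_square[OF z(1)] using center_closed[OF z(1)] by (simp add: m_assoc)
  \<comment> \<open>All three noncentral cosets square to \<open>c\<close>; for \<open>ab\<close>
    this is \<open>c c c\<close>.\<close>
  also have "\<dots> = c" using ij assms by (cases i; cases j) (simp_all add: zz aa bb pw_def)
  finally have "g \<otimes> g = c" .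
  then have "c \<otimes> g \<otimes> g = \<one>" using g by (simp add: m_assoc)
  then show "inv g = c \<otimes> g" using g by (intro inv_equality) simp_all
qed

lemma C4_C4_commuting:
  assumes "m" "\<not> e" "s = (False, True)" "t = (False, True)" shows "commuting_involutions U.V"
proof (rule U.commuting_involutions_V[OF d_center])
  show d2: "d \<otimes> d = \<one>" using assms by (simp add: dd)
  show "d \<noteq> \<one>" using m_cases assms by blast
  fix g assume g: "g \<in> carrier G" "g \<notin> center G"
  obtain z i j where z: "z \<in> center G" "g = nf z i j" using nf_surj[OF g(1)] by blast
  then have ij: "i \<or> j" using g nf_center by blast
  have zz: "z \<otimes> z = \<one>" using center_square[OF z(1)] assms by blast
  have "g \<otimes> g = z \<otimes> z \<otimes> (pw c (j \<and> i) \<otimes> (pw (a \<otimes> a) i \<otimes> pw (b \<otimes> b) j))"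
    unfolding z nf_square[OF z(1)] using center_closed[OF z(1)] by (simp add: m_assoc)
  \<comment> \<open>Here \<open>a a = b b = d\<close>, whereas \<open>ab\<close> squares to
    \<open>c d d = c\<close>.\<close>
  then have "g \<otimes> g = c \<or> g \<otimes> g = d"
    using ij assms d2 by (cases i; cases j) (simp_all add: zz aa bb pw_def)
  then have "c \<otimes> g \<otimes> g = \<one> \<or> d \<otimes> g \<otimes> g = \<one>" using g d2 by (elim disjE) (simp_all add: m_assoc)
  then show "inv g = c \<otimes> g \<or> inv g = d \<otimes> g" using g inv_equality by auto
qed

text \<open>\<open>b\<close> has square \<open>d\<close>, so \<open>inv b = d b\<close>, and its
  conjugate is \<open>c b\<close>; these differ from \<open>b\<close> and from each other because
  \<open>1\<close>, \<open>c\<close> and \<open>d\<close> are distinct.\<close>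

lemma b_order_four:
  assumes "m" "\<not> e" "t = (False, True)"
  defines "u \<equiv> single \<one> + (single b + single (inv b)) :: _ \<Rightarrow> 'f"
  shows "u \<in> involutions U.V" "conv G (single a) u \<noteq> conv G u (single a)"
proof -
  have bb': "b \<otimes> b = d" using assms by (simp add: bb pw_def)
  have d2: "d \<otimes> d = \<one>" using assms by (simp add: dd)
  have d: "d \<noteq> \<one>" "d \<noteq> c" using m_cases assms by auto
  show "u \<in> involutions U.V"
    by (rule U.one_add_b_add_inv_b[of b]) (simp_all add: bb' d2 u_def)
  have conj: "a \<otimes> b \<otimes> inv a = c \<otimes> b"
  proof -
    have "c \<otimes> (b \<otimes> a) = a \<otimes> b" by (simp add: ba m_assoc[symmetric])
    then show ?thesis by (metis a b c inv_solve_right m_assoc m_closed)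
  qed
  have bne: "b \<noteq> inv b"
  proof
    assume "b = inv b"
    then have "b \<otimes> b = \<one>" using r_inv[OF b] by metis
    then show False using bb' d by simp
  qed
  show "conv G (single a) u \<noteq> conv G u (single a)"
  proof (rule U.one_add_b_add_inv_b_noncommuting[of b a])
    show "b \<noteq> \<one>" using bb' d by auto
    show "a \<otimes> b \<otimes> inv a \<noteq> b" using c_ne_one by (simp add: conj)
    show "a \<otimes> b \<otimes> inv a \<noteq> inv b"
    proof
      assume "a \<otimes> b \<otimes> inv a = inv b"
      then have "c \<otimes> b \<otimes> b = \<one>" using l_inv[OF b] by (simp add: conj)
      then have "c \<otimes> d = \<one>" by (simp add: m_assoc bb')
      then have "c \<otimes> (c \<otimes> d) = c" by simp
      then show False using d by (simp add: m_assoc[symmetric])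
    qed
  qed (simp_all add: bne u_def)
qed

lemma C4_C4_not_central:
  assumes "m" "\<not> e" "t = (False, True)" shows "\<not> central_involutions U.V"
  using U.not_central_involutions_V[OF b_order_four(1)[OF assms] a b_order_four(2)[OF assms]] .

lemma C22_C4_not_commuting:
  assumes "m" "\<not> e" "s = (False, False)" "t = (False, True)" shows "\<not> commuting_involutions U.V"
proof
  assume c: "commuting_involutions U.V"
  have "single a \<in> involutions U.V" using assms by (intro U.single_involution) (simp_all add: aa pw_def)
  then show False
    using c b_order_four[OF assms(1,2,4)] unfolding commuting_involutions_def U.V_simps by blast
qed

text \<open>The cosets of \<open>b\<close> and \<open>ab\<close> contain no involution, as their
  elements square to \<open>d\<close> and \<open>c d\<close>. So \<open>N\<close> consists of the
  centre and the coset of \<open>a\<close>.\<close>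

lemma C22_C4_not_generated:
  assumes "m" "\<not> e" "s = (False, False)" "t = (False, True)" shows "\<not> generated_by_involutions U.V"
proof -
  define N where "N = {nf z i False | z i. z \<in> center G}"
  have iff: "nf z i j \<in> N \<longleftrightarrow> \<not> j" if "z \<in> center G" for z i j
  proof
    assume "nf z i j \<in> N"
    then obtain w k where "w \<in> center G" "nf z i j = nf w k False" by (auto simp: N_def)
    then show "\<not> j" using nf_inj[OF that] by blast
  qed (use that in \<open>auto simp: N_def\<close>)
  show ?thesis
  proof (rule U.not_generated_by_involutions_V[where N = N and b = b])
    fix g h assume g: "g \<in> carrier G" and h: "h \<in> carrier G"
    obtain z i j w k l where zw: "z \<in> center G" "w \<in> center G" and gh: "g = nf z i j" "h = nf w k l"
      using nf_surj[OF g] nf_surj[OF h] by blast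
    have "z \<otimes> (w \<otimes> (pw c (j \<and> k) \<otimes> (pw (a \<otimes> a) (i \<and> k) \<otimes> pw (b \<otimes> b) (j \<and> l)))) \<in> center G"
      using zw by (intro center_mult pw_center c_center aa_center bb_center)
    then show "g \<otimes> h \<in> N \<longleftrightarrow> (g \<in> N \<longleftrightarrow> h \<in> N)"
      unfolding gh nf_mult[OF zw] using zw iff by auto
  next
    fix g assume g: "g \<in> carrier G" "g \<otimes> g = \<one>"
    obtain z i j where z: "z \<in> center G" "g = nf z i j" using nf_surj[OF g(1)] by blast
    have zz: "z \<otimes> z = \<one>" using center_square[OF z(1)] assms by blast
    have "g \<otimes> g = z \<otimes> z \<otimes> (pw c (j \<and> i) \<otimes> (pw (a \<otimes> a) i \<otimes> pw (b \<otimes> b) j))"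
      unfolding z nf_square[OF z(1)] using center_closed[OF z(1)] by (simp add: m_assoc)
    then have eq: "pw c (j \<and> i) \<otimes> pw d j = \<one>" using g assms by (simp add: zz aa bb pw_def split: if_splits)
    have "\<not> j"
    proof
      assume j
      then have "pw c i \<otimes> d = \<one>" using eq by (simp add: pw_def)
      then have "pw c i \<otimes> (pw c i \<otimes> d) = pw c i" by simp
      then have "d = pw c i" by (cases i) (simp_all add: pw_def m_assoc[symmetric])
      then show False using m_cases assms by (cases i) (simp_all add: pw_def)
    qed
    then show "g \<in> N" using z iff by blast
  next
    have "b = nf \<one> False True" by (simp add: nf_def pw_def)
    then show "b \<notin> N" using iff[OF one_center] by metis
  qed simp
qed

lemma dihedral_generated:
  assumes "\<not> e" "s = (False, False)" "t = (False, False)" shows "generated_by_involutions U.V"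
proof -
  interpret W: involution_pair_algebra G F c a b
  proof unfold_locales
    show "a \<otimes> a = \<one>" "b \<otimes> b = \<one>" using assms by (simp_all add: aa bb pw_def)
    show "z \<otimes> z = \<one>" if "z \<in> center G" for z using center_square[OF that] assms by blast
  qed (use ab_ne cover in auto)
  show ?thesis by (rule W.generated_by_involutions_V)
qed

lemma card_lower:
  assumes "\<not> snd s" "\<not> snd t"
  shows "card (UNIV :: 'f set) ^ order G \<le> card (carrier U.V) * card (carrier U.V)"
  unfolding order_def
proof (rule U.card_V_lower)
  fix g assume g: "g \<in> carrier G"
  obtain z i j where z: "z \<in> center G" "g = nf z i j" using nf_surj[OF g] by blast
  then show "g \<otimes> g = \<one> \<or> g \<otimes> g = c" using square_nf_cases[OF z(1) assms] by blast
qed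

lemma card_upper: "card (carrier U.V) < card (UNIV :: 'f set) ^ order G"
  unfolding order_def by (rule U.card_V_upper)

lemma order_kind: "order G = (if m then 16 else 8)"
  using order_eq card_center by simp

end

section \<open>Properties of the dihedral, semidihedral and quaternion groups of order
  sixteen\<close>

locale dihedral_kind_algebra = dihedral_pres G a b e f
  for G (structure) and a b e f +
  fixes F :: "'f::{field,finite} itself"
  assumes char_2: "CHAR('f) = 2"
begin

sublocale U: central_involution_algebra G F "P 4"
  by unfold_locales (use char_2 P4_center in \<open>auto simp: P_one_iff P_add\<close>)

lemma not_exponent_four: "\<not> exponent_four U.V"
  by (rule U.not_exponent_four_V[of "P 1"]) (simp_all add: P_add P_one_iff)

lemma not_central_squares: "\<not> central_squares U.V"
proof (rule U.not_central_squares_V[of "P 1" b])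
  have "P 2 \<otimes> b \<noteq> P (e * 2) \<otimes> b" using e by (auto simp: P_eq_iff)
  then show "P 1 \<otimes> P 1 \<otimes> b \<noteq> b \<otimes> (P 1 \<otimes> P 1)" by (simp only: P_add one_add_one b_P not_False_eq_True)
qed simp_all

text \<open>\<open>ab\<close> and \<open>b\<close> are involutions whose product \<open>a\<close>
  has order eight.\<close>

lemma D16_not_four:
  assumes "e = 7" "f = 0" shows "\<not> involution_products_four U.V"
proof (rule U.not_involution_products_four_V[of "P 1 \<otimes> b" b])
  show "P 1 \<otimes> b \<otimes> (P 1 \<otimes> b) = \<one>" unfolding P_b_mult using assms by (simp add: P_one_iff)
  show bb'': "b \<otimes> b = \<one>" using assms by (simp add: bb')
  have "P 1 \<otimes> b \<otimes> b = P 1" using bb'' by (simp add: m_assoc)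
  then show "P 1 \<otimes> b \<otimes> b \<otimes> (P 1 \<otimes> b \<otimes> b) \<otimes> (P 1 \<otimes> b \<otimes> b \<otimes> (P 1 \<otimes> b \<otimes> b)) \<noteq> \<one>"
    by (simp add: P_add P_one_iff)
qed simp_all

text \<open>\<open>a^2 b\<close> and \<open>b\<close> are involutions with products
  \<open>a^2\<close> and \<open>a^6\<close> in the two orders. Writing \<open>b\<close> as
  \<open>P 0 \<otimes> b\<close> lets \<open>P_b_mult\<close> apply to both.\<close>

lemma SD16_not_commuting:
  assumes "e = 3" "f = 0" shows "\<not> commuting_involutions U.V"
proof (rule U.not_commuting_involutions_V[of "P 2 \<otimes> b" "P 0 \<otimes> b"])
  show "P 2 \<otimes> b \<otimes> (P 2 \<otimes> b) = \<one>" "P 0 \<otimes> b \<otimes> (P 0 \<otimes> b) = \<one>"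
    unfolding P_b_mult using assms by (simp_all add: P_one_iff)
  show "P 2 \<otimes> b \<otimes> (P 0 \<otimes> b) \<noteq> P 0 \<otimes> b \<otimes> (P 2 \<otimes> b)"
    unfolding P_b_mult using assms by (simp add: P_eq_iff)
qed simp_all

text \<open>Outer elements invert the cyclic subgroup and all have square
  \<open>a^(i + 7 i + 4) = a^4\<close>.\<close>

lemma Q16_commuting:
  assumes "e = 7" "f = 4" shows "commuting_involutions U.V"
proof (rule U.commuting_involutions_index_two[OF A_subgroup A_index_two A_comm])
  fix k g assume "k \<in> A" and g: "g \<in> carrier G - A"
  then obtain j where j: "k = P j" by (auto simp: A_def)
  show "inv g \<otimes> k \<otimes> g = inv k" using A_conj[OF g, of j] assms by (simp add: j P_inv)
next
  fix g assume g: "g \<in> carrier G - A"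
  then obtain i where i: "g = P i \<otimes> b" using A_cases[of g] by blast
  have "P (4 + i) \<otimes> b \<otimes> (P i \<otimes> b) = \<one>"
    unfolding P_b_mult P_one_iff assms by (simp add: mod_eq_0_iff_dvd)
  then show "inv g = P 4 \<otimes> g" using g unfolding i by (intro inv_equality) (simp_all add: P_add')
qed simp_all

text \<open>Outer elements send \<open>a^j\<close> to \<open>a^(3 j)\<close>, which is
  \<open>a^-j\<close> for even \<open>j\<close> and \<open>a^(4 - j)\<close> for odd
  \<open>j\<close>. The square of \<open>a^i b\<close> is \<open>a^(4 i)\<close>, so outer
  involutions have even \<open>i\<close>, and two of them commute up to \<open>a^4\<close>.\<close>

lemma SD16_four:
  assumes "e = 3" "f = 0" shows "involution_products_four U.V"
proof (rule U.involution_products_four_index_two[OF A_subgroup A_index_two A_comm])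
  fix k g assume "k \<in> A" and g: "g \<in> carrier G - A"
  then obtain j where j: "k = P j" by (auto simp: A_def)
  have "P (3 * j) = P (7 * j) \<or> P (3 * j) = P (4 + 7 * j)"
  proof (cases "even j")
    case True
    then obtain i where "j = 2 * i" by blast
    then have "7 * j = 3 * j + 8 * i" by simp
    then have "(7 * j) mod 8 = (3 * j) mod 8" by (simp only: mod_mult_self2)
    then show ?thesis by (simp add: P_eq_iff)
  next
    case False
    then obtain i where "j = 2 * i + 1" using oddE by blast
    then have "4 + 7 * j = 3 * j + 8 * (i + 1)" by simp
    then have "(4 + 7 * j) mod 8 = (3 * j) mod 8" by (simp only: mod_mult_self2)
    then show ?thesis by (simp add: P_eq_iff)
  qed
  then show "inv g \<otimes> k \<otimes> g = inv k \<or> inv g \<otimes> k \<otimes> g = P 4 \<otimes> inv k"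
    using A_conj[OF g, of j] assms by (simp add: j P_inv P_add)
next
  fix g assume g: "g \<in> carrier G - A" "g \<otimes> g \<noteq> \<one>"
  then obtain i where i: "g = P i \<otimes> b" using A_cases[of g] by blast
  have gg: "g \<otimes> g = P (4 * i)" unfolding i P_b_mult using assms by simp
  have "odd i"
  proof
    assume "even i"
    then obtain k where "i = 2 * k" by blast
    then show False using g gg by (simp add: P_one_iff)
  qed
  then obtain k where k: "i = 2 * k + 1" using oddE by blast
  have "P (4 + i) \<otimes> b \<otimes> (P i \<otimes> b) = P (8 * (k + 1))" unfolding P_b_mult using assms by (simp add: k)
  also have "\<dots> = \<one>" unfolding P_one_iff by simp
  finally show "inv g = P 4 \<otimes> g" unfolding i by (intro inv_equality) (simp_all add: P_add')
next
  fix g h assume g: "g \<in> carrier G - A" "g \<otimes> g = \<one>" and h: "h \<in> carrier G - A" "h \<otimes> h = \<one>"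
  obtain i where i: "g = P i \<otimes> b" using g A_cases[of g] by blast
  obtain j where j: "h = P j \<otimes> b" using h A_cases[of h] by blast
  have ev: "even k" if "P k \<otimes> b \<otimes> (P k \<otimes> b) = \<one>" for k
  proof (rule ccontr)
    assume "odd k"
    then obtain l where "k = 2 * l + 1" using oddE by blast
    moreover have "(4 * k) mod 8 = 0" using that unfolding P_b_mult P_one_iff assms by simp
    ultimately show False by (simp add: mod_eq_0_iff_dvd)
  qed
  obtain k l where kl: "i = 2 * k" "j = 2 * l" using ev[of i] ev[of j] g h i j by blast
  have gh: "g \<otimes> h = P (i + 3 * j)" "h \<otimes> g = P (j + 3 * i)" unfolding i j P_b_mult using assms by simp_all
  show "h \<otimes> g = g \<otimes> h \<or> h \<otimes> g = P 4 \<otimes> (g \<otimes> h)"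
  proof (cases "even (k + l)")
    case True
    then obtain n where "k + l = 2 * n" by blast
    then have "j + 3 * i + 8 * l = i + 3 * j + 8 * n" by (simp add: kl)
    then have "(j + 3 * i) mod 8 = (i + 3 * j) mod 8" by (metis mod_mult_self2)
    then show ?thesis by (simp add: gh P_eq_iff)
  next
    case False
    then obtain n where "k + l = 2 * n + 1" using oddE by blast
    then have "j + 3 * i + 8 * (l + 1) = 4 + (i + 3 * j) + 8 * (n + 1)" by (simp add: kl)
    then have "(j + 3 * i) mod 8 = (4 + (i + 3 * j)) mod 8" by (metis mod_mult_self2)
    then show ?thesis by (simp add: gh P_add P_eq_iff)
  qed
qed simp_all

end

text \<open>To be read as a decision tree. The first two lines split off \<open>M16\<close> and the
  three kinds \<open>D16\<close>, \<open>SD16\<close>, \<open>Q16\<close>; there involution products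
  single out \<open>D16\<close>, and commuting involutions separate the other two. Among the
  remaining seven, commuting involutions separate \<open>Q8\<close>, \<open>Q8_C2\<close>,
  \<open>C4_C4\<close> from the rest; \<open>C4_C4\<close> then falls to centrality of involutions,
  \<open>D8_C4\<close> to the centre, \<open>C22_C4\<close> to generation, and the orders settle
  what is left.\<close>

definition kind_properties :: "kind \<Rightarrow> nat \<Rightarrow> ('v, 'k) monoid_scheme \<Rightarrow> bool" where
  "kind_properties k q V \<longleftrightarrow>
     (exponent_four V \<longleftrightarrow> k \<notin> {M16, D16, SD16, Q16}) \<and>
     (central_squares V \<longleftrightarrow> k \<notin> {D16, SD16, Q16}) \<and>
     (k \<in> {Q8, Q8_C2, C4_C4, Q16} \<longrightarrow> commuting_involutions V) \<and>
     (k \<in> {D8, D8_C2, C22_C4, D8_C4, SD16} \<longrightarrow> \<not> commuting_involutions V) \<and>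
     (k \<in> {Q8, Q8_C2} \<longrightarrow> central_involutions V) \<and>
     (k = C4_C4 \<longrightarrow> \<not> central_involutions V) \<and>
     (k \<in> {D8, D8_C2, C22_C4} \<longrightarrow> elementary_center V) \<and>
     (k = D8_C4 \<longrightarrow> \<not> elementary_center V) \<and>
     (k \<in> {D8, D8_C2} \<longrightarrow> generated_by_involutions V) \<and>
     (k = C22_C4 \<longrightarrow> \<not> generated_by_involutions V) \<and>
     (k = D16 \<longrightarrow> \<not> involution_products_four V) \<and>
     (k \<in> {SD16, Q16} \<longrightarrow> involution_products_four V) \<and>
     (k \<in> {D8, Q8} \<longrightarrow> card (carrier V) < q ^ 8) \<and>
     (k \<in> {D8_C2, Q8_C2} \<longrightarrow> q ^ 16 \<le> card (carrier V) * card (carrier V))"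

lemma commuting_imp_involution_products_four:
  assumes "group M" "commuting_involutions M" shows "involution_products_four M"
  unfolding involution_products_four_def
proof (intro ballI)
  interpret group M by fact
  fix x y assume "x \<in> involutions M" "y \<in> involutions M"
  then have xy: "x \<in> carrier M" "y \<in> carrier M" "x \<otimes>\<^bsub>M\<^esub> x = \<one>\<^bsub>M\<^esub>" "y \<otimes>\<^bsub>M\<^esub> y = \<one>\<^bsub>M\<^esub>"
    and comm: "x \<otimes>\<^bsub>M\<^esub> y = y \<otimes>\<^bsub>M\<^esub> x"
    using assms(2) unfolding commuting_involutions_def involutions_def by blast+
  have "x \<otimes>\<^bsub>M\<^esub> y \<otimes>\<^bsub>M\<^esub> (x \<otimes>\<^bsub>M\<^esub> y) = x \<otimes>\<^bsub>M\<^esub> y \<otimes>\<^bsub>M\<^esub> (y \<otimes>\<^bsub>M\<^esub> x)" by (simp only: comm)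
  also have "\<dots> = x \<otimes>\<^bsub>M\<^esub> (y \<otimes>\<^bsub>M\<^esub> y) \<otimes>\<^bsub>M\<^esub> x" using xy(1,2) by (simp add: m_assoc)
  finally have "x \<otimes>\<^bsub>M\<^esub> y \<otimes>\<^bsub>M\<^esub> (x \<otimes>\<^bsub>M\<^esub> y) = \<one>\<^bsub>M\<^esub>" using xy by simp
  then show "x \<otimes>\<^bsub>M\<^esub> y \<otimes>\<^bsub>M\<^esub> (x \<otimes>\<^bsub>M\<^esub> y) \<otimes>\<^bsub>M\<^esub> (x \<otimes>\<^bsub>M\<^esub> y \<otimes>\<^bsub>M\<^esub> (x \<otimes>\<^bsub>M\<^esub> y)) = \<one>\<^bsub>M\<^esub>" by simp
qed

lemma kind_properties_unitary:
  fixes G :: "('g, 'm) monoid_scheme"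
  assumes char: "CHAR('f::{field,finite}) = 2" and fin: "finite_group G" and k: "of_kind k G"
  shows "kind_properties k (card (UNIV :: 'f set)) (unitary_subgroup TYPE('f) G)"
proof -
  have central: "central_kind_algebra TYPE('f) G a b c d m e s t" if K: "central_kind m e s t G a b c d" for m e s t a b c d
  proof -
    interpret finite_group G by fact
    show ?thesis by unfold_locales (use K char in \<open>simp_all add: central_kind_def\<close>)
  qed
  have dihedral: "dihedral_kind_algebra TYPE('f) G a b e f"
    if K: "dihedral_kind e f G a b" "e = 3 \<or> e = 7" "f = 0 \<or> f = 4" for a b e f
  proof -
    interpret finite_group G by fact
    show ?thesis by unfold_locales (use K char in simp_all)
  qed
  show ?thesis
  proof (cases k)
    case D8
    then obtain a b c d where "central_kind False False (False, False) (False, False) G a b c d" using k by auto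
    then interpret L: central_kind_algebra G a b c d False False "(False, False)" "(False, False)" "TYPE('f)"
      by (rule central)
    show ?thesis using L.card_upper L.order_kind
      by (simp add: kind_properties_def D8 L.exponent_four L.U.central_squares_V L.dihedral_not_commuting
          L.elementary_center L.dihedral_generated)
  next
    case Q8
    then obtain a b c d where "central_kind False False (True, False) (True, False) G a b c d" using k by auto
    then interpret L: central_kind_algebra G a b c d False False "(True, False)" "(True, False)" "TYPE('f)"
      by (rule central)
    show ?thesis using L.card_upper L.order_kind
      by (simp add: kind_properties_def Q8 L.exponent_four L.U.central_squares_V
          L.quaternion_central_involutions central_involutions_imp_commuting)
  next
    case D8_C2
    then obtain a b c d where "central_kind True False (False, False) (False, False) G a b c d" using k by auto
    then interpret L: central_kind_algebra G a b c d True False "(False, False)" "(False, False)" "TYPE('f)"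
      by (rule central)
    show ?thesis using L.card_lower L.order_kind
      by (simp add: kind_properties_def D8_C2 L.exponent_four L.U.central_squares_V L.dihedral_not_commuting
          L.elementary_center L.dihedral_generated)
  next
    case Q8_C2
    then obtain a b c d where "central_kind True False (True, False) (True, False) G a b c d" using k by auto
    then interpret L: central_kind_algebra G a b c d True False "(True, False)" "(True, False)" "TYPE('f)"
      by (rule central)
    show ?thesis using L.card_lower L.order_kind
      by (simp add: kind_properties_def Q8_C2 L.exponent_four L.U.central_squares_V
          L.quaternion_central_involutions central_involutions_imp_commuting)
  next
    case C22_C4
    then obtain a b c d where "central_kind True False (False, False) (False, True) G a b c d" using k by auto
    then interpret L: central_kind_algebra G a b c d True False "(False, False)" "(False, True)" "TYPE('f)"
      by (rule central)
    show ?thesis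
      by (simp add: kind_properties_def C22_C4 L.exponent_four L.U.central_squares_V L.C22_C4_not_commuting
          L.elementary_center L.C22_C4_not_generated)
  next
    case C4_C4
    then obtain a b c d where "central_kind True False (False, True) (False, True) G a b c d" using k by auto
    then interpret L: central_kind_algebra G a b c d True False "(False, True)" "(False, True)" "TYPE('f)"
      by (rule central)
    show ?thesis
      by (simp add: kind_properties_def C4_C4 L.exponent_four L.U.central_squares_V L.C4_C4_commuting
          L.C4_C4_not_central)
  next
    case D8_C4
    then obtain a b c d where "central_kind True True (False, False) (False, False) G a b c d" using k by auto
    then interpret L: central_kind_algebra G a b c d True True "(False, False)" "(False, False)" "TYPE('f)"
      by (rule central)
    show ?thesis
      by (simp add: kind_properties_def D8_C4 L.exponent_four L.U.central_squares_V L.dihedral_not_commuting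
          L.not_elementary_center)
  next
    case M16
    then obtain a b c d where "central_kind True True (False, False) (False, True) G a b c d" using k by auto
    then interpret L: central_kind_algebra G a b c d True True "(False, False)" "(False, True)" "TYPE('f)"
      by (rule central)
    show ?thesis
      by (simp add: kind_properties_def M16 L.not_exponent_four L.U.central_squares_V)
  next
    case D16
    then obtain a b where "dihedral_kind 7 0 G a b" using k by auto
    then interpret L: dihedral_kind_algebra G a b 7 0 "TYPE('f)" by (rule dihedral) simp_all
    show ?thesis
      by (simp add: kind_properties_def D16 L.not_exponent_four L.not_central_squares L.D16_not_four)
  next
    case SD16
    then obtain a b where "dihedral_kind 3 0 G a b" using k by auto
    then interpret L: dihedral_kind_algebra G a b 3 0 "TYPE('f)" by (rule dihedral) simp_all
    show ?thesis
      by (simp add: kind_properties_def SD16 L.not_exponent_four L.not_central_squares L.SD16_not_commuting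
          L.SD16_four)
  next
    case Q16
    then obtain a b where "dihedral_kind 7 4 G a b" using k by auto
    then interpret L: dihedral_kind_algebra G a b 7 4 "TYPE('f)" by (rule dihedral) simp_all
    show ?thesis
      by (simp add: kind_properties_def Q16 L.not_exponent_four L.not_central_squares L.Q16_commuting
          commuting_imp_involution_products_four[OF L.U.group_V])
  qed
qed

lemma kind_properties_iso:
  assumes V: "group V" "group W" "V \<cong> W" and k: "kind_properties k q V" and l: "kind_properties l q W"
  shows "k = l"
proof -
  obtain \<phi> where "\<phi> \<in> iso V W" using V(3) by (auto simp: is_iso_def)
  then interpret P: group_iso_pair V W \<phi>
    using V by (simp add: group_iso_pair_def group_iso_pair_axioms_def)
  obtain \<psi> where "\<psi> \<in> iso W V"
    using group.iso_sym[OF V(1,3)] by (auto simp: is_iso_def)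
  then interpret Q: group_iso_pair W V \<psi>
    using V by (simp add: group_iso_pair_def group_iso_pair_axioms_def)
  have gen: "generated_by_involutions W \<longleftrightarrow> generated_by_involutions V"
    using P.generated_by_involutions_iso_imp Q.generated_by_involutions_iso_imp by blast
  have card: "card (carrier W) = card (carrier V)" using bij_betw_same_card[OF P.bij] by simp
  \<comment> \<open>The bound below \<open>q^8\<close> squares to one below \<open>q^16\<close>, so
    the order bounds of the last two lines of \<open>kind_properties\<close> exclude each
    other.\<close>
  have size: "\<not> q ^ 16 \<le> card (carrier V) * card (carrier V)" if "card (carrier V) < q ^ 8"
  proof -
    have "card (carrier V) * card (carrier V) < q ^ 8 * q ^ 8" using that by (intro mult_strict_mono') simp_all
    moreover have "q ^ 8 * q ^ 8 = q ^ 16" by (simp add: power_add[symmetric])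
    ultimately show ?thesis by linarith
  qed
  note iso = P.exponent_four_iso P.central_squares_iso P.commuting_involutions_iso P.central_involutions_iso
    P.elementary_center_iso P.involution_products_four_iso gen card
  show ?thesis
    using k l size unfolding kind_properties_def iso by (cases k; cases l) simp_all
qed

theorem theorem3:
  fixes G :: "('g, 'm) monoid_scheme" and H :: "('h, 'n) monoid_scheme"
  assumes "CHAR('f::{field,finite}) = 2"
    and "two_group G" and "\<not> comm_group G" and "order G \<le> 2 ^ 4"
    and "two_group H" and "\<not> comm_group H" and "order H \<le> 2 ^ 4"
    and "unitary_subgroup TYPE('f) G \<cong> unitary_subgroup TYPE('f) H"
  shows "G \<cong> H"
proof -
  have fin: "finite_group M" if "two_group M" for M :: "('x, 'y) monoid_scheme"
  proof -
    \<comment> \<open>An infinite carrier would have order 0, which is not a power of two.\<close>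
    have "order M > 0" using that by (auto simp: two_group_def)
    then have "finite (carrier M)" unfolding order_def by (rule card_ge_0_finite)
    then show ?thesis using that by (simp add: two_group_def finite_group_def finite_group_axioms_def)
  qed
  have G: "finite_group G" and H: "finite_group H" using fin assms by blast+
  obtain k where k: "of_kind k G"
    using finite_group.of_kind_exists[OF G] assms(2-4) by (auto simp: two_group_def)
  obtain l where l: "of_kind l H"
    using finite_group.of_kind_exists[OF H] assms(5-7) by (auto simp: two_group_def)
  have "k = l"
    by (rule kind_properties_iso[OF finite_group.group_unitary[OF G] finite_group.group_unitary[OF H] assms(8)
          kind_properties_unitary[OF assms(1) G k] kind_properties_unitary[OF assms(1) H l]])
  then show ?thesis using of_kind_iso[OF G H k] l by simp
qed

end
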